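(* Let $f\in\mathcal F(\mathbb R^n)$ and let $(\sigma_1,\dots,\sigma_m)$ be a $1$-reducible $s$-cover of $[n]$. Then $$\|f\|_\infty^{m-s}\left(\int_{\mathbb R^n}f(x)\,dx\right)^s\geq \frac{\prod_{j=1}^m|\sigma_j|!}{(n!)^s}\prod_{j=1}^m\int_{H_{\sigma_j}}f(x)\,dx.$$ Moreover, equality holds if and only if $f=\|f\|_\infty\chi_C$, where $$C=\mathrm{conv}\left(\bigcup_{j=1}^k \{0\}^{|\overline{\sigma}_1|}\times\cdots\times \{0\}^{|\overline{\sigma}_{j-1}|}\times K_j\times \{0\}^{|\overline{\sigma}_{j+1}|}\times\cdots\times \{0\}^{|\overline{\sigma}_k|}\right)$$ for some $K_j\in\mathcal K^{|\overline{\sigma}_j|}$ with $0\in K_j$, $j=1,\dots,k$, and where $(\overline{\sigma}_1,\dots,\overline{\sigma}_k)$ is the $1$-cover of $[n]$ induced by the $s$-cover $(\sigma_1,\dots,\sigma_m)$.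
   Context: $[n]=\{1,\dots,n\}$; $e_1,\dots,e_n$ is the canonical basis of $\mathbb R^n$; for $\sigma\subseteq[n]$, $H_\sigma=\langle\{e_i:i\in\sigma\}\rangle$, and integrals over $H_\sigma$ are with respect to $|\sigma|$-dimensional Lebesgue measure. $\mathcal K^d$ is the set of $d$-dimensional convex bodies of $\mathbb R^d$ (convex compact sets with non-empty interior). $\chi_C$ is the characteristic function of $C$; $\mathrm{conv}$ is the convex hull; $\|f\|_\infty=\sup f$. A function $f:\mathbb R^n\to[0,+\infty)$ is log-concave if $f((1-\lambda)x+\lambda y)\ge f(x)^{1-\lambda}f(y)^\lambda$ for all $x,y\in\mathbb R^n$, $\lambda\in[0,1]$. $\mathcal F(\mathbb R^n)$ is the set of integrable log-concave functions whose domain is a convex subset of $\mathbb R^n$ (extended by $0$ outside the domain). For positive integers $m,s$ and $\sigma\subseteq[n]$, $(\sigma_1,\dots,\sigma_m)$ is an $s$-cover of $\sigma$ if $\sigma_i\subseteq\sigma$ for all $i$ and $|\{i:j\in\sigma_i\}|=s$ for every $j\in\sigma$. It is $1$-reducible if it can be reordered as $(\sigma_{1_1},\dots,\sigma_{1_{i_1}},\dots,\sigma_{s_1},\dots,\sigma_{s_{i_s}})$ so that $(\sigma_{j_1},\dots,\sigma_{j_{i_j}})$ is a $1$-cover of $\sigma$ for every $j=1,\dots,s$. The $1$-cover of $\sigma$ induced by $(\sigma_1,\dots,\sigma_m)$ is the list $(\overline\sigma_1,\dots,\overline\sigma_k)$ of all distinct non-empty sets of the form $\bigcap_{j=1}^m\sigma_j^{\varepsilon(j)}$,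 $\varepsilon(j)\in\{0,1\}$, where $\sigma_j^0=\sigma_j$, $\sigma_j^1=\sigma\setminus\sigma_j$. The products in the definition of $C$ are taken with respect to the decomposition $\mathbb R^n=H_{\overline\sigma_1}\oplus\cdots\oplus H_{\overline\sigma_k}$, identifying $H_{\overline\sigma_j}$ with $\mathbb R^{|\overline\sigma_j|}$. Convention for equality cases: the values of a log-concave function on the boundary of its support $\mathrm{supp}(f)=\{f>0\}$ are disregarded, i.e. $f$ is replaced by $\hat f(x)=\limsup_{y\to x,\ y\in\mathrm{int}(\mathrm{supp}(f))}f(y)$, defined on $\mathrm{cl}(\mathrm{supp}(f))$ (this presupposes $\mathrm{int}(\mathrm{supp}(f))\ne\emptyset$).
   Formalization: The "only if" part of the equality case is proved for k ≥ 2; for k = 1 every σ_j is [n] or empty and it is false: f = exp(−|x|) gives equality but is not a multiple of a characteristic function. The inequality and the "if" part hold for all k. *)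

theory Defs
  imports "HOL-Analysis.Analysis" "HOL-Library.Multiset"
begin

text \<open>
  \<open>\<real>\<^sup>n\<close> is \<^typ>\<open>real ^ 'n\<close>; the index set \<open>[n]\<close> is \<open>UNIV :: 'n set\<close>, so \<open>n = CARD('n) \<ge> 1\<close>.
  Integrals and suprema of nonnegative functions take values in \<^typ>\<open>ennreal\<close>, because an
  integrable log-concave function whose support has empty interior need not be bounded.
\<close>

subsection \<open>Log-concave functions\<close>

text \<open>Isabelle has \<open>0 powr 0 = 0\<close> instead of \<open>1\<close>; this only concerns \<open>l = 0\<close> and \<open>l = 1\<close>, where
  the inequality holds under both conventions.\<close>

definition log_concave :: "(real ^ 'n \<Rightarrow> real) \<Rightarrow> bool" where
  "log_concave f \<longleftrightarrow> (\<forall>x. 0 \<le> f x) \<and>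
     (\<forall>x y. \<forall>l\<in>{0..1}. f ((1 - l) *\<^sub>R x + l *\<^sub>R y) \<ge> f x powr (1 - l) * f y powr l)"

definition integrable_log_concave :: "(real ^ 'n \<Rightarrow> real) set" where
  "integrable_log_concave = {f. log_concave f \<and> integrable lebesgue f}"

definition sup_norm :: "(real ^ 'n \<Rightarrow> real) \<Rightarrow> ennreal" where
  "sup_norm f = (SUP x. ennreal (f x))"

definition supp :: "(real ^ 'n \<Rightarrow> real) \<Rightarrow> (real ^ 'n) set" where
  "supp f = {x. f x > 0}"

text \<open>The representative \<open>f^\<close> used in the equality case, extended by \<open>0\<close> outside the closure of the
  support. It is meant for integrable \<open>f\<close> with \<open>interior (supp f) \<noteq> {}\<close>; then \<open>f\<close> is bounded, so
  the upper limit is finite.\<close>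

definition boundary_reg :: "(real ^ 'n \<Rightarrow> real) \<Rightarrow> real ^ 'n \<Rightarrow> real" where
  "boundary_reg f x =
     (if x \<in> closure (supp f)
      then enn2real (Limsup (at x within interior (supp f)) (\<lambda>y. ennreal (f y)))
      else 0)"

subsection \<open>Coordinate subspaces\<close>

definition coord_subspace :: "'n set \<Rightarrow> (real ^ 'n) set" where
  "coord_subspace A = span {axis i 1 | i. i \<in> A}"

text \<open>\<open>|A|\<close>-dimensional Lebesgue measure on \<open>coord_subspace A\<close>, as a measure on all of \<open>\<real>\<^sup>n\<close>
  concentrated on that subspace. For \<open>A = {}\<close> it is the unit mass at \<open>0\<close>. The completion is needed
  because log-concave functions need not be Borel measurable.\<close>

definition coord_lebesgue :: "'n::finite set \<Rightarrow> (real ^ 'n) measure" where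
  "coord_lebesgue A =
     completion (distr (Pi\<^sub>M A (\<lambda>_. lborel)) borel (\<lambda>g. \<chi> i. if i \<in> A then g i else 0))"

text \<open>A \<open>|A|\<close>-dimensional convex body, under the identification of \<open>\<real>\<^bsup>|A|\<^esup>\<close> with
  \<open>coord_subspace A\<close>; the interior is the one relative to that subspace.\<close>

definition convex_body_in :: "'n set \<Rightarrow> (real ^ 'n) set \<Rightarrow> bool" where
  "convex_body_in A K \<longleftrightarrow> K \<subseteq> coord_subspace A \<and> convex K \<and> compact K \<and>
     (top_of_set (coord_subspace A)) interior_of K \<noteq> {}"

subsection \<open>Covers\<close>

definition is_cover :: "nat \<Rightarrow> 'a set list \<Rightarrow> 'a set \<Rightarrow> bool" where
  "is_cover s S A \<longleftrightarrow> 0 < s \<and> 0 < length S \<and> (\<forall>i<length S. S ! i \<subseteq> A) \<and>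
     (\<forall>j\<in>A. card {i. i < length S \<and> j \<in> S ! i} = s)"

text \<open>The list \<open>concat B\<close> is the reordering of \<open>S\<close>, and the entries of \<open>B\<close> are its \<open>s\<close> blocks.\<close>

definition one_reducible :: "nat \<Rightarrow> 'a set list \<Rightarrow> 'a set \<Rightarrow> bool" where
  "one_reducible s S A \<longleftrightarrow>
     (\<exists>B. length B = s \<and> mset (concat B) = mset S \<and> (\<forall>b\<in>set B. is_cover 1 b A))"

text \<open>The induced \<open>1\<close>-cover, as the set of its (distinct, non-empty) members; their order is
  immaterial. The value \<open>True\<close> of \<open>e j\<close> stands for the exponent \<open>1\<close>, that is, the complement.\<close>

definition induced_cover :: "'a set list \<Rightarrow> 'a set \<Rightarrow> 'a set set" where
  "induced_cover S A =
     {\<Inter>j\<in>{..<length S}. if e j then A - S ! j else S ! j | e :: nat \<Rightarrow> bool. True} - {{}}"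

subsection \<open>The two sides of the inequality and the extremal functions\<close>

text \<open>A \<open>1\<close>-reducible \<open>s\<close>-cover has at least \<open>s\<close> members, so \<open>length S - s\<close> does not truncate.\<close>

definition lhs :: "nat \<Rightarrow> 'n::finite set list \<Rightarrow> (real ^ 'n \<Rightarrow> real) \<Rightarrow> ennreal" where
  "lhs s S f = sup_norm f ^ (length S - s) * (\<integral>\<^sup>+x. ennreal (f x) \<partial>lebesgue) ^ s"

definition rhs :: "nat \<Rightarrow> 'n::finite set list \<Rightarrow> (real ^ 'n \<Rightarrow> real) \<Rightarrow> ennreal" where
  "rhs s S f =
     ennreal ((\<Prod>j<length S. fact (card (S ! j))) / (fact CARD('n)) ^ s) *
     (\<Prod>j<length S. \<integral>\<^sup>+x. ennreal (f x) \<partial>coord_lebesgue (S ! j))"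

definition extremal :: "'n::finite set list \<Rightarrow> (real ^ 'n \<Rightarrow> real) \<Rightarrow> bool" where
  "extremal S f \<longleftrightarrow>
     (\<exists>K. (\<forall>A\<in>induced_cover S UNIV. convex_body_in A (K A) \<and> 0 \<in> K A) \<and>
       (\<forall>x. ennreal (f x) =
          sup_norm f * indicator (convex hull (\<Union>A\<in>induced_cover S UNIV. K A)) x))"

end

theory Submission
  imports Defs
begin

text \<open>
  For a set \<open>K\<close> let \<open>F_K z = \<integral> e\<^sup>-\<^sup>r 1_K (z / r) dr\<close>, the integral being over \<open>r > 0\<close>; its integral over a
  \<open>d\<close>-dimensional space is \<open>d!\<close> times the volume of \<open>K\<close>. If \<open>K\<close> is convex, then
  \<open>F_K (x + y) \<ge> F_K x * F_K y\<close>, so \<open>|A|! vol (K \<inter> H_A) * |B|! vol (K \<inter> H_B) \<le> |A \<union> B|! vol (K \<inter> H_(A \<union> B))\<close>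
  for disjoint \<open>A\<close> and \<open>B\<close>. A function \<open>g\<close> with supremum \<open>1\<close> inherits this from its level sets, because
  \<open>min (g x) (g y) \<ge> g x * g y\<close>; iterating over the members of a \<open>1\<close>-cover and multiplying over the \<open>s\<close>
  blocks gives the inequality.

  Equality forces equality for every pair \<open>A\<close>, \<open>-A\<close> with \<open>A\<close> in the cover. Then \<open>g\<close> takes only the values
  \<open>0\<close> and \<open>1\<close> almost everywhere on \<open>H_A\<close> or on \<open>H_(-A)\<close>, almost all level sets contain \<open>0\<close> and are the hull
  of their two sections (the hull has at least the same volume), and log-concavity makes \<open>g\<close> the indicator
  of a set \<open>C\<close>. Each extreme point of \<open>C\<close> lies in \<open>H_A \<union> H_(-A)\<close> for every \<open>A\<close> in the cover, hence in
  \<open>H_X\<close> for a member \<open>X\<close> of the induced \<open>1\<close>-cover, so Krein--Milman describes \<open>C\<close>.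
\<close>

subsection \<open>Lebesgue measure on coordinate subspaces\<close>

text \<open>When \<open>0 \<in> K\<close>, \<open>F_K\<close> is \<open>exp\<close> of minus the
  gauge of \<open>K\<close>, and its inequality is subadditivity of the gauge. Level sets need not
  contain \<open>0\<close>, so the radii \<open>r\<close> with \<open>z / r \<in> K\<close> need not
  form a half-line. What survives is that radii of \<open>x\<close> and \<open>y\<close> add up to
  radii of \<open>x + y\<close>, and that shifting a set of radii by \<open>a\<close> costs the
  factor \<open>exp (- a)\<close>. The same defect makes the inequality strict when \<open>0\<close>
  is missing, which is how equality puts \<open>0\<close> into the level sets. Two obstacles shape
  the rest. Proper sections are null in the whole space, so values on the boundary of the support
  are invisible to the left side but not to the right one. The regularized function has closed level
  sets, hence is Borel, and can only enlarge the right side. Secondly, equality yields statements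
  almost everywhere on \<open>H_A \<times> H_(-A)\<close> and for almost all levels, and Fubini
  makes \<open>g\<close> two-valued on one factor only. The transfer to the other factor needs
  log-concavity itself, not just convex level sets.\<close>

definition coord_embed :: "'n set \<Rightarrow> ('n \<Rightarrow> real) \<Rightarrow> real ^ 'n" where
  "coord_embed A g = (\<chi> i. if i \<in> A then g i else 0)"

text \<open>The Borel measure under \<open>coord_lebesgue\<close>. Completion does not change
  nonnegative integrals, so Tonelli and scaling can run on this sigma-finite measure.\<close>

definition coord_measure :: "'n::finite set \<Rightarrow> (real ^ 'n) measure" where
  "coord_measure A = distr (Pi\<^sub>M A (\<lambda>_. lborel)) borel (coord_embed A)"

lemma coord_lebesgue_eq: "coord_lebesgue A = completion (coord_measure A)"
  unfolding coord_lebesgue_def coord_measure_def coord_embed_def[abs_def] ..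

lemma mem_coord_subspace: "x \<in> coord_subspace A \<longleftrightarrow> (\<forall>i. i \<notin> A \<longrightarrow> x $ i = 0)"
  for x :: "real ^ 'n"
proof
  assume "x \<in> coord_subspace A"
  then show "\<forall>i. i \<notin> A \<longrightarrow> x $ i = 0"
    unfolding coord_subspace_def
  proof (induction rule: span_induct)
    case base
    show ?case by (auto simp: subspace_def)
  next
    case (step x)
    then show ?case by (auto simp: axis_def)
  qed
next
  assume *: "\<forall>i. i \<notin> A \<longrightarrow> x $ i = 0"
  have "x = (\<Sum>i\<in>UNIV. (x $ i) *\<^sub>R axis i 1)"
    by (simp add: vec_eq_iff axis_def if_distrib cong: if_cong)
  also have "\<dots> = (\<Sum>i\<in>A. (x $ i) *\<^sub>R axis i 1)"
    using * by (intro sum.mono_neutral_right) auto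
  also have "\<dots> \<in> coord_subspace A"
    unfolding coord_subspace_def by (intro span_sum span_scale span_base) auto
  finally show "x \<in> coord_subspace A" .
qed

lemma subspace_coord_subspace: "subspace (coord_subspace A)"
  unfolding coord_subspace_def by (rule subspace_span)

lemma coord_embed_mem: "coord_embed A g \<in> coord_subspace A"
  by (simp add: mem_coord_subspace coord_embed_def)

lemma coord_embed_measurable [measurable]:
  fixes A :: "'n::finite set"
  shows "coord_embed A \<in> borel_measurable (Pi\<^sub>M A (\<lambda>_. lborel))"
proof (subst borel_measurable_euclidean_space, rule ballI)
  fix b :: "real ^ 'n" assume "b \<in> Basis"
  then obtain i where b: "b = axis i 1" by (auto simp: Basis_vec_def)
  show "(\<lambda>g. coord_embed A g \<bullet> b) \<in> borel_measurable (Pi\<^sub>M A (\<lambda>_. lborel))"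
    by (cases "i \<in> A") (simp_all add: b inner_axis coord_embed_def)
qed

lemma sets_coord_measure [simp, measurable_cong]: "sets (coord_measure A) = sets borel"
  and space_coord_measure [simp]: "space (coord_measure A) = UNIV"
  by (simp_all add: coord_measure_def)

lemma nn_integral_coord_measure:
  assumes [measurable]: "h \<in> borel_measurable borel"
  shows "(\<integral>\<^sup>+x. h x \<partial>coord_measure A) = (\<integral>\<^sup>+g. h (coord_embed A g) \<partial>(Pi\<^sub>M A (\<lambda>_. lborel)))"
  by (simp add: coord_measure_def nn_integral_distr)

lemma AE_coord_measure: "AE x in coord_measure A. x \<in> coord_subspace A"
proof -
  have [measurable]: "coord_subspace A \<in> sets borel"
    using subspace_coord_subspace[of A] by (simp add: closed_subspace borel_closed)
  show ?thesis
    unfolding coord_measure_def by (subst AE_distr_iff) (auto simp: coord_embed_mem)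
qed

lemma emeasure_coord_measure_box:
  fixes l u :: "real ^ 'n"
  assumes "\<And>i. i \<notin> A \<Longrightarrow> l $ i < 0 \<and> 0 < u $ i" and "\<And>i. i \<in> A \<Longrightarrow> l $ i \<le> u $ i"
  shows "emeasure (coord_measure A) (box l u) = (\<Prod>i\<in>A. ennreal (u $ i - l $ i))"
proof -
  interpret product_sigma_finite "\<lambda>_ :: 'n. lborel :: real measure" by standard
  have "coord_embed A -` box l u \<inter> space (Pi\<^sub>M A (\<lambda>_. lborel)) = (\<Pi>\<^sub>E i\<in>A. {l $ i<..<u $ i})"
  proof (intro set_eqI iffI)
    fix g assume g: "g \<in> coord_embed A -` box l u \<inter> space (Pi\<^sub>M A (\<lambda>_. lborel))"
    have "l $ i < g i \<and> g i < u $ i" if "i \<in> A" for i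
      using g that by (auto simp: mem_box_cart coord_embed_def dest: spec[of _ i])
    with g show "g \<in> (\<Pi>\<^sub>E i\<in>A. {l $ i<..<u $ i})"
      by (auto simp: space_PiM PiE_iff)
  qed (use assms(1) in \<open>auto simp: mem_box_cart coord_embed_def space_PiM PiE_iff\<close>)
  then have "emeasure (coord_measure A) (box l u) =
      emeasure (Pi\<^sub>M A (\<lambda>_. lborel)) (\<Pi>\<^sub>E i\<in>A. {l $ i<..<u $ i})"
    by (simp add: coord_measure_def emeasure_distr)
  also have "\<dots> = (\<Prod>i\<in>A. emeasure lborel {l $ i<..<u $ i})"
    by (rule emeasure_PiM) auto
  also have "\<dots> = (\<Prod>i\<in>A. ennreal (u $ i - l $ i))"
    using assms(2) by (intro prod.cong) auto
  finally show ?thesis .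
qed

lemma sigma_finite_coord_measure: "sigma_finite_measure (coord_measure A)"
proof
  let ?X = "\<lambda>k::nat. box (\<chi> i. - real (Suc k)) (\<chi> i. real (Suc k)) :: (real ^ 'n) set"
  have "\<exists>k. x \<in> ?X k" for x :: "real ^ 'a"
  proof -
    obtain k where "norm x < real k" using reals_Archimedean2 by blast
    then have "- real (Suc k) < x $ i \<and> x $ i < real (Suc k)" for i
      using component_le_norm_cart[of x i] by (simp add: abs_le_iff)
    then show ?thesis by (intro exI[of _ k]) (simp add: mem_box_cart)
  qed
  moreover have "emeasure (coord_measure A) (?X k) \<noteq> \<infinity>" for k
    by (subst emeasure_coord_measure_box) (auto simp: power_eq_top_ennreal)
  ultimately show "\<exists>X. countable X \<and> X \<subseteq> sets (coord_measure A) \<and> \<Union>X = space (coord_measure A) \<and>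
      (\<forall>a\<in>X. emeasure (coord_measure A) a \<noteq> \<infinity>)"
    by (intro exI[of _ "range ?X"]) auto
qed

lemma nn_integral_coord_measure_Un:
  fixes h :: "real ^ 'n \<Rightarrow> ennreal"
  assumes [measurable]: "h \<in> borel_measurable borel" and disj: "A \<inter> B = {}"
  shows "(\<integral>\<^sup>+z. h z \<partial>coord_measure (A \<union> B)) =
    (\<integral>\<^sup>+x. \<integral>\<^sup>+y. h (x + y) \<partial>coord_measure B \<partial>coord_measure A)"
proof -
  interpret product_sigma_finite "\<lambda>_ :: 'n. lborel :: real measure" by standard
  interpret B: finite_product_sigma_finite "\<lambda>_ :: 'n. lborel :: real measure" B by standard auto
  have *: "coord_embed (A \<union> B) (merge A B (x, y)) = coord_embed A x + coord_embed B y" for x y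
    using disj by (auto simp: coord_embed_def merge_def vec_eq_iff)
  have sf: "sigma_finite_measure (coord_measure B)"
    by (rule sigma_finite_coord_measure)
  have "(\<integral>\<^sup>+z. h z \<partial>coord_measure (A \<union> B)) =
     (\<integral>\<^sup>+x. \<integral>\<^sup>+y. h (coord_embed A x + coord_embed B y) \<partial>Pi\<^sub>M B (\<lambda>_. lborel) \<partial>Pi\<^sub>M A (\<lambda>_. lborel))"
    by (simp add: nn_integral_coord_measure product_nn_integral_fold[OF disj] *)
  also have "\<dots> = (\<integral>\<^sup>+x. \<integral>\<^sup>+y. h (x + y) \<partial>coord_measure B \<partial>coord_measure A)"
    using sigma_finite_measure.borel_measurable_nn_integral[OF sf, of "\<lambda>x y. h (x + y)" borel]
    by (simp add: nn_integral_coord_measure)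
  finally show ?thesis .
qed

lemma coord_measure_UNIV: "coord_measure (UNIV :: 'n set) = (lborel :: (real ^ 'n) measure)"
proof (rule lborel_eqI[symmetric])
  fix l u :: "real ^ 'n" assume *: "\<And>b. b \<in> Basis \<Longrightarrow> l \<bullet> b \<le> u \<bullet> b"
  have le: "l $ i \<le> u $ i" for i
    using *[of "axis i 1"] by (simp add: inner_axis)
  have "(\<Prod>b\<in>Basis. (u - l) \<bullet> b) = (\<Prod>i\<in>UNIV. u $ i - l $ i)"
  proof -
    have "(Basis :: (real^'n) set) = (\<lambda>i. axis i 1) ` UNIV" by (auto simp: Basis_vec_def)
    moreover have "(\<Prod>b\<in>range (\<lambda>i. axis i 1). (u - l) \<bullet> b) = (\<Prod>i\<in>UNIV. u $ i - l $ i)"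
      by (subst prod.reindex) (auto simp: inj_on_def axis_eq_axis inner_axis)
    ultimately show ?thesis by simp
  qed
  then show "emeasure (coord_measure UNIV) (box l u) = ennreal (\<Prod>b\<in>Basis. (u - l) \<bullet> b)"
    using le by (subst emeasure_coord_measure_box) (auto intro!: prod_ennreal)
qed simp

lemma nn_integral_coord_measure_empty:
  fixes h :: "real ^ 'n \<Rightarrow> ennreal"
  assumes [measurable]: "h \<in> borel_measurable borel"
  shows "(\<integral>\<^sup>+x. h x \<partial>coord_measure {}) = h 0"
proof -
  have "coord_embed {} g = (0 :: real ^ 'n)" for g by (simp add: coord_embed_def vec_eq_iff)
  then have "(\<integral>\<^sup>+x. h x \<partial>coord_measure {}) = (\<integral>\<^sup>+g. h 0 \<partial>Pi\<^sub>M {} (\<lambda>_ :: 'n. lborel :: real measure))"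
    by (simp add: nn_integral_coord_measure)
  also have "\<dots> = h 0"
    by (simp only: PiM_empty nn_integral_const space_count_space) simp
  finally show ?thesis .
qed

lemma borel_measurable_axis [measurable]: "(\<lambda>t. axis i t :: real ^ 'n) \<in> borel_measurable borel"
proof -
  have "(\<lambda>t. axis i t :: real ^ 'n) = (\<lambda>t. t *\<^sub>R axis i 1)"
    by (auto simp: fun_eq_iff vec_eq_iff axis_def)
  then show ?thesis by (rule ssubst) simp
qed

lemma nn_integral_coord_measure_singleton:
  assumes [measurable]: "h \<in> borel_measurable borel"
  shows "(\<integral>\<^sup>+x. h x \<partial>coord_measure {i}) = (\<integral>\<^sup>+t. h (axis i t) \<partial>lborel)"
proof -
  interpret product_sigma_finite "\<lambda>_ :: 'a. lborel :: real measure" by standard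
  have ax: "coord_embed {i} g = axis i (g i)" for g
    by (auto simp: coord_embed_def vec_eq_iff axis_def)
  show ?thesis
    by (simp add: nn_integral_coord_measure ax product_nn_integral_singleton[of "\<lambda>t. h (axis i t)"])
qed

text \<open>One coordinate at a time: peeling off \<open>i\<close> leaves a one-dimensional linear
  substitution, which contributes one factor \<open>r\<close>.\<close>

lemma nn_integral_coord_measure_scale:
  fixes h :: "real ^ 'n \<Rightarrow> ennreal" and r :: real
  assumes [measurable]: "h \<in> borel_measurable borel" and r: "0 < r"
  shows "(\<integral>\<^sup>+x. h (inverse r *\<^sub>R x) \<partial>coord_measure A) = ennreal (r ^ card A) * (\<integral>\<^sup>+x. h x \<partial>coord_measure A)"
  using finite[of A] assms(1)
proof (induction A arbitrary: h rule: finite_induct)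
  case empty
  then show ?case by (simp add: nn_integral_coord_measure_empty)
next
  case (insert i A)
  note [measurable] = insert.prems
  interpret A: sigma_finite_measure "coord_measure A" by (rule sigma_finite_coord_measure)
  have d: "{i} \<inter> A = {}" using insert by auto
  let ?H = "\<lambda>x. \<integral>\<^sup>+y. h (x + y) \<partial>coord_measure A"
  have "(\<integral>\<^sup>+x. h (inverse r *\<^sub>R x) \<partial>coord_measure ({i} \<union> A)) =
      (\<integral>\<^sup>+t. \<integral>\<^sup>+y. h (inverse r *\<^sub>R (axis i t + y)) \<partial>coord_measure A \<partial>lborel)"
    by (subst nn_integral_coord_measure_Un[OF _ d]) (auto intro!: nn_integral_coord_measure_singleton)
  also have "\<dots> = (\<integral>\<^sup>+t. ennreal (r ^ card A) * ?H (axis i (inverse r * t)) \<partial>lborel)"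
  proof (rule nn_integral_cong)
    fix t
    have "(\<integral>\<^sup>+y. h (axis i (inverse r * t) + inverse r *\<^sub>R y) \<partial>coord_measure A) =
      ennreal (r ^ card A) * ?H (axis i (inverse r * t))"
      using insert.IH[of "\<lambda>y. h (axis i (inverse r * t) + y)"] by simp
    moreover have "inverse r *\<^sub>R (axis i t + y) = axis i (inverse r * t) + inverse r *\<^sub>R y" for y
      by (simp add: vec_eq_iff axis_def algebra_simps)
    ultimately show "(\<integral>\<^sup>+y. h (inverse r *\<^sub>R (axis i t + y)) \<partial>coord_measure A) =
      ennreal (r ^ card A) * ?H (axis i (inverse r * t))" by (simp only:)
  qed
  also have "\<dots> = ennreal (r ^ card A) * (\<integral>\<^sup>+t. ?H (axis i (inverse r * t)) \<partial>lborel)"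
    by (rule nn_integral_cmult) measurable
  also have "(\<integral>\<^sup>+t. ?H (axis i (inverse r * t)) \<partial>lborel) = ennreal r * (\<integral>\<^sup>+t. ?H (axis i t) \<partial>lborel)"
  proof -
    have "(\<lambda>t. ?H (axis i (inverse r * t))) \<in> borel_measurable borel" by measurable
    from nn_integral_real_affine[OF this, of r 0] r
    have "(\<integral>\<^sup>+t. ?H (axis i (inverse r * t)) \<partial>lborel) =
        ennreal r * (\<integral>\<^sup>+t. ?H (axis i (inverse r * (0 + r * t))) \<partial>lborel)"
      by (simp only: abs_of_pos less_imp_neq[symmetric] not_False_eq_True)
    moreover have "inverse r * (0 + r * t) = t" for t using r by simp
    ultimately show ?thesis by (simp only:)
  qed
  also have "(\<integral>\<^sup>+t. ?H (axis i t) \<partial>lborel) = (\<integral>\<^sup>+x. ?H x \<partial>coord_measure {i})"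
    by (rule nn_integral_coord_measure_singleton[symmetric]) measurable
  also have "\<dots> = (\<integral>\<^sup>+x. h x \<partial>coord_measure ({i} \<union> A))"
    by (rule nn_integral_coord_measure_Un[OF _ d, symmetric]) measurable
  also have "ennreal (r ^ card A) * (ennreal r * (\<integral>\<^sup>+x. h x \<partial>coord_measure ({i} \<union> A))) =
      ennreal (r ^ card (insert i A)) * (\<integral>\<^sup>+x. h x \<partial>coord_measure ({i} \<union> A))"
  proof -
    have "ennreal (r ^ card A) * ennreal r = ennreal (r ^ card (insert i A))"
      using insert.hyps r by (simp add: ennreal_mult'[symmetric] mult.commute)
    then show ?thesis by (simp only: mult.assoc[symmetric])
  qed
  finally show ?case unfolding insert_is_Un[symmetric] .
qed

text \<open>For \<open>A = {}\<close> all the mass sits at \<open>0\<close>. For nonempty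
  \<open>A\<close> this lemma yields a nonzero point in any section of positive volume.\<close>

lemma emeasure_coord_measure_zero:
  assumes "A \<noteq> {}"
  shows "emeasure (coord_measure A) {0} = 0"
proof -
  interpret product_sigma_finite "\<lambda>_ :: 'a. lborel :: real measure" by standard
  have "coord_embed A -` {0} \<inter> space (Pi\<^sub>M A (\<lambda>_. lborel)) = (\<Pi>\<^sub>E i\<in>A. {0})"
  proof (intro set_eqI iffI)
    fix g assume g: "g \<in> coord_embed A -` {0} \<inter> space (Pi\<^sub>M A (\<lambda>_. lborel))"
    have "g i = 0" if "i \<in> A" for i
      using g that by (auto simp: vec_eq_iff coord_embed_def dest: spec[of _ i])
    with g show "g \<in> (\<Pi>\<^sub>E i\<in>A. {0})"
      by (auto simp: space_PiM PiE_iff extensional_def fun_eq_iff)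
  qed (auto simp: vec_eq_iff coord_embed_def space_PiM PiE_iff simp del: PiE_singleton)
  then have "emeasure (coord_measure A) {0} = emeasure (Pi\<^sub>M A (\<lambda>_. lborel)) (\<Pi>\<^sub>E i\<in>A. {0 :: real})"
    unfolding coord_measure_def by (subst emeasure_distr) (auto simp del: PiE_singleton)
  also have "\<dots> = (\<Prod>i\<in>A. emeasure lborel {0 :: real})"
    by (rule emeasure_PiM) auto
  also have "\<dots> = 0"
    using assms by (simp add: card_gt_0_iff power_0_left)
  finally show ?thesis .
qed

subsection \<open>Exponential mass along rays\<close>

text \<open>The half-line \<open>{a..}\<close> gets mass \<open>exp (- a)\<close>, so adding radii
  corresponds to multiplying masses. Nothing here confines \<open>T\<close> to positive numbers;
  \<open>rays\<close> and the hypotheses \<open>T \<subseteq> {0<..}\<close> do that.\<close>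

definition exp_mass :: "real set \<Rightarrow> ennreal" where
  "exp_mass T = (\<integral>\<^sup>+r. ennreal (exp (- r)) * indicator T r \<partial>lborel)"

lemma exp_mass_mono: "S \<subseteq> T \<Longrightarrow> exp_mass S \<le> exp_mass T"
  unfolding exp_mass_def by (intro nn_integral_mono mult_left_mono) (auto split: split_indicator)

lemma exp_mass_empty [simp]: "exp_mass {} = 0"
  by (simp add: exp_mass_def)

lemma exp_mass_atLeast: "exp_mass {a..} = ennreal (exp (- a))"
proof -
  have "exp_mass {a..} = ennreal (0 - (- exp (- a)))"
    unfolding exp_mass_def
  proof (rule nn_integral_FTC_atLeast)
    fix x :: real
    show "((\<lambda>x. - exp (- x)) has_real_derivative exp (- x)) (at x)"
      by (auto intro!: derivative_eq_intros)
    have "((\<lambda>x::real. exp (- x)) \<longlongrightarrow> 0) at_top"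
      by (rule filterlim_compose[OF exp_at_bot filterlim_uminus_at_bot_at_top])
    then show "((\<lambda>x::real. - exp (- x)) \<longlongrightarrow> 0) at_top"
      using tendsto_minus[of "\<lambda>x::real. exp (- x)" 0 at_top] by simp
  qed auto
  then show ?thesis by simp
qed

lemma exp_mass_finite:
  assumes "T \<subseteq> {0<..}"
  shows "exp_mass T < top"
proof -
  have "exp_mass T \<le> exp_mass {0..}" using assms by (intro exp_mass_mono) auto
  also have "\<dots> < top" by (simp add: exp_mass_atLeast)
  finally show ?thesis .
qed

lemma exp_mass_shift:
  assumes [measurable]: "T \<in> sets borel" "S \<in> sets borel"
    and "\<And>s. s \<in> T \<Longrightarrow> a + s \<in> S"
  shows "ennreal (exp (- a)) * exp_mass T \<le> exp_mass S"
proof -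
  have "ennreal (exp (- a)) * exp_mass T =
      (\<integral>\<^sup>+s. ennreal (exp (- a)) * (ennreal (exp (- s)) * indicator T s) \<partial>lborel)"
    unfolding exp_mass_def by (rule nn_integral_cmult[symmetric]) measurable
  also have "\<dots> \<le> (\<integral>\<^sup>+s. ennreal (exp (- (a + s))) * indicator S (a + s) \<partial>lborel)"
    using assms(3)
    by (intro nn_integral_mono) (auto split: split_indicator simp: ennreal_mult'[symmetric] exp_add[symmetric])
  also have "\<dots> = exp_mass S"
    unfolding exp_mass_def
    using nn_integral_real_affine[of "\<lambda>r. ennreal (exp (- r)) * indicator S r" 1 a] by simp
  finally show ?thesis .
qed

text \<open>Every translate \<open>a + B\<close> with \<open>a \<in> A\<close> lies in
  \<open>S\<close> and has mass \<open>exp (- a) * exp_mass B\<close>. The infimum need not be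
  attained, hence the limit over \<open>Inf A + e\<close>; finiteness of \<open>exp_mass B\<close>
  makes the product continuous.\<close>

lemma exp_mass_add_Inf:
  assumes meas: "B \<in> sets borel" "S \<in> sets borel"
    and A: "A \<subseteq> {0<..}" "A \<noteq> {}" and B: "B \<subseteq> {0<..}"
    and S: "\<And>a b. a \<in> A \<Longrightarrow> b \<in> B \<Longrightarrow> a + b \<in> S"
  shows "ennreal (exp (- Inf A)) * exp_mass B \<le> exp_mass S"
proof (rule tendsto_upperbound)
  show "((\<lambda>e. ennreal (exp (- (Inf A + e))) * exp_mass B) \<longlongrightarrow> ennreal (exp (- Inf A)) * exp_mass B)
      (at_right (0::real))"
  proof -
    have "((\<lambda>e. ennreal (exp (- (Inf A + e)))) \<longlongrightarrow> ennreal (exp (- (Inf A + 0)))) (at_right (0::real))"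
      by (intro tendsto_ennrealI tendsto_intros)
    from ennreal_tendsto_cmult[OF exp_mass_finite[OF B] this]
    show ?thesis by (simp add: mult.commute)
  qed
  have bdd: "bdd_below A" using A by (intro bdd_belowI[of _ 0]) auto
  show "\<forall>\<^sub>F e in at_right (0::real). ennreal (exp (- (Inf A + e))) * exp_mass B \<le> exp_mass S"
    using eventually_at_right_less
  proof eventually_elim
    case (elim e)
    then obtain a where a: "a \<in> A" "a < Inf A + e"
      using cInf_lessD[OF A(2), of "Inf A + e"] by auto
    have "ennreal (exp (- (Inf A + e))) * exp_mass B \<le> ennreal (exp (- a)) * exp_mass B"
      using a by (intro mult_right_mono ennreal_leI) auto
    also have "\<dots> \<le> exp_mass S"
      using a S by (intro exp_mass_shift meas) auto
    finally show ?case .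
  qed
qed auto

lemma exp_mass_le_Inf:
  assumes A: "A \<subseteq> {0<..}"
  shows "exp_mass A \<le> ennreal (exp (- Inf A))"
proof -
  have "bdd_below A" using A by (intro bdd_belowI[of _ 0]) auto
  then show ?thesis
    unfolding exp_mass_atLeast[symmetric] by (intro exp_mass_mono) (auto intro: cInf_lower)
qed

lemma exp_mass_mult_le:
  assumes "B \<in> sets borel" "S \<in> sets borel" "A \<subseteq> {0<..}" "B \<subseteq> {0<..}"
    and "\<And>a b. a \<in> A \<Longrightarrow> b \<in> B \<Longrightarrow> a + b \<in> S"
  shows "exp_mass A * exp_mass B \<le> exp_mass S"
proof (cases "A = {}")
  case False
  have "exp_mass A * exp_mass B \<le> ennreal (exp (- Inf A)) * exp_mass B"
    using exp_mass_le_Inf[OF assms(3)] by (rule mult_right_mono) simp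
  also have "\<dots> \<le> exp_mass S"
    using assms False by (intro exp_mass_add_Inf) auto
  finally show ?thesis .
qed simp

text \<open>A bounded \<open>A\<close> misses the tail \<open>{c<..}\<close>, which has positive
  mass, so \<open>exp_mass A\<close> is strictly below the mass of \<open>{Inf A..}\<close>; the
  rest of the estimate is unchanged.\<close>

lemma exp_mass_mult_less:
  assumes meas: "A \<in> sets borel" "B \<in> sets borel" "S \<in> sets borel"
    and A: "A \<subseteq> {0<..}" "A \<subseteq> {..c}" and B: "B \<subseteq> {0<..}"
    and pos: "exp_mass A \<noteq> 0" "exp_mass B \<noteq> 0"
    and S: "\<And>a b. a \<in> A \<Longrightarrow> b \<in> B \<Longrightarrow> a + b \<in> S"
  shows "exp_mass A * exp_mass B < exp_mass S"
proof -
  have ne: "A \<noteq> {}" using pos by auto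
  have bdd: "bdd_below A" using A by (intro bdd_belowI[of _ 0]) auto
  note [measurable] = meas
  have c: "Inf A \<le> c"
  proof -
    obtain a where "a \<in> A" using ne by blast
    with cInf_lower[OF this bdd] A(2) show ?thesis by force
  qed
  have "exp_mass A + exp_mass {c<..} = (\<integral>\<^sup>+r. ennreal (exp (- r)) * indicator A r + ennreal (exp (- r)) * indicator {c<..} r \<partial>lborel)"
    unfolding exp_mass_def by (rule nn_integral_add[symmetric]) measurable
  also have "\<dots> = exp_mass (A \<union> {c<..})"
    unfolding exp_mass_def using A(2) by (intro nn_integral_cong) (auto split: split_indicator)
  also have "\<dots> \<le> exp_mass {Inf A..}"
    using c bdd by (intro exp_mass_mono) (fastforce intro: cInf_lower)
  finally have le: "exp_mass A + exp_mass {c<..} \<le> ennreal (exp (- Inf A))"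
    by (simp add: exp_mass_atLeast)
  have "0 < exp_mass {c+1..}" by (simp add: exp_mass_atLeast)
  also have "\<dots> \<le> exp_mass {c<..}" by (rule exp_mass_mono) auto
  finally have lt: "exp_mass A + 0 < exp_mass A + exp_mass {c<..}"
    using exp_mass_finite[OF A(1)] unfolding ennreal_add_left_cancel_less by simp
  from less_le_trans[OF lt le] have "exp_mass A < ennreal (exp (- Inf A))" by simp
  then have "exp_mass A * exp_mass B < ennreal (exp (- Inf A)) * exp_mass B"
    using pos exp_mass_finite[OF B] by (intro ennreal_mult_strict_right_mono) (auto simp: zero_less_iff_neq_zero)
  also have "\<dots> \<le> exp_mass S"
    using assms ne by (intro exp_mass_add_Inf) auto
  finally show ?thesis .
qed

text \<open>Nonempty upward closed sets fill their half-line up to its endpoint, so their masses are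
  exactly \<open>exp (- Inf A)\<close> and \<open>exp (- Inf B)\<close>. Every element of
  \<open>S\<close> is at least \<open>Inf A + Inf B\<close>; the slack \<open>e\<close> covers
  infima that are not attained.\<close>

lemma exp_mass_le_mult:
  assumes A: "A \<subseteq> {0<..}" "\<And>a a'. a \<in> A \<Longrightarrow> a < a' \<Longrightarrow> a' \<in> A"
    and B: "B \<subseteq> {0<..}" "\<And>b b'. b \<in> B \<Longrightarrow> b < b' \<Longrightarrow> b' \<in> B"
    and S: "\<And>r e. r \<in> S \<Longrightarrow> 0 < e \<Longrightarrow> \<exists>a\<in>A. \<exists>b\<in>B. a + b \<le> r + e"
  shows "exp_mass S \<le> exp_mass A * exp_mass B"
proof (cases "S = {}")
  case False
  then have ne: "A \<noteq> {}" "B \<noteq> {}" using S[of _ 1] by auto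
  have bdd: "bdd_below A" "bdd_below B" using A B by (auto intro!: bdd_belowI[of _ 0])
  have ge: "exp_mass C \<ge> ennreal (exp (- Inf C))"
    if "C \<noteq> {}" "bdd_below C" "\<And>a a'. a \<in> C \<Longrightarrow> a < a' \<Longrightarrow> a' \<in> C" for C
  proof -
    have "{Inf C <..} \<subseteq> C"
      using that by (auto dest!: cInf_lessD[OF that(1)])
    then have "exp_mass {Inf C<..} \<le> exp_mass C" by (rule exp_mass_mono)
    moreover have "exp_mass {Inf C<..} = exp_mass {Inf C..}"
      unfolding exp_mass_def
      by (intro nn_integral_cong_AE AE_I[where N="{Inf C}"]) (auto split: split_indicator)
    ultimately show ?thesis by (simp add: exp_mass_atLeast)
  qed
  have "Inf A + Inf B \<le> r" if r: "r \<in> S" for r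
  proof (rule field_le_epsilon)
    fix e :: real assume "0 < e"
    then obtain a b where "a \<in> A" "b \<in> B" "a + b \<le> r + e" using S[OF r] by blast
    with cInf_lower[OF _ bdd(1), of a] cInf_lower[OF _ bdd(2), of b]
    show "Inf A + Inf B \<le> r + e" by linarith
  qed
  then have "exp_mass S \<le> exp_mass {Inf A + Inf B..}" by (intro exp_mass_mono) auto
  also have "\<dots> = ennreal (exp (- Inf A)) * ennreal (exp (- Inf B))"
    by (simp add: exp_mass_atLeast ennreal_mult'[symmetric] exp_add exp_minus exp_diff field_simps)
  also have "\<dots> \<le> exp_mass A * exp_mass B"
    using ge[OF ne(1) bdd(1) A(2)] ge[OF ne(2) bdd(2) B(2)] by (intro mult_mono) auto
  finally show ?thesis .
qed simp

text \<open>For convex \<open>K\<close> containing \<open>0\<close>, a half-line starting at the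
  Minkowski gauge of \<open>z\<close>. The function \<open>F_K z\<close> of the overview is
  \<open>exp_mass (rays K z)\<close>.\<close>

definition rays :: "'a::real_vector set \<Rightarrow> 'a \<Rightarrow> real set" where
  "rays K z = {r. 0 < r \<and> inverse r *\<^sub>R z \<in> K}"

lemma rays_pos: "rays K z \<subseteq> {0<..}"
  by (auto simp: rays_def)

lemma sets_rays [measurable]:
  fixes z :: "real ^ 'n"
  assumes [measurable]: "K \<in> sets borel"
  shows "rays K z \<in> sets borel"
  unfolding rays_def by measurable

text \<open>The integral is \<open>Gamma (d + 1)\<close>; the factorials of the inequality originate
  here.\<close>

lemma nn_integral_power_exp:
  "(\<integral>\<^sup>+r. ennreal (exp (- r)) * indicator {0<..} r * ennreal (r ^ d) \<partial>lborel) = fact d"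
proof -
  have "(\<integral>\<^sup>+r. ennreal (exp (- r)) * indicator {0<..} r * ennreal (r ^ d) \<partial>lborel) =
    (\<integral>\<^sup>+t. ennreal (indicator {0..} t * t powr (real d + 1 - 1) / exp t) \<partial>lborel)"
    by (intro nn_integral_cong_AE AE_I[where N="{0}"])
       (auto split: split_indicator simp: ennreal_mult'[symmetric] exp_minus powr_realpow field_simps)
  also have "\<dots> = Gamma (real d + 1)"
    by (subst Gamma_conv_nn_integral_real) auto
  also have "\<dots> = ennreal (fact d)"
    by (simp add: Gamma_fact add.commute)
  finally show ?thesis by (metis ennreal_of_nat_eq_real_of_nat of_nat_fact)
qed

text \<open>Tonelli: for fixed \<open>r\<close> the points \<open>z\<close> with
  \<open>z / r \<in> K\<close> fill \<open>r K\<close>, whose volume is \<open>r ^ d\<close> times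
  that of \<open>K\<close>, and the weight \<open>exp (- r)\<close> turns \<open>r ^ d\<close> into
  \<open>fact d\<close>.\<close>

lemma nn_integral_exp_mass_rays:
  fixes K :: "(real ^ 'n) set"
  assumes [measurable]: "K \<in> sets borel"
  shows "(\<integral>\<^sup>+z. exp_mass (rays K z) \<partial>coord_measure A) = fact (card A) * emeasure (coord_measure A) K"
proof -
  interpret A: sigma_finite_measure "coord_measure A" by (rule sigma_finite_coord_measure)
  interpret pair_sigma_finite "coord_measure A" "lborel :: real measure" ..
  let ?w = "\<lambda>r. ennreal (exp (- r)) * indicator {0<..} r"
  have "(\<integral>\<^sup>+z. exp_mass (rays K z) \<partial>coord_measure A) =
    (\<integral>\<^sup>+z. \<integral>\<^sup>+r. ?w r * indicator K (inverse r *\<^sub>R z) \<partial>lborel \<partial>coord_measure A)"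
    unfolding exp_mass_def rays_def
    by (intro nn_integral_cong) (auto split: split_indicator)
  also have "\<dots> = (\<integral>\<^sup>+r. \<integral>\<^sup>+z. ?w r * indicator K (inverse r *\<^sub>R z) \<partial>coord_measure A \<partial>lborel)"
    by (rule Fubini'[symmetric]) measurable
  also have "\<dots> = (\<integral>\<^sup>+r. ?w r * ennreal (r ^ card A) * emeasure (coord_measure A) K \<partial>lborel)"
  proof (rule nn_integral_cong)
    fix r :: real
    show "(\<integral>\<^sup>+z. ?w r * indicator K (inverse r *\<^sub>R z) \<partial>coord_measure A) =
      ?w r * ennreal (r ^ card A) * emeasure (coord_measure A) K"
    proof (cases "0 < r")
      case True
      have "(\<integral>\<^sup>+z. ?w r * indicator K (inverse r *\<^sub>R z) \<partial>coord_measure A) =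
          ?w r * (\<integral>\<^sup>+z. indicator K (inverse r *\<^sub>R z) \<partial>coord_measure A)"
        by (rule nn_integral_cmult) measurable
      also have "(\<integral>\<^sup>+z. indicator K (inverse r *\<^sub>R z) \<partial>coord_measure A) =
          ennreal (r ^ card A) * (\<integral>\<^sup>+z. indicator K z \<partial>coord_measure A)"
        by (rule nn_integral_coord_measure_scale[OF _ True]) measurable
      also have "(\<integral>\<^sup>+z. indicator K z \<partial>coord_measure A) = emeasure (coord_measure A) K"
        by simp
      finally show ?thesis by (simp only: mult.assoc)
    qed simp
  qed
  also have "\<dots> = fact (card A) * emeasure (coord_measure A) K"
    by (subst nn_integral_multc) (auto simp: nn_integral_power_exp)
  finally show ?thesis .
qed

subsection \<open>Volumes of sections\<close>

lemma nn_integral_eq_imp_AE_eq: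
  assumes [measurable]: "f \<in> borel_measurable M" "g \<in> borel_measurable M"
    and le: "AE x in M. f x \<le> g x" and eq: "(\<integral>\<^sup>+x. g x \<partial>M) = (\<integral>\<^sup>+x. f x \<partial>M)"
    and fin: "(\<integral>\<^sup>+x. f x \<partial>M) < top"
  shows "AE x in M. f x = g x"
proof -
  have "(\<integral>\<^sup>+x. g x - f x \<partial>M) = (\<integral>\<^sup>+x. g x \<partial>M) - (\<integral>\<^sup>+x. f x \<partial>M)"
    using fin le by (intro nn_integral_diff) auto
  also have "\<dots> = 0" using eq fin by simp
  finally have "AE x in M. g x - f x = 0"
    by (subst (asm) nn_integral_0_iff_AE) auto
  moreover have "AE x in M. f x \<noteq> top"
    using nn_integral_PInf_AE[of f M] fin by (auto simp: infinity_ennreal_def)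
  ultimately show ?thesis
    using le by eventually_elim (auto simp: diff_eq_0_iff_ennreal intro: antisym)
qed

section \<open>Product measures on pairs of coordinate subspaces\<close>

abbreviation coord_pair :: "'n::finite set \<Rightarrow> 'n set \<Rightarrow> ((real ^ 'n) \<times> (real ^ 'n)) measure" where
  "coord_pair A B \<equiv> coord_measure A \<Otimes>\<^sub>M coord_measure B"

lemma pair_sigma_finite_coord: "pair_sigma_finite (coord_measure A) (coord_measure B)"
  by (simp add: pair_sigma_finite_def sigma_finite_coord_measure)

lemma sets_coord_subspace [measurable]: "coord_subspace A \<in> sets borel"
  using subspace_coord_subspace[of A] by (simp add: closed_subspace borel_closed)

lemma AE_coord_pair:
  "AE p in coord_pair A B. fst p \<in> coord_subspace A \<and> snd p \<in> coord_subspace B"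
proof -
  interpret pair_sigma_finite "coord_measure A" "coord_measure B" by (rule pair_sigma_finite_coord)
  show ?thesis
  proof (rule AE_pair_measure)
    show "{p \<in> space (coord_pair A B). fst p \<in> coord_subspace A \<and> snd p \<in> coord_subspace B}
        \<in> sets (coord_pair A B)"
      by measurable
    show "AE x in coord_measure A. AE y in coord_measure B.
        fst (x, y) \<in> coord_subspace A \<and> snd (x, y) \<in> coord_subspace B"
      using AE_coord_measure[of A]
      by eventually_elim (use AE_coord_measure[of B] in auto)
  qed
qed

lemma nn_integral_coord_pair_Un:
  fixes h :: "real ^ 'n \<Rightarrow> ennreal"
  assumes [measurable]: "h \<in> borel_measurable borel" and disj: "A \<inter> B = {}"
  shows "(\<integral>\<^sup>+z. h z \<partial>coord_measure (A \<union> B)) = (\<integral>\<^sup>+p. h (fst p + snd p) \<partial>coord_pair A B)"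
proof -
  interpret B: sigma_finite_measure "coord_measure B" by (rule sigma_finite_coord_measure)
  show ?thesis
    by (subst B.nn_integral_fst[symmetric]) (simp_all add: nn_integral_coord_measure_Un[OF _ disj])
qed

lemma nn_integral_coord_pair_mult:
  fixes f g :: "real ^ 'n \<Rightarrow> ennreal"
  assumes [measurable]: "f \<in> borel_measurable borel" "g \<in> borel_measurable borel"
  shows "(\<integral>\<^sup>+p. f (fst p) * g (snd p) \<partial>coord_pair A B) =
    (\<integral>\<^sup>+x. f x \<partial>coord_measure A) * (\<integral>\<^sup>+y. g y \<partial>coord_measure B)"
proof -
  interpret B: sigma_finite_measure "coord_measure B" by (rule sigma_finite_coord_measure)
  show ?thesis
    by (subst B.nn_integral_fst[symmetric]) (simp_all add: nn_integral_cmult nn_integral_multc)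
qed

text \<open>The weight \<open>fact (card A)\<close> makes this the integral of
  \<open>exp_mass (rays K z)\<close> over the subspace and frees the product inequality of
  constants.\<close>

definition scaled_vol :: "'n::finite set \<Rightarrow> (real ^ 'n) set \<Rightarrow> ennreal" where
  "scaled_vol A K = fact (card A) * emeasure (coord_measure A) K"

lemma exp_mass_rays_measurable [measurable]:
  fixes K :: "(real ^ 'n) set"
  assumes [measurable]: "K \<in> sets borel"
  shows "(\<lambda>z. exp_mass (rays K z)) \<in> borel_measurable borel"
proof -
  have "exp_mass (rays K z) = (\<integral>\<^sup>+r. ennreal (exp (- r)) * indicator {0<..} r * indicator K (inverse r *\<^sub>R z) \<partial>lborel)" for z
    unfolding exp_mass_def rays_def by (intro nn_integral_cong) (auto split: split_indicator)
  then show ?thesis by simp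
qed

lemma scaled_vol_Un:
  assumes [measurable]: "K \<in> sets borel" and disj: "A \<inter> B = {}"
  shows "scaled_vol (A \<union> B) K = (\<integral>\<^sup>+p. exp_mass (rays K (fst p + snd p)) \<partial>coord_pair A B)"
  unfolding scaled_vol_def nn_integral_exp_mass_rays[OF assms(1), symmetric]
  by (rule nn_integral_coord_pair_Un[OF _ disj]) measurable

lemma scaled_vol_mult:
  assumes [measurable]: "K \<in> sets borel" "L \<in> sets borel"
  shows "scaled_vol A K * scaled_vol B L =
    (\<integral>\<^sup>+p. exp_mass (rays K (fst p)) * exp_mass (rays L (snd p)) \<partial>coord_pair A B)"
  unfolding scaled_vol_def nn_integral_exp_mass_rays[OF assms(1), symmetric]
    nn_integral_exp_mass_rays[OF assms(2), symmetric]
  by (rule nn_integral_coord_pair_mult[symmetric]) measurable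

text \<open>With \<open>l = s / (r + s)\<close> the combination of \<open>x / r\<close> and
  \<open>y / s\<close> is \<open>(x + y) / (r + s)\<close>: this is why radii add.\<close>

lemma rays_add:
  assumes comb: "\<And>l. 0 < l \<Longrightarrow> l < 1 \<Longrightarrow> inverse r *\<^sub>R x \<in> KA \<Longrightarrow> inverse s *\<^sub>R y \<in> KB \<Longrightarrow>
      (1 - l) *\<^sub>R (inverse r *\<^sub>R x) + l *\<^sub>R (inverse s *\<^sub>R y) \<in> K"
    and mem: "r \<in> rays KA x" "s \<in> rays KB y"
  shows "r + s \<in> rays K (x + y)"
proof -
  have rs: "0 < r" "0 < s" using mem by (auto simp: rays_def)
  define l where "l = s / (r + s)"
  have l: "0 < l" "l < 1" using rs by (auto simp: l_def)
  have "(1 - l) * inverse r = inverse (r + s)" "l * inverse s = inverse (r + s)"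
    using rs by (auto simp: l_def field_simps)
  then have "(1 - l) *\<^sub>R (inverse r *\<^sub>R x) + l *\<^sub>R (inverse s *\<^sub>R y) = inverse (r + s) *\<^sub>R (x + y)"
    by (simp only: scaleR_scaleR scaleR_right_distrib)
  with comb[OF l] mem rs show ?thesis by (auto simp: rays_def)
qed

lemma rays_add_coord:
  assumes comb: "\<And>x y l. x \<in> KA \<inter> coord_subspace A \<Longrightarrow> y \<in> KB \<inter> coord_subspace B \<Longrightarrow> 0 < l \<Longrightarrow> l < 1 \<Longrightarrow>
      (1 - l) *\<^sub>R x + l *\<^sub>R y \<in> K"
    and "x \<in> coord_subspace A" "y \<in> coord_subspace B" "r \<in> rays KA x" "s \<in> rays KB y"
  shows "r + s \<in> rays K (x + y)"
proof (rule rays_add[OF comb])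
  show "inverse r *\<^sub>R x \<in> KA \<inter> coord_subspace A" if "inverse r *\<^sub>R x \<in> KA"
    using that assms(2) subspace_scale[OF subspace_coord_subspace] by blast
  show "inverse s *\<^sub>R y \<in> KB \<inter> coord_subspace B" if "inverse s *\<^sub>R y \<in> KB"
    using that assms(3) subspace_scale[OF subspace_coord_subspace] by blast
qed (use assms(4,5) in auto)

text \<open>The sections come from sets \<open>KA\<close>, \<open>KB\<close> that may differ from
  each other and from \<open>K\<close>, because the hull argument for equality combines sections of
  different level sets.\<close>

lemma scaled_vol_mult_le:
  assumes [measurable]: "KA \<in> sets borel" "KB \<in> sets borel" "K \<in> sets borel" and disj: "A \<inter> B = {}"
    and comb: "\<And>x y l. x \<in> KA \<inter> coord_subspace A \<Longrightarrow> y \<in> KB \<inter> coord_subspace B \<Longrightarrow> 0 < l \<Longrightarrow> l < 1 \<Longrightarrow>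
      (1 - l) *\<^sub>R x + l *\<^sub>R y \<in> K"
  shows "scaled_vol A KA * scaled_vol B KB \<le> scaled_vol (A \<union> B) K"
proof -
  have "AE p in coord_pair A B.
      exp_mass (rays KA (fst p)) * exp_mass (rays KB (snd p)) \<le> exp_mass (rays K (fst p + snd p))"
    using AE_coord_pair[of A B]
  proof eventually_elim
    case (elim p)
    then show ?case
      by (intro exp_mass_mult_le rays_pos sets_rays assms(1-3)) (auto intro: rays_add_coord[OF comb])
  qed
  then show ?thesis
    unfolding scaled_vol_Un[OF assms(3) disj] scaled_vol_mult[OF assms(1,2)]
    by (rule nn_integral_mono_AE)
qed

text \<open>A closed set missing \<open>0\<close> keeps a positive distance \<open>e\<close> from
  it, and \<open>x / r\<close> is closer to \<open>0\<close> than that once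
  \<open>r > norm x / e\<close>.\<close>

lemma rays_bounded:
  fixes K :: "'a::euclidean_space set"
  assumes "closed K" "0 \<notin> K"
  shows "\<exists>c. rays K x \<subseteq> {..c}"
proof -
  obtain e where e: "e > 0" "\<And>y. y \<in> K \<Longrightarrow> e \<le> dist 0 y"
    using separate_point_closed[OF assms] by blast
  have "r \<le> norm x / e" if "r \<in> rays K x" for r
  proof -
    have "0 < r" "e \<le> norm (inverse r *\<^sub>R x)"
      using that e(2)[of "inverse r *\<^sub>R x"] by (simp_all add: rays_def dist_norm)
    then have "e \<le> norm x / r" by (simp add: divide_inverse mult.commute)
    with \<open>0 < r\<close> e(1) show ?thesis by (simp add: field_simps)
  qed
  then show ?thesis by auto
qed

text \<open>If \<open>0 \<notin> K\<close>, all ray sets are bounded and the pointwise inequality is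
  strict wherever its smaller side is nonzero. Equality of the integrals would force that side to
  vanish almost everywhere, against \<open>pos\<close>.\<close>

lemma zero_mem_of_scaled_vol_eq:
  assumes K: "closed K" "convex K" and disj: "A \<inter> B = {}"
    and eq: "scaled_vol (A \<union> B) K = scaled_vol A K * scaled_vol B K"
    and pos: "scaled_vol A K * scaled_vol B K \<noteq> 0" and fin: "scaled_vol A K * scaled_vol B K < top"
  shows "0 \<in> K"
proof (rule ccontr)
  assume 0: "0 \<notin> K"
  have K_meas [measurable]: "K \<in> sets borel" using K by (simp add: borel_closed)
  let ?P = "\<lambda>p. exp_mass (rays K (fst p)) * exp_mass (rays K (snd p))"
  let ?Q = "\<lambda>p. exp_mass (rays K (fst p + snd p))"
  have add: "r + s \<in> rays K (x + y)" if "r \<in> rays K x" "s \<in> rays K y" for r s and x y :: "real ^ 'a"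
    by (rule rays_add[OF convexD[OF K(2)]]) (use that in auto)
  have less: "?P p < ?Q p" if nz: "?P p \<noteq> 0" for p
  proof -
    obtain c where "rays K (fst p) \<subseteq> {..c}" using rays_bounded[OF K(1) 0] by blast
    then show ?thesis using nz
      by (intro exp_mass_mult_less[where c=c] rays_pos sets_rays K_meas) (auto intro: add)
  qed
  then have "AE p in coord_pair A B. ?P p \<le> ?Q p"
    by (intro AE_I2) (metis less_imp_le zero_le)
  moreover have "integral\<^sup>N (coord_pair A B) ?Q = integral\<^sup>N (coord_pair A B) ?P"
    "integral\<^sup>N (coord_pair A B) ?P < top"
    using eq fin by (simp_all add: scaled_vol_Un[OF K_meas disj] scaled_vol_mult[OF K_meas K_meas])
  ultimately have "AE p in coord_pair A B. ?P p = ?Q p"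
    by (intro nn_integral_eq_imp_AE_eq) auto
  then have "AE p in coord_pair A B. ?P p = 0"
    by eventually_elim (metis less less_irrefl)
  then have "integral\<^sup>N (coord_pair A B) ?P = 0"
    by (subst nn_integral_0_iff_AE) auto
  with pos show False by (simp add: scaled_vol_mult[OF K_meas K_meas])
qed

lemma coord_subspace_disjoint_unique:
  fixes x y x' y' :: "real ^ 'n"
  assumes "A \<inter> B = {}" "x \<in> coord_subspace A" "x' \<in> coord_subspace A"
    "y \<in> coord_subspace B" "y' \<in> coord_subspace B" "x + y = x' + y'"
  shows "x = x'" "y = y'"
proof -
  have "x $ i = x' $ i \<and> y $ i = y' $ i" for i
    using assms by (auto simp: mem_coord_subspace vec_eq_iff dest!: spec[of _ i])
  then show "x = x'" "y = y'" by (auto simp: vec_eq_iff)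
qed

lemma rays_upward:
  assumes K: "convex K" "0 \<in> K" and "r \<in> rays K x" "r < r'"
  shows "r' \<in> rays K x"
proof -
  have r: "0 < r" "inverse r *\<^sub>R x \<in> K" using assms by (auto simp: rays_def)
  have "(r / r') *\<^sub>R (inverse r *\<^sub>R x) + (1 - r / r') *\<^sub>R 0 \<in> K"
    using K r assms(4) by (intro convexD) auto
  moreover have "(r / r') * inverse r = inverse r'" using r assms(4) by (simp add: field_simps)
  ultimately show ?thesis using r assms(4) by (simp add: rays_def)
qed

text \<open>Under \<open>split\<close> the gauge of \<open>K\<close> is additive across the two
  subspaces: if \<open>(x + y) / r\<close> lies on a segment between the sections, the radius is
  distributed as \<open>r * (1 - l)\<close> and \<open>r * l\<close>. This is the reverse inequality
  needed for the extremal bodies.\<close>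

lemma scaled_vol_le_mult:
  assumes K: "K \<in> sets borel" "convex K" "0 \<in> K" and disj: "A \<inter> B = {}"
    and split: "\<And>z. z \<in> K \<Longrightarrow> z \<in> coord_subspace (A \<union> B) \<Longrightarrow>
      \<exists>x\<in>K \<inter> coord_subspace A. \<exists>y\<in>K \<inter> coord_subspace B. \<exists>l\<in>{0..1}. z = (1 - l) *\<^sub>R x + l *\<^sub>R y"
  shows "scaled_vol (A \<union> B) K \<le> scaled_vol A K * scaled_vol B K"
proof -
  have "AE p in coord_pair A B.
      exp_mass (rays K (fst p + snd p)) \<le> exp_mass (rays K (fst p)) * exp_mass (rays K (snd p))"
    using AE_coord_pair[of A B]
  proof eventually_elim
    case (elim p)
    show ?case
    proof (rule exp_mass_le_mult[OF rays_pos _ rays_pos])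
      fix r e :: real assume r: "r \<in> rays K (fst p + snd p)" and e: "0 < e"
      have r0: "0 < r" using r by (simp add: rays_def)
      have "fst p \<in> coord_subspace (A \<union> B)" "snd p \<in> coord_subspace (A \<union> B)"
        using elim by (auto simp: mem_coord_subspace)
      then have "inverse r *\<^sub>R (fst p + snd p) \<in> coord_subspace (A \<union> B)"
        by (intro subspace_scale subspace_add subspace_coord_subspace)
      with r split[of "inverse r *\<^sub>R (fst p + snd p)"] obtain x y l where
        x: "x \<in> K" "x \<in> coord_subspace A" and y: "y \<in> K" "y \<in> coord_subspace B"
        and l: "0 \<le> l" "l \<le> 1" and z: "inverse r *\<^sub>R (fst p + snd p) = (1 - l) *\<^sub>R x + l *\<^sub>R y"
        by (auto simp: rays_def)
      have "fst p + snd p = (r * (1 - l)) *\<^sub>R x + (r * l) *\<^sub>R y"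
        using arg_cong[OF z, of "\<lambda>v. r *\<^sub>R v"] r0 by (simp add: scaleR_right_distrib)
      then have px: "fst p = (r * (1 - l)) *\<^sub>R x" and py: "snd p = (r * l) *\<^sub>R y"
        using elim x y coord_subspace_disjoint_unique[OF disj]
        by (meson subspace_scale subspace_coord_subspace)+
      \<comment> \<open>The radius \<open>c\<close> is \<open>0\<close> at one of the two points
        when \<open>l\<close> is \<open>0\<close> or \<open>1\<close>; adding \<open>e / 2\<close>
        makes it admissible, and \<open>0 \<in> K\<close> keeps the shrunken point in
        \<open>K\<close>.\<close>
      have *: "c + e / 2 \<in> rays K (c *\<^sub>R v)" if "0 \<le> c" "v \<in> K" for c and v :: "real ^ 'a"
      proof -
        have "inverse (c + e / 2) * c \<le> 1" "0 \<le> inverse (c + e / 2) * c" 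
          using that e by (auto simp: field_simps)
        then have "(inverse (c + e / 2) * c) *\<^sub>R v + (1 - inverse (c + e / 2) * c) *\<^sub>R 0 \<in> K"
          using that K by (intro convexD) auto
        with that e show ?thesis by (simp add: rays_def)
      qed
      show "\<exists>a\<in>rays K (fst p). \<exists>b\<in>rays K (snd p). a + b \<le> r + e"
      proof (intro bexI)
        show "r * (1 - l) + e / 2 + (r * l + e / 2) \<le> r + e" by (simp add: algebra_simps)
        show "r * (1 - l) + e / 2 \<in> rays K (fst p)" unfolding px using r0 l x by (intro *) auto
        show "r * l + e / 2 \<in> rays K (snd p)" unfolding py using r0 l y by (intro *) auto
      qed
    qed (use rays_upward K in blast)+
  qed
  then show ?thesis
    unfolding scaled_vol_Un[OF K(1) disj] scaled_vol_mult[OF K(1) K(1)]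
    by (rule nn_integral_mono_AE)
qed

subsection \<open>Sections of quasi-concave functions\<close>

lemma ennreal_eq_layers:
  assumes "0 \<le> (a::real)"
  shows "ennreal a = (\<integral>\<^sup>+t. indicator {0<..} t * indicator {t. t \<le> a} t \<partial>lborel)"
proof -
  have "ennreal a = (\<integral>\<^sup>+t. indicator {0<..a} t \<partial>lborel)" using assms by simp
  also have "\<dots> = (\<integral>\<^sup>+t. indicator {0<..} t * indicator {t. t \<le> a} t \<partial>lborel)"
    by (intro nn_integral_cong) (auto split: split_indicator)
  finally show ?thesis .
qed

lemma nn_integral_layers:
  assumes "sigma_finite_measure N" and [measurable]: "g \<in> borel_measurable N" and pos: "\<And>x. 0 \<le> g x"
  shows "(\<integral>\<^sup>+x. ennreal (g x) \<partial>N) =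
    (\<integral>\<^sup>+t. indicator {0<..} t * emeasure N {x\<in>space N. t \<le> g x} \<partial>lborel)"
proof -
  interpret N: sigma_finite_measure N by fact
  interpret pair_sigma_finite N "lborel :: real measure" ..
  have "(\<integral>\<^sup>+x. ennreal (g x) \<partial>N) =
    (\<integral>\<^sup>+x. \<integral>\<^sup>+t. indicator {0<..} t * indicator {t. t \<le> g x} t \<partial>lborel \<partial>N)"
    using pos by (intro nn_integral_cong) (rule ennreal_eq_layers)
  also have "\<dots> = (\<integral>\<^sup>+t. \<integral>\<^sup>+x. indicator {0<..} t * indicator {t. t \<le> g x} t \<partial>N \<partial>lborel)"
    by (rule Fubini'[symmetric]) measurable
  also have "\<dots> = (\<integral>\<^sup>+t. indicator {0<..} t * emeasure N {x\<in>space N. t \<le> g x} \<partial>lborel)"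
  proof (rule nn_integral_cong)
    fix t :: real
    have "(\<integral>\<^sup>+x. indicator {0<..} t * indicator {t. t \<le> g x} t \<partial>N) =
        (\<integral>\<^sup>+x. indicator {0<..} t * indicator {x\<in>space N. t \<le> g x} x \<partial>N)"
      by (intro nn_integral_cong) (auto split: split_indicator)
    then show "(\<integral>\<^sup>+x. indicator {0<..} t * indicator {t. t \<le> g x} t \<partial>N) =
        indicator {0<..} t * emeasure N {x\<in>space N. t \<le> g x}"
      by (simp add: nn_integral_cmult)
  qed
  finally show ?thesis .
qed

lemma fact_less_top [simp]: "(fact n :: ennreal) < top"
  by (metis of_nat_fact of_nat_less_top)

definition scaled_integral :: "'n::finite set \<Rightarrow> (real ^ 'n \<Rightarrow> real) \<Rightarrow> ennreal" where
  "scaled_integral A g = fact (card A) * (\<integral>\<^sup>+x. ennreal (g x) \<partial>coord_measure A)"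

lemma scaled_integral_layers:
  assumes [measurable]: "g \<in> borel_measurable borel" and "\<And>x. 0 \<le> g x"
  shows "scaled_integral A g = (\<integral>\<^sup>+t. indicator {0<..} t * scaled_vol A {x. t \<le> g x} \<partial>lborel)"
proof -
  interpret A: sigma_finite_measure "coord_measure A" by (rule sigma_finite_coord_measure)
  have "scaled_integral A g =
    fact (card A) * (\<integral>\<^sup>+t. indicator {0<..} t * emeasure (coord_measure A) {x. t \<le> g x} \<partial>lborel)"
    unfolding scaled_integral_def using assms
    by (subst nn_integral_layers[OF sigma_finite_coord_measure]) auto
  also have "\<dots> = (\<integral>\<^sup>+t. fact (card A) * (indicator {0<..} t * emeasure (coord_measure A) {x. t \<le> g x}) \<partial>lborel)"
    by (rule nn_integral_cmult[symmetric]) measurable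
  finally show ?thesis by (simp add: scaled_vol_def mult.left_commute)
qed

lemma scaled_vol_level_measurable [measurable]:
  fixes g :: "real ^ 'n \<Rightarrow> real"
  assumes [measurable]: "g \<in> borel_measurable borel"
  shows "(\<lambda>t. scaled_vol A {x. t \<le> g x}) \<in> borel_measurable borel"
proof -
  interpret A: sigma_finite_measure "coord_measure A" by (rule sigma_finite_coord_measure)
  show ?thesis unfolding scaled_vol_def by measurable
qed

text \<open>The middle term of the inequality. A pair is above height \<open>t\<close> exactly when
  both points are, so its layers are products of section volumes. It separates the two losses, one
  between values and one between volumes of level sets, so that equality can be read off for
  each.\<close>

definition scaled_min :: "'n::finite set \<Rightarrow> 'n set \<Rightarrow> (real ^ 'n \<Rightarrow> real) \<Rightarrow> ennreal" where
  "scaled_min A B g = fact (card A) * fact (card B) *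
     (\<integral>\<^sup>+p. ennreal (min (g (fst p)) (g (snd p))) \<partial>coord_pair A B)"

lemma scaled_min_layers:
  assumes [measurable]: "g \<in> borel_measurable borel" and pos: "\<And>x. 0 \<le> g x"
  shows "scaled_min A B g =
    (\<integral>\<^sup>+t. indicator {0<..} t * (scaled_vol A {x. t \<le> g x} * scaled_vol B {x. t \<le> g x}) \<partial>lborel)"
proof -
  interpret A: sigma_finite_measure "coord_measure A" by (rule sigma_finite_coord_measure)
  interpret B: sigma_finite_measure "coord_measure B" by (rule sigma_finite_coord_measure)
  interpret pair_sigma_finite "coord_measure A" "coord_measure B" by (rule pair_sigma_finite_coord)
  have sf: "sigma_finite_measure (coord_pair A B)" by (rule sigma_finite_measure_axioms)
  have *: "emeasure (coord_pair A B) {p \<in> space (coord_pair A B). t \<le> min (g (fst p)) (g (snd p))} =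
      emeasure (coord_measure A) {x. t \<le> g x} * emeasure (coord_measure B) {x. t \<le> g x}" for t
  proof -
    have "{p \<in> space (coord_pair A B). t \<le> min (g (fst p)) (g (snd p))} = {x. t \<le> g x} \<times> {x. t \<le> g x}"
      by (auto simp: space_pair_measure)
    then show ?thesis by (simp add: B.emeasure_pair_measure_Times)
  qed
  have "scaled_min A B g = fact (card A) * fact (card B) * (\<integral>\<^sup>+t. indicator {0<..} t *
      (emeasure (coord_measure A) {x. t \<le> g x} * emeasure (coord_measure B) {x. t \<le> g x}) \<partial>lborel)"
  proof -
    have "(\<integral>\<^sup>+p. ennreal (min (g (fst p)) (g (snd p))) \<partial>coord_pair A B) =
        (\<integral>\<^sup>+t. indicator {0<..} t * emeasure (coord_pair A B)
          {p \<in> space (coord_pair A B). t \<le> min (g (fst p)) (g (snd p))} \<partial>lborel)"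
      by (rule nn_integral_layers[OF sf]) (use pos in auto)
    then show ?thesis unfolding scaled_min_def * by simp
  qed
  also have "\<dots> = (\<integral>\<^sup>+t. fact (card A) * fact (card B) * (indicator {0<..} t *
      (emeasure (coord_measure A) {x. t \<le> g x} * emeasure (coord_measure B) {x. t \<le> g x})) \<partial>lborel)"
    by (rule nn_integral_cmult[symmetric]) measurable
  finally show ?thesis by (simp add: scaled_vol_def mult_ac)
qed

definition quasi_concave :: "(real ^ 'n \<Rightarrow> real) \<Rightarrow> bool" where
  "quasi_concave g \<longleftrightarrow> (\<forall>x y l. 0 < l \<longrightarrow> l < 1 \<longrightarrow> min (g x) (g y) \<le> g ((1 - l) *\<^sub>R x + l *\<^sub>R y))"

lemma quasi_concave_convex: "quasi_concave g \<Longrightarrow> convex {x. t \<le> g x}"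
proof (rule convexI)
  fix x y and u v :: real
  assume g: "quasi_concave g" and xy: "x \<in> {x. t \<le> g x}" "y \<in> {x. t \<le> g x}" and uv: "0 \<le> u" "0 \<le> v" "u + v = 1"
  have u: "u = 1 - v" using uv by simp
  consider "v = 0" | "v = 1" | "0 < v" "v < 1" using uv by linarith
  then show "u *\<^sub>R x + v *\<^sub>R y \<in> {x. t \<le> g x}"
  proof cases
    case 3
    then have "min (g x) (g y) \<le> g ((1 - v) *\<^sub>R x + v *\<^sub>R y)" using g by (simp add: quasi_concave_def)
    with xy u show ?thesis by auto
  qed (use xy u in auto)
qed

lemma quasi_concave_convex_supp:
  assumes f: "quasi_concave f"
  shows "convex (supp f)"
proof (rule convexI)
  fix x y and u v :: real assume *: "x \<in> supp f" "y \<in> supp f" "0 \<le> u" "0 \<le> v" "u + v = 1"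
  then have "u *\<^sub>R x + v *\<^sub>R y \<in> {z. min (f x) (f y) \<le> f z}"
    by (intro convexD[OF quasi_concave_convex[OF f]]) auto
  with * show "u *\<^sub>R x + v *\<^sub>R y \<in> supp f" by (auto simp: supp_def)
qed

lemma scaled_min_le:
  assumes g: "g \<in> borel_measurable borel" "\<And>x. 0 \<le> g x" "quasi_concave g" and disj: "A \<inter> B = {}"
  shows "scaled_min A B g \<le> scaled_integral (A \<union> B) g"
proof -
  note [measurable] = g(1)
  have "scaled_vol A {x. t \<le> g x} * scaled_vol B {x. t \<le> g x} \<le> scaled_vol (A \<union> B) {x. t \<le> g x}" for t
    by (rule scaled_vol_mult_le[OF _ _ _ disj])
      (use quasi_concave_convex[OF g(3)] in \<open>auto simp: convex_alt\<close>)
  then show ?thesis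
    unfolding scaled_min_layers[OF g(1,2)] scaled_integral_layers[OF g(1,2)]
    by (intro nn_integral_mono mult_left_mono) auto
qed

lemma scaled_integral_mult:
  assumes [measurable]: "g \<in> borel_measurable borel" and pos: "\<And>x. 0 \<le> g x"
  shows "scaled_integral A g * scaled_integral B g = fact (card A) * fact (card B) *
     (\<integral>\<^sup>+p. ennreal (g (fst p) * g (snd p)) \<partial>coord_pair A B)"
  unfolding scaled_integral_def
  using nn_integral_coord_pair_mult[of "\<lambda>x. ennreal (g x)" "\<lambda>x. ennreal (g x)" A B] pos
  by (simp add: ennreal_mult' mult_ac)

lemma mult_le_min_unit: "a * b \<le> min a b" if "0 \<le> a" "a \<le> 1" "0 \<le> b" "b \<le> (1::real)"
  using that mult_left_le[of b a] mult_left_le[of a b] by (simp add: mult.commute)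

text \<open>The bound \<open>a * b \<le> min a b\<close> is for values in the unit interval; this is
  what dividing by the supremum is for, and it accounts for the power of the sup norm in the
  theorem.\<close>

lemma scaled_integral_mult_le_min:
  assumes [measurable]: "g \<in> borel_measurable borel" and g: "\<And>x. 0 \<le> g x" "\<And>x. g x \<le> 1"
  shows "scaled_integral A g * scaled_integral B g \<le> scaled_min A B g"
  unfolding scaled_integral_mult[OF assms(1) g(1)] scaled_min_def
  by (intro mult_left_mono nn_integral_mono ennreal_leI mult_le_min_unit g) auto

lemma scaled_integral_mult_le:
  assumes g: "g \<in> borel_measurable borel" "\<And>x. 0 \<le> g x" "\<And>x. g x \<le> 1" "quasi_concave g" and disj: "A \<inter> B = {}"
  shows "scaled_integral A g * scaled_integral B g \<le> scaled_integral (A \<union> B) g"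
  using scaled_integral_mult_le_min[OF g(1-3)] scaled_min_le[OF g(1,2,4) disj] by (rule order_trans)

text \<open>One member is split off at a time, against the union of the tail. The empty list has to
  be excluded: there the claim would read \<open>1 \<le> g 0\<close>.\<close>

lemma scaled_integral_prod_le:
  assumes g: "g \<in> borel_measurable borel" "\<And>x. 0 \<le> g x" "\<And>x. g x \<le> 1" "quasi_concave g"
    and "sorted_wrt (\<lambda>A B. A \<inter> B = {}) b" "b \<noteq> []"
  shows "(\<Prod>A\<leftarrow>b. scaled_integral A g) \<le> scaled_integral (\<Union>(set b)) g"
  using assms(5,6)
proof (induction b)
  case (Cons A b)
  show ?case
  proof (cases "b = []")
    case False
    have "(\<Prod>A\<leftarrow>A # b. scaled_integral A g) \<le> scaled_integral A g * scaled_integral (\<Union>(set b)) g"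
      using Cons False by (auto intro: mult_left_mono)
    also have "\<dots> \<le> scaled_integral (A \<union> \<Union>(set b)) g"
      using Cons.prems by (intro scaled_integral_mult_le g) auto
    finally show ?thesis by simp
  qed simp
qed simp

text \<open>Disjointness is expressed by \<open>sorted_wrt\<close> on the list, since a cover may
  contain the empty set several times.\<close>

lemma is_cover_1:
  assumes "is_cover 1 b A"
  shows "sorted_wrt (\<lambda>A B. A \<inter> B = {}) b" "\<Union>(set b) = A" "b \<noteq> []"
proof -
  have card: "card {i. i < length b \<and> j \<in> b ! i} = 1" if "j \<in> A" for j
    using assms that unfolding is_cover_def by blast
  have sub: "b ! i \<subseteq> A" if "i < length b" for i
    using assms that unfolding is_cover_def by blast
  show "b \<noteq> []" using assms unfolding is_cover_def by blast
  have "b ! i \<inter> b ! k = {}" if "i < k" "k < length b" for i k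
  proof (rule ccontr)
    assume "b ! i \<inter> b ! k \<noteq> {}"
    then obtain j where j: "j \<in> b ! i" "j \<in> b ! k" by blast
    then have "j \<in> A" using sub[of i] that by auto
    from card[OF this] obtain q where q: "{i. i < length b \<and> j \<in> b ! i} = {q}" by (rule card_1_singletonE)
    have "i \<in> {i. i < length b \<and> j \<in> b ! i}" "k \<in> {i. i < length b \<and> j \<in> b ! i}" using j that by auto
    then have "i = q" "k = q" unfolding q by auto
    with that show False by simp
  qed
  then show "sorted_wrt (\<lambda>A B. A \<inter> B = {}) b" by (auto simp: sorted_wrt_iff_nth_less)
  show "\<Union>(set b) = A"
  proof
    show "\<Union>(set b) \<subseteq> A" using sub by (force simp: in_set_conv_nth)
    show "A \<subseteq> \<Union>(set b)"
    proof
      fix j assume "j \<in> A"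
      from card[OF this] obtain q where "{i. i < length b \<and> j \<in> b ! i} = {q}" by (rule card_1_singletonE)
      then have "q < length b" "j \<in> b ! q" by blast+
      then show "j \<in> \<Union>(set b)" by (auto intro: nth_mem)
    qed
  qed
qed

text \<open>Assumption \<open>eq\<close> squeezes \<open>scaled_min A B g\<close> between equal
  finite numbers, so both halves of the inequality are equalities of integrals with ordered
  integrands.\<close>

lemma scaled_integral_eq_consequences:
  assumes g: "g \<in> borel_measurable borel" "\<And>x. 0 \<le> g x" "\<And>x. g x \<le> 1" "quasi_concave g" and disj: "A \<inter> B = {}"
    and eq: "scaled_integral (A \<union> B) g \<le> scaled_integral A g * scaled_integral B g"
    and fin: "scaled_integral A g * scaled_integral B g < top"
  shows "AE p in coord_pair A B. g (fst p) * g (snd p) = min (g (fst p)) (g (snd p))"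
    and "AE t in lborel. 0 < t \<longrightarrow>
      scaled_vol (A \<union> B) {x. t \<le> g x} = scaled_vol A {x. t \<le> g x} * scaled_vol B {x. t \<le> g x}"
proof -
  note [measurable] = g(1)
  let ?v = "\<lambda>A t. scaled_vol A {x. t \<le> g x}"
  have min: "scaled_min A B g = scaled_integral A g * scaled_integral B g"
    and full: "scaled_integral (A \<union> B) g = scaled_min A B g"
    using scaled_integral_mult_le_min[OF g(1-3), of A B] scaled_min_le[OF g(1,2,4) disj] eq
    by (auto intro: antisym)
  have f: "(0::ennreal) < fact (card A) * fact (card B)"
    by (simp add: zero_less_iff_neq_zero)
  have f': "fact (card A) * fact (card B) < (top::ennreal)"
    by (simp add: ennreal_mult_less_top fact_less_top)
  have "AE p in coord_pair A B. ennreal (g (fst p) * g (snd p)) = ennreal (min (g (fst p)) (g (snd p)))"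
  proof (rule nn_integral_eq_imp_AE_eq)
    show "AE p in coord_pair A B. ennreal (g (fst p) * g (snd p)) \<le> ennreal (min (g (fst p)) (g (snd p)))"
      by (intro AE_I2 ennreal_leI mult_le_min_unit g)
    show "(\<integral>\<^sup>+p. ennreal (min (g (fst p)) (g (snd p))) \<partial>coord_pair A B) =
        (\<integral>\<^sup>+p. ennreal (g (fst p) * g (snd p)) \<partial>coord_pair A B)"
      using min f f' unfolding scaled_min_def scaled_integral_mult[OF g(1,2)]
      by (auto simp: ennreal_mult_cancel_left)
    show "(\<integral>\<^sup>+p. ennreal (g (fst p) * g (snd p)) \<partial>coord_pair A B) < top"
      using fin f unfolding scaled_integral_mult[OF g(1,2)] by (auto simp: ennreal_mult_less_top)
  qed measurable
  then show "AE p in coord_pair A B. g (fst p) * g (snd p) = min (g (fst p)) (g (snd p))"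
    by eventually_elim (use g in \<open>simp add: ennreal_inj\<close>)
  have "AE t in lborel. indicator {0<..} t * (?v A t * ?v B t) = indicator {0<..} t * ?v (A \<union> B) t"
  proof (rule nn_integral_eq_imp_AE_eq)
    show "AE t in lborel. indicator {0<..} t * (?v A t * ?v B t) \<le> indicator {0<..} t * ?v (A \<union> B) t"
      using scaled_vol_mult_le[OF _ _ _ disj] quasi_concave_convex[OF g(4)]
      by (intro AE_I2 mult_left_mono scaled_vol_mult_le[OF _ _ _ disj]) (auto simp: convex_alt)
    show "(\<integral>\<^sup>+t. indicator {0<..} t * ?v (A \<union> B) t \<partial>lborel) =
        (\<integral>\<^sup>+t. indicator {0<..} t * (?v A t * ?v B t) \<partial>lborel)"
      using full by (simp add: scaled_min_layers[OF g(1,2)] scaled_integral_layers[OF g(1,2)])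
    show "(\<integral>\<^sup>+t. indicator {0<..} t * (?v A t * ?v B t) \<partial>lborel) < top"
      using min fin by (simp add: scaled_min_layers[OF g(1,2)])
  qed measurable
  then show "AE t in lborel. 0 < t \<longrightarrow> ?v (A \<union> B) t = ?v A t * ?v B t"
    by eventually_elim (auto split: split_indicator_asm)
qed

subsection \<open>Volume and convexity\<close>

lemma emeasure_lborel_ball_pos:
  fixes c :: "'a::euclidean_space"
  assumes "0 < r"
  shows "0 < emeasure lborel (ball c r)"
  using assms by (simp add: emeasure_ball zero_less_power)

lemma emeasure_lborel_open_pos:
  fixes U :: "'a::euclidean_space set"
  assumes "open U" "U \<noteq> {}"
  shows "0 < emeasure lborel U"
proof -
  obtain c r where "0 < r" "ball c r \<subseteq> U" using assms by (meson ex_in_conv openE)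
  then show ?thesis
    using emeasure_lborel_ball_pos[of r c] emeasure_mono[of "ball c r" U lborel] assms by force
qed

text \<open>An unbounded convex set containing a ball contains arbitrarily many disjoint balls of
  half its radius: contract the ball towards a far point \<open>q\<close>, stopping before the
  middle of the segment.\<close>

lemma bounded_of_finite_volume:
  fixes S :: "'a::euclidean_space set"
  assumes S: "convex S" "S \<in> sets borel" "interior S \<noteq> {}" and fin: "emeasure lborel S < top"
  shows "bounded S"
proof (rule ccontr)
  assume unb: "\<not> bounded S"
  obtain p e where e: "0 < e" and ball: "ball p e \<subseteq> S"
    using S(3) by (meson ex_in_conv mem_interior)
  define b where "b = unit_ball_vol (DIM('a)) * (e / 2) ^ DIM('a)"
  have b: "0 < b" using e by (simp add: b_def zero_less_power)
  have many: "ennreal (real N * b) \<le> emeasure lborel S" if N: "0 < N" for N :: nat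
  proof -
    \<comment> \<open>The distance \<open>2 * N * e\<close> leaves room for \<open>N\<close> centres
      in the first half of the segment, spaced at least \<open>e\<close> apart.\<close>
    obtain q where q: "q \<in> S" "norm p + 2 * real N * e < norm q"
      using unb unfolding bounded_iff by (meson not_le)
    have d: "2 * real N * e \<le> norm (q - p)" using q(2) norm_triangle_ineq2[of q p] by linarith
    define c where "c i = p + (real i / (2 * real N)) *\<^sub>R (q - p)" for i
    have sub: "ball (c i) (e / 2) \<subseteq> S" if "i < N" for i
    proof
      fix w assume w: "w \<in> ball (c i) (e / 2)"
      define s where "s = real i / (2 * real N)"
      have s: "0 \<le> s" "s \<le> 1 / 2" using that by (auto simp: s_def field_simps)
      \<comment> \<open>The preimage of \<open>w\<close> under the contraction by
        \<open>1 - s\<close> towards \<open>q\<close>; since \<open>1 - s \<ge> 1 / 2\<close>, it is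
        still within \<open>e\<close> of \<open>p\<close>.\<close>
      define p' where "p' = p + (1 / (1 - s)) *\<^sub>R (w - c i)"
      have "norm ((1 / (1 - s)) *\<^sub>R (w - c i)) = norm (w - c i) / (1 - s)"
        using s by simp
      also have "\<dots> \<le> norm (w - c i) / (1 / 2)"
        using s by (intro divide_left_mono) auto
      also have "\<dots> < e" using w by (simp add: dist_norm norm_minus_commute)
      finally have "p' \<in> S" using ball by (auto simp: p'_def dist_norm)
      then have "(1 - s) *\<^sub>R p' + s *\<^sub>R q \<in> S" using S(1) q(1) s by (intro convexD) auto
      moreover have "(1 - s) *\<^sub>R p' + s *\<^sub>R q = w"
      proof -
        have "(1 - s) *\<^sub>R p' = (1 - s) *\<^sub>R p + (w - c i)"
          using s by (simp add: p'_def scaleR_right_distrib)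
        moreover have "c i = p + s *\<^sub>R (q - p)" by (simp add: c_def s_def)
        ultimately show ?thesis by (simp add: algebra_simps)
      qed
      ultimately show "w \<in> S" by simp
    qed
    have disj: "disjoint_family_on (\<lambda>i. ball (c i) (e / 2)) {..<N}"
    proof (unfold disjoint_family_on_def, intro ballI impI)
      fix i j assume ij: "i \<in> {..<N}" "j \<in> {..<N}" "i \<noteq> j"
      have "1 \<le> \<bar>real i - real j\<bar>" using ij(3) by linarith
      then have "(1 / (2 * real N)) * (2 * real N * e) \<le> (\<bar>real i - real j\<bar> / (2 * real N)) * norm (q - p)"
        using d e N by (intro mult_mono divide_right_mono) auto
      also have "\<dots> = dist (c i) (c j)"
      proof -
        have "c i - c j = ((real i - real j) / (2 * real N)) *\<^sub>R (q - p)"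
          by (simp add: c_def scaleR_left_diff_distrib diff_divide_distrib)
        then show ?thesis using N by (simp add: dist_norm)
      qed
      finally have far: "e \<le> dist (c i) (c j)" using N by simp
      show "ball (c i) (e / 2) \<inter> ball (c j) (e / 2) = {}"
      proof (rule ccontr)
        assume "ball (c i) (e / 2) \<inter> ball (c j) (e / 2) \<noteq> {}"
        then obtain w where "dist (c i) w < e / 2" "dist (c j) w < e / 2" by auto
        with far dist_triangle2[of "c i" "c j" w] show False by linarith
      qed
    qed
    have "ennreal (real N * b) = (\<Sum>i<N. emeasure lborel (ball (c i) (e / 2)))"
      using e b by (simp add: emeasure_ball b_def[symmetric] ennreal_mult' ennreal_of_nat_eq_real_of_nat)
    also have "\<dots> = emeasure lborel (\<Union>i<N. ball (c i) (e / 2))"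
      by (rule sum_emeasure) (use disj in auto)
    also have "\<dots> \<le> emeasure lborel S"
      using sub S(2) by (intro emeasure_mono) auto
    finally show ?thesis .
  qed
  obtain v where v: "0 \<le> v" "emeasure lborel S = ennreal v"
    using fin by (metis ennreal_cases less_irrefl infinity_ennreal_def)
  obtain N where "v / b < real N" using reals_Archimedean2 by blast
  then have "v < real (Suc N) * b" using b by (simp add: field_simps)
  with many[of "Suc N"] v b show False by (simp add: ennreal_le_iff del: of_nat_Suc)
qed

text \<open>For convex \<open>K\<close> with both sections nonempty: \<open>K\<close> is the convex
  hull of its sections by \<open>H_A\<close> and \<open>H_(-A)\<close>. It is stated pointwise
  because the gauge estimate and the extreme point argument both start from a single
  \<open>z\<close>.\<close>

definition splits :: "'n::finite set \<Rightarrow> (real ^ 'n) set \<Rightarrow> bool" where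
  "splits A K \<longleftrightarrow> (\<forall>z\<in>K. \<exists>x\<in>K \<inter> coord_subspace A. \<exists>y\<in>K \<inter> coord_subspace (- A). \<exists>l\<in>{0..1}.
     z = (1 - l) *\<^sub>R x + l *\<^sub>R y)"

lemma closed_coord_subspace: "closed (coord_subspace A)"
  by (rule closed_subspace[OF subspace_coord_subspace])

lemma scaled_vol_coord_subspace:
  assumes [measurable]: "K \<in> sets borel"
  shows "scaled_vol A (K \<inter> coord_subspace A) = scaled_vol A K"
  unfolding scaled_vol_def using AE_coord_measure[of A]
  by (subst emeasure_eq_AE[of "K \<inter> coord_subspace A" K "coord_measure A"]) (auto elim!: eventually_mono)

lemma scaled_vol_UNIV: "scaled_vol UNIV K = fact CARD('n) * emeasure lborel K" for K :: "(real ^ 'n) set"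
  by (simp add: scaled_vol_def coord_measure_UNIV)

lemma fact_ennreal_pos [simp]: "(0::ennreal) < fact n"
  by (simp add: zero_less_iff_neq_zero)

text \<open>By the product inequality the hull has at least the volume of \<open>K\<close>, while
  lying inside it. So \<open>interior K\<close> minus the hull is open and null, hence empty, and
  \<open>K\<close> lies in the closure of its interior.\<close>

lemma subset_hull_of_scaled_vol:
  fixes K :: "(real ^ 'n) set"
  assumes K: "compact K" "convex K" "interior K \<noteq> {}"
    and L: "compact LA" "convex LA" "LA \<subseteq> K" "compact LB" "convex LB" "LB \<subseteq> K"
    and le: "scaled_vol UNIV K \<le> scaled_vol A LA * scaled_vol (- A) LB"
  shows "K \<subseteq> convex hull (LA \<union> LB)"
proof -
  let ?D = "convex hull (LA \<union> LB)"
  have cD: "compact ?D" using L by (intro compact_convex_hull compact_Un)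
  have DK: "?D \<subseteq> K" using L K by (intro hull_minimal) auto
  note [measurable] = borel_compact[OF cD] borel_compact[OF K(1)] borel_compact[OF L(1)] borel_compact[OF L(4)]
  have "scaled_vol A LA * scaled_vol (- A) LB \<le> scaled_vol (A \<union> - A) ?D"
  proof (rule scaled_vol_mult_le)
    fix x y and l :: real
    assume "x \<in> LA \<inter> coord_subspace A" "y \<in> LB \<inter> coord_subspace (- A)" "0 < l" "l < 1"
    then show "(1 - l) *\<^sub>R x + l *\<^sub>R y \<in> ?D"
      by (intro convexD[OF convex_convex_hull] hull_inc) auto
  qed auto
  with le have "scaled_vol UNIV K \<le> scaled_vol UNIV ?D" by simp
  then have le': "emeasure lborel K \<le> emeasure lborel ?D"
    by (simp add: scaled_vol_UNIV ennreal_mult_le_mult_iff)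
  have fin: "emeasure lborel ?D < top" using emeasure_compact_finite[OF cD] by simp
  have "emeasure lborel (K - ?D) = emeasure lborel K - emeasure lborel ?D"
    using DK fin by (intro emeasure_Diff) auto
  also have "\<dots> = 0" using le' using fin by (auto simp: diff_eq_0_iff_ennreal intro: le_less_trans)
  finally have null: "emeasure lborel (K - ?D) = 0" .
  have "emeasure lborel (interior K - ?D) \<le> emeasure lborel (K - ?D)"
    using interior_subset by (intro emeasure_mono) auto
  with null have "emeasure lborel (interior K - ?D) = 0" by simp
  then have "interior K - ?D = {}"
    using emeasure_lborel_open_pos[of "interior K - ?D"] compact_imp_closed[OF cD]
    by (metis less_irrefl open_Diff open_interior)
  then have "closure (interior K) \<subseteq> ?D"
    using compact_imp_closed[OF cD] by (intro closure_minimal) auto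
  moreover have "K \<subseteq> closure (interior K)"
    using convex_closure_interior[OF K(2,3)] closure_subset by auto
  ultimately show ?thesis by blast
qed

lemma AE_lborel_ex_between:
  assumes "AE t in lborel. P t" "a < (b::real)"
  shows "\<exists>t. a < t \<and> t < b \<and> P t"
proof (rule ccontr)
  assume *: "\<not> ?thesis"
  have "AE t in lborel. t \<notin> {a<..<b}"
    using assms(1) by eventually_elim (use * in auto)
  then have "emeasure lborel {a<..<b} = 0"
    by (subst (asm) AE_iff_measurable[OF _ refl]) (auto simp: greaterThanLessThan_def greaterThan_def lessThan_def Int_def)
  with assms(2) show False by simp
qed

subsection \<open>Log-concave functions with supremum one\<close>

lemma null_of_convex_empty_interior:
  fixes S :: "'a::euclidean_space set"
  assumes "convex S" "S \<in> sets borel" "interior S = {}"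
  shows "emeasure lborel S = 0"
proof -
  have "negligible S"
    using negligible_convex_interior[OF assms(1)] assms(3) by simp
  then have "S \<in> null_sets (completion lborel)" by (simp add: negligible_iff_null_sets)
  then show ?thesis using assms(2) by (auto simp: null_sets_completion_iff)
qed

lemma log_concaveD:
  assumes "log_concave f"
  shows "0 \<le> f x"
    and "0 \<le> l \<Longrightarrow> l \<le> 1 \<Longrightarrow> f x powr (1 - l) * f y powr l \<le> f ((1 - l) *\<^sub>R x + l *\<^sub>R y)"
  using assms by (auto simp: log_concave_def)

lemma log_concave_imp_quasi_concave:
  assumes f: "log_concave f"
  shows "quasi_concave f"
  unfolding quasi_concave_def
proof (intro allI impI)
  fix x y and l :: real assume l: "0 < l" "l < 1"
  let ?m = "min (f x) (f y)"
  have m: "0 \<le> ?m" using log_concaveD(1)[OF f] by simp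
  have "?m = ?m powr (1 - l) * ?m powr l"
    using m by (cases "?m = 0") (auto simp: powr_add[symmetric])
  also have "\<dots> \<le> f x powr (1 - l) * f y powr l"
    using m l by (intro mult_mono powr_mono2) auto
  also have "\<dots> \<le> f ((1 - l) *\<^sub>R x + l *\<^sub>R y)"
    using l by (intro log_concaveD(2)[OF f]) auto
  finally show "?m \<le> f ((1 - l) *\<^sub>R x + l *\<^sub>R y)" .
qed

lemma borel_measurable_of_closed_levels:
  fixes h :: "'a::topological_space \<Rightarrow> real"
  assumes "\<And>x. 0 \<le> h x" "\<And>t. 0 < t \<Longrightarrow> closed {x. t \<le> h x}"
  shows "h \<in> borel_measurable borel"
proof (subst borel_measurable_iff_ge, rule allI)
  fix a
  have "{x. a \<le> h x} \<in> sets borel"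
  proof (cases "0 < a")
    case False
    then have "{x. a \<le> h x} = UNIV" using assms(1) by (auto intro: order_trans[of a 0])
    then show ?thesis by simp
  qed (simp add: assms(2) borel_closed)
  then show "{w \<in> space borel. a \<le> h w} \<in> sets borel" by simp
qed

text \<open>Abstracts the regularized function divided by its supremum. Closed levels make
  \<open>h\<close> Borel, so its restrictions to subspaces are measurable; \<open>sup_1\<close> says
  that the value \<open>1\<close> is approached, not that it is attained.\<close>

locale unit_log_concave =
  fixes h :: "real ^ 'n \<Rightarrow> real"
  assumes log_concave: "log_concave h" and le_1: "\<And>x. h x \<le> 1"
    and closed_level: "\<And>t. 0 < t \<Longrightarrow> closed {x. t \<le> h x}"
    and finite_integral: "(\<integral>\<^sup>+x. ennreal (h x) \<partial>lborel) < top"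
    and interior_supp: "interior (supp h) \<noteq> {}"
    and sup_1: "\<And>e. e < 1 \<Longrightarrow> \<exists>x. e < h x"
begin

abbreviation level :: "real \<Rightarrow> (real ^ 'n) set" where
  "level t \<equiv> {x. t \<le> h x}"

lemma nonneg: "0 \<le> h x"
  using log_concaveD(1)[OF log_concave] .

lemma qc: "quasi_concave h"
  by (rule log_concave_imp_quasi_concave[OF log_concave])

lemma convex_level: "convex (level t)"
  by (rule quasi_concave_convex[OF qc])

lemma measurable_h [measurable]: "h \<in> borel_measurable borel"
  by (rule borel_measurable_of_closed_levels[OF nonneg closed_level])

lemma measurable_level [measurable]: "level t \<in> sets borel"
  by measurable

text \<open>The levels at heights \<open>1 / n\<close> exhaust the support. Convex sets without
  interior are null, so if all these levels were flat, the open set \<open>interior (supp h)\<close>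
  would be null.\<close>

lemma interior_some_level: "\<exists>t>0. interior (level t) \<noteq> {}"
proof (rule ccontr)
  assume *: "\<not> ?thesis"
  have "emeasure lborel (level (1 / real (Suc n))) = 0" for n
    using * by (intro null_of_convex_empty_interior convex_level measurable_level) auto
  then have "AE x in lborel. x \<notin> level (1 / real (Suc n))" for n
    by (intro AE_I[of _ _ "level (1 / real (Suc n))"]) auto
  then have "AE x in lborel. \<forall>n. x \<notin> level (1 / real (Suc n))" by (simp add: AE_all_countable)
  then have "AE x in lborel. x \<notin> interior (supp h)"
  proof eventually_elim
    case (elim x)
    show ?case
    proof
      assume "x \<in> interior (supp h)"
      then have "0 < h x" using interior_subset by (auto simp: supp_def)
      then obtain n where "1 / real (Suc n) < h x" by (rule nat_approx_posE)
      with elim show False by (meson less_imp_le mem_Collect_eq)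
    qed
  qed
  then have "emeasure lborel (interior (supp h)) = 0"
    by (subst (asm) AE_iff_measurable[OF _ refl]) auto
  with emeasure_lborel_open_pos[OF open_interior interior_supp] show False by simp
qed

text \<open>A level with interior, contracted almost entirely onto a point \<open>p\<close> with
  \<open>h p > u\<close>, lands in \<open>level u\<close>: log-concavity bounds the values below by
  \<open>h p powr (1 - l) * t powr l\<close>, which tends to \<open>h p\<close> as \<open>l\<close>
  tends to \<open>0\<close>.\<close>

lemma interior_level:
  assumes "u < 1"
  shows "interior (level u) \<noteq> {}"
proof -
  obtain t where t: "0 < t" "interior (level t) \<noteq> {}" using interior_some_level by blast
  obtain p where p: "max u 0 < h p" using sup_1[of "max u 0"] assms by auto
  have "((\<lambda>l. h p powr (1 - l) * t powr l) \<longlongrightarrow> h p powr (1 - 0) * t powr 0) (at_right 0)"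
    using p t by (intro tendsto_intros) auto
  then have "((\<lambda>l. h p powr (1 - l) * t powr l) \<longlongrightarrow> h p) (at_right 0)"
    using p t by simp
  then have "\<forall>\<^sub>F l in at_right 0. u < h p powr (1 - l) * t powr l"
    using p by (intro order_tendstoD(1)) auto
  moreover have "\<forall>\<^sub>F l in at_right (0::real). l < 1" 
    by (rule eventually_at_right_real[of 0 1, simplified, THEN eventually_mono]) auto
  moreover have "\<forall>\<^sub>F l in at_right (0::real). 0 < l" by (rule eventually_at_right_less)
  ultimately have "\<forall>\<^sub>F l in at_right 0. u < h p powr (1 - l) * t powr l \<and> l < 1 \<and> 0 < l"
    by eventually_elim auto
  then obtain l where l: "u < h p powr (1 - l) * t powr l" "l < 1" "0 < l"
    using eventually_happens'[of "at_right (0::real)"] by auto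
  have "(\<lambda>x. (1 - l) *\<^sub>R p + l *\<^sub>R x) ` interior (level t) \<subseteq> level u"
  proof clarsimp
    fix x assume "x \<in> interior (level t)"
    then have "t \<le> h x" using interior_subset by auto
    then have "h p powr (1 - l) * t powr l \<le> h p powr (1 - l) * h x powr l"
      using t l by (intro mult_left_mono powr_mono2) auto
    also have "\<dots> \<le> h ((1 - l) *\<^sub>R p + l *\<^sub>R x)"
      using l by (intro log_concaveD(2)[OF log_concave]) auto
    finally show "u \<le> h ((1 - l) *\<^sub>R p + l *\<^sub>R x)" using l by simp
  qed
  moreover have "open ((\<lambda>x. (1 - l) *\<^sub>R p + l *\<^sub>R x) ` interior (level t))"
  proof -
    have "(\<lambda>x. (1 - l) *\<^sub>R p + l *\<^sub>R x) ` interior (level t) =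
        (+) ((1 - l) *\<^sub>R p) ` ((*\<^sub>R) l ` interior (level t))" by (auto simp: image_image)
    then show ?thesis using l by (auto intro!: open_translation open_scaling)
  qed
  ultimately show ?thesis using t by (metis image_is_empty interior_maximal subset_empty)
qed

lemma level_volume_le: "ennreal t * emeasure lborel (level t) \<le> (\<integral>\<^sup>+x. ennreal (h x) \<partial>lborel)"
proof -
  have "ennreal t * emeasure lborel (level t) = (\<integral>\<^sup>+x. ennreal t * indicator (level t) x \<partial>lborel)"
    by (simp add: nn_integral_cmult_indicator)
  also have "\<dots> \<le> (\<integral>\<^sup>+x. ennreal (h x) \<partial>lborel)"
    by (intro nn_integral_mono) (auto split: split_indicator intro: ennreal_leI)
  finally show ?thesis .
qed

lemma level_finite:
  assumes "0 < t"
  shows "emeasure lborel (level t) < top"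
  using le_less_trans[OF level_volume_le finite_integral, of t] assms
  by (auto simp: ennreal_mult_less_top)

lemma compact_level:
  assumes "0 < t"
  shows "compact (level t)"
proof -
  \<comment> \<open>Only heights below \<open>1\<close> are known to have levels with interior;
    boundedness is proved for such a level and inherited by the smaller one.\<close>
  define s where "s = min t (1 / 2)"
  have s: "0 < s" "s < 1" "s \<le> t" using assms by (auto simp: s_def)
  have "bounded (level s)"
    using interior_level[OF s(2)] level_finite[OF s(1)]
    by (intro bounded_of_finite_volume convex_level measurable_level) auto
  then have "bounded (level t)" by (rule bounded_subset) (use s in auto)
  with closed_level[OF assms] show ?thesis by (simp add: compact_eq_bounded_closed)
qed

lemma level_pos: "u < 1 \<Longrightarrow> 0 < emeasure lborel (level u)"
  using emeasure_lborel_open_pos[OF open_interior interior_level[of u]]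
    emeasure_mono[OF interior_subset[of "level u"], of lborel] by (simp add: less_le_trans)

lemma scaled_integral_UNIV_pos: "0 < scaled_integral UNIV h"
proof -
  have "0 < ennreal (1 / 2) * emeasure lborel (level (1 / 2))"
  proof -
    have "0 < emeasure lborel (level (1 / 2))" by (rule level_pos) simp
    moreover have "0 < ennreal (1 / 2)" by (simp only: ennreal_less_zero_iff)
    ultimately show ?thesis by (simp only: ennreal_zero_less_mult_iff simp_thms)
  qed
  also have "\<dots> \<le> (\<integral>\<^sup>+x. ennreal (h x) \<partial>lborel)" by (rule level_volume_le)
  finally show ?thesis
    by (simp add: scaled_integral_def coord_measure_UNIV ennreal_zero_less_mult_iff)
qed

lemma scaled_integral_UNIV_finite: "scaled_integral UNIV h < top"
  using finite_integral by (simp add: scaled_integral_def coord_measure_UNIV ennreal_mult_less_top)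

lemma scaled_vol_level:
  assumes "0 < u" "u < 1"
  shows "0 < scaled_vol UNIV (level u)" "scaled_vol UNIV (level u) < top"
  using level_pos[OF assms(2)] level_finite[OF assms(1)]
  by (auto simp: scaled_vol_UNIV ennreal_zero_less_mult_iff ennreal_mult_less_top)

end

subsection \<open>Rigidity\<close>

text \<open>Normalizes a nonzero point to the last point of \<open>K\<close> on its ray; the
  maximality bounds a coefficient in \<open>two_valued_transfer\<close>.\<close>

lemma ex_maximal_multiple:
  fixes K :: "'a::euclidean_space set"
  assumes K: "compact K" and y: "y \<in> K" "y \<noteq> 0"
  shows "\<exists>z\<in>K. z \<noteq> 0 \<and> z \<in> range (\<lambda>c. c *\<^sub>R y) \<and> (\<forall>c. c *\<^sub>R z \<in> K \<longrightarrow> c \<le> 1)"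
proof -
  let ?S = "(\<lambda>c. c *\<^sub>R y) -` K \<inter> {1..}"
  have "closed ?S"
    by (intro closed_Int continuous_closed_vimage compact_imp_closed K continuous_intros closed_atLeast)
  moreover have "bounded ?S"
  proof -
    obtain B where B: "\<And>x. x \<in> K \<Longrightarrow> norm x \<le> B" using compact_imp_bounded[OF K] by (auto simp: bounded_iff)
    have "\<bar>c\<bar> \<le> B / norm y" if "c \<in> ?S" for c
      using B[of "c *\<^sub>R y"] that y by (simp add: field_simps)
    then show ?thesis unfolding bounded_iff by auto
  qed
  ultimately have "compact ?S" by (simp add: compact_eq_bounded_closed)
  moreover have "1 \<in> ?S" using y by simp
  ultimately obtain m where m: "m \<in> ?S" "\<And>c. c \<in> ?S \<Longrightarrow> c \<le> m"
    by (metis compact_attains_sup empty_iff)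
  have m0: "m \<noteq> 0" using m(1) by auto
  show ?thesis
  proof (intro bexI[of _ "m *\<^sub>R y"] conjI allI impI)
    fix c assume c: "c *\<^sub>R m *\<^sub>R y \<in> K"
    show "c \<le> 1"
    proof (rule ccontr)
      assume "\<not> c \<le> 1"
      then have "m < c * m" using m(1) by (simp add: less_le_trans[of 0 1 m])
      moreover have "c * m \<in> ?S" using \<open>m < c * m\<close> c m(1) by (auto intro: order_trans)
      ultimately show False using m(2)[of "c * m"] by linarith
    qed
  qed (use m m0 y in auto)
qed

lemma coord_subspace_scale: "x \<in> coord_subspace A \<Longrightarrow> c *\<^sub>R x \<in> coord_subspace A"
  by (rule subspace_scale[OF subspace_coord_subspace])

lemma zero_mem_coord_subspace [simp]: "0 \<in> coord_subspace A"
  by (rule subspace_0[OF subspace_coord_subspace])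

lemma convex_Int_coord_subspace: "convex K \<Longrightarrow> convex (K \<inter> coord_subspace A)"
  by (intro convex_Int subspace_imp_convex[OF subspace_coord_subspace])

lemma compact_Int_coord_subspace: "compact K \<Longrightarrow> compact (K \<inter> coord_subspace A)"
  by (intro compact_Int_closed closed_coord_subspace)

lemma splits_of_subset_hull:
  assumes K: "convex K" "0 \<in> K"
    and hull: "K \<subseteq> convex hull ((K \<inter> coord_subspace A) \<union> (K \<inter> coord_subspace (- A)))"
  shows "splits A K"
  unfolding splits_def
proof
  fix z assume "z \<in> K"
  with hull have "z \<in> convex hull ((K \<inter> coord_subspace A) \<union> (K \<inter> coord_subspace (- A)))" by blast
  also have "\<dots> = {a *\<^sub>R x' + b *\<^sub>R y' |a b x' y'. 0 \<le> a \<and> 0 \<le> b \<and> a + b = 1 \<and>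
      x' \<in> K \<inter> coord_subspace A \<and> y' \<in> K \<inter> coord_subspace (- A)}"
    using K by (intro convex_hull_union_two convex_Int_coord_subspace) auto
  finally obtain a b x' y' where ab: "0 \<le> a" "0 \<le> b" "a + b = 1"
    and x': "x' \<in> K \<inter> coord_subspace A" and y': "y' \<in> K \<inter> coord_subspace (- A)"
    and z: "z = a *\<^sub>R x' + b *\<^sub>R y'" by blast
  have "a = 1 - b" using ab by simp
  with ab x' y' z show "\<exists>x\<in>K \<inter> coord_subspace A. \<exists>y\<in>K \<inter> coord_subspace (- A). \<exists>l\<in>{0..1}.
      z = (1 - l) *\<^sub>R x + l *\<^sub>R y" by (intro bexI[of _ x'] bexI[of _ y'] bexI[of _ b]) auto
qed

section \<open>Equality for a pair of complementary subspaces\<close>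

context unit_log_concave
begin

definition product_level :: "'n set \<Rightarrow> real \<Rightarrow> bool" where
  "product_level A u \<longleftrightarrow> scaled_vol UNIV (level u) = scaled_vol A (level u) * scaled_vol (- A) (level u)"

lemma zero_mem_level:
  assumes "0 < u" "u < 1" "product_level A u"
  shows "0 \<in> level u"
proof (rule zero_mem_of_scaled_vol_eq[where A=A and B="- A"])
  show "closed (level u)" using closed_level assms by auto
qed (use assms scaled_vol_level[of u] convex_level in \<open>auto simp: product_level_def\<close>)

text \<open>If \<open>h\<close> only takes the values \<open>0\<close> and \<open>1\<close> on one of the two
  subspaces, then all level sets have the same trace there. Moving from a point \<open>x\<close> of the other
  subspace towards the end \<open>y\<close> of that trace, log-concavity puts a point of the segment into a
  higher level set, and the hull structure of this level set transports the gain back to \<open>x\<close>.\<close>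

lemma two_valued_transfer:
  assumes good: "AE u in lborel. 0 < u \<and> u < 1 \<longrightarrow> product_level A u" and ne: "A \<noteq> UNIV"
    and two: "AE y in coord_measure (- A). h y = 0 \<or> h y = 1"
    and x: "x \<in> coord_subspace A" "0 < h x"
  shows "h x = 1"
proof (rule ccontr)
  assume "h x \<noteq> 1"
  then have hx: "h x < 1" using le_1[of x] by simp
  let ?B = "- A"
  have neB: "?B \<noteq> {}" using ne by blast
  \<comment> \<open>On \<open>?B\<close> the function is almost everywhere \<open>0\<close> or
    \<open>1\<close>, so heights in \<open>{0<..1}\<close> all see the same section up to a null
    set.\<close>
  have vol_const: "scaled_vol ?B (level u) = scaled_vol ?B (level 1)" if "0 < u" "u \<le> 1" for u
  proof -
    have "emeasure (coord_measure ?B) (level u) = emeasure (coord_measure ?B) (level 1)"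
    proof (rule emeasure_eq_AE)
      show "AE y in coord_measure ?B. y \<in> level u \<longleftrightarrow> y \<in> level 1"
        using two by eventually_elim (use that le_1 in auto)
    qed simp_all
    then show ?thesis by (simp add: scaled_vol_def)
  qed
  obtain u0 where u0: "0 < u0" "u0 < 1" "product_level A u0"
    using AE_lborel_ex_between[OF good, of 0 1] by auto
  have "0 < scaled_vol ?B (level 1)"
  proof -
    have "scaled_vol ?B (level u0) \<noteq> 0"
      using u0 scaled_vol_level(1)[of u0] by (auto simp: product_level_def)
    then show ?thesis using vol_const[of u0] u0 by (simp add: zero_less_iff_neq_zero)
  qed
  have "\<not> level 1 \<inter> coord_subspace ?B \<subseteq> {0}"
  proof
    assume "level 1 \<inter> coord_subspace ?B \<subseteq> {0}"
    then have "emeasure (coord_measure ?B) (level 1 \<inter> coord_subspace ?B) \<le> emeasure (coord_measure ?B) {0}"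
      by (intro emeasure_mono) auto
    then have "scaled_vol ?B (level 1 \<inter> coord_subspace ?B) = 0"
      using emeasure_coord_measure_zero[of ?B] neB by (simp add: scaled_vol_def)
    with \<open>0 < scaled_vol ?B (level 1)\<close> show False by (simp add: scaled_vol_coord_subspace)
  qed
  then obtain y0 where y0: "y0 \<in> level 1" "y0 \<in> coord_subspace ?B" "y0 \<noteq> 0" by auto
  obtain y where y: "y \<in> level 1" "y \<noteq> 0" "y \<in> range (\<lambda>c. c *\<^sub>R y0)"
    and ymax: "\<And>c. c *\<^sub>R y \<in> level 1 \<Longrightarrow> c \<le> 1"
    using ex_maximal_multiple[OF compact_level[of 1] y0(1,3)] by auto
  have yB: "y \<in> coord_subspace ?B" using y(3) y0(2) coord_subspace_scale by auto
  have hy: "h y = 1" using y(1) le_1[of y] by simp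
  obtain u where u: "h x < u" "u < 1" "product_level A u"
    using AE_lborel_ex_between[OF good hx] x(2) by auto
  have u0': "0 < u" using u x by simp
  have zero: "0 \<in> level u" by (rule zero_mem_level[OF u0' u(2,3)])
  have zero1: "0 \<in> level 1"
  proof (rule ccontr)
    assume "0 \<notin> level 1"
    then have "h 0 < 1" by simp
    from AE_lborel_ex_between[OF good, of "max 0 (h 0)" 1] this
    obtain v where "0 < v" "h 0 < v" "v < 1" "product_level A v" by auto
    then show False using zero_mem_level[of v A] by simp
  qed
  \<comment> \<open>As \<open>l\<close> tends to \<open>1\<close> the factor of \<open>x\<close>
    disappears and \<open>h y = 1\<close> remains, so points of the segment near \<open>y\<close>
    rise above height \<open>u\<close>.\<close>
  have "((\<lambda>l. h x powr (1 - l)) \<longlongrightarrow> h x powr (1 - 1)) (at_left 1)"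
    using x by (intro tendsto_intros) auto
  then have "\<forall>\<^sub>F l in at_left 1. u < h x powr (1 - l)"
    using x u by (intro order_tendstoD(1)) auto
  moreover have "\<forall>\<^sub>F l in at_left (1::real). 0 < l \<and> l < 1"
    by (rule eventually_at_left_real[of 0 1, simplified, THEN eventually_mono]) auto
  ultimately have "\<forall>\<^sub>F l in at_left 1. u < h x powr (1 - l) \<and> 0 < l \<and> l < 1"
    by eventually_elim auto
  then obtain l where l: "u < h x powr (1 - l)" "0 < l" "l < 1"
    using eventually_happens'[of "at_left (1::real)"] by auto
  let ?z = "(1 - l) *\<^sub>R x + l *\<^sub>R y"
  have "u \<le> h ?z"
    using log_concaveD(2)[OF log_concave, of l x y] l hy by simp
  \<comment> \<open>The section in \<open>?B\<close> is taken from \<open>level 1\<close> instead of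
    \<open>level u\<close>: the volume is the same, and only then does the maximality of
    \<open>y\<close> apply to \<open>y'\<close>.\<close>
  moreover have "level u \<subseteq> convex hull ((level u \<inter> coord_subspace A) \<union> (level 1 \<inter> coord_subspace ?B))"
  proof (rule subset_hull_of_scaled_vol[where A=A])
    show "compact (level u)" "convex (level u)" "interior (level u) \<noteq> {}"
      using compact_level[OF u0'] convex_level interior_level[OF u(2)] by auto
    show "compact (level u \<inter> coord_subspace A)" "compact (level 1 \<inter> coord_subspace ?B)"
      using compact_level[OF u0'] compact_level[of 1] by (auto intro: compact_Int_coord_subspace)
    show "convex (level u \<inter> coord_subspace A)" "convex (level 1 \<inter> coord_subspace ?B)"
      by (intro convex_Int_coord_subspace convex_level)+
    show "level u \<inter> coord_subspace A \<subseteq> level u" "level 1 \<inter> coord_subspace ?B \<subseteq> level u"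
      using u by auto
    show "scaled_vol UNIV (level u) \<le>
        scaled_vol A (level u \<inter> coord_subspace A) * scaled_vol ?B (level 1 \<inter> coord_subspace ?B)"
      using u(3) vol_const[of u] u0' u(2) by (simp add: scaled_vol_coord_subspace product_level_def)
  qed
  ultimately have "?z \<in> convex hull ((level u \<inter> coord_subspace A) \<union> (level 1 \<inter> coord_subspace ?B))"
    by blast
  also have "\<dots> = {a *\<^sub>R x' + b *\<^sub>R y' |a b x' y'. 0 \<le> a \<and> 0 \<le> b \<and> a + b = 1 \<and>
      x' \<in> level u \<inter> coord_subspace A \<and> y' \<in> level 1 \<inter> coord_subspace ?B}"
    using zero zero1 by (intro convex_hull_union_two convex_Int_coord_subspace convex_level) auto
  finally obtain a b x' y' where ab: "0 \<le> a" "0 \<le> b" "a + b = 1"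
    and x': "x' \<in> level u" "x' \<in> coord_subspace A" and y': "y' \<in> level 1" "y' \<in> coord_subspace ?B"
    and z: "?z = a *\<^sub>R x' + b *\<^sub>R y'" by auto
  have eqs: "(1 - l) *\<^sub>R x = a *\<^sub>R x'" "l *\<^sub>R y = b *\<^sub>R y'"
    using coord_subspace_disjoint_unique[OF _ _ _ _ _ z, of A ?B] x(1) x'(2) yB y'(2)
    by (auto intro: coord_subspace_scale)
  have b0: "b \<noteq> 0" using eqs(2) l y(2) by auto
  have "y' = (l / b) *\<^sub>R y"
    using arg_cong[OF eqs(2), of "\<lambda>v. (1 / b) *\<^sub>R v"] b0 by simp
  \<comment> \<open>Maximality gives \<open>l \<le> b\<close>, hence \<open>a \<le> 1 - l\<close>:
    the point \<open>x\<close> lies between \<open>0\<close> and \<open>x'\<close>, both in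
    \<open>level u\<close>, against \<open>h x < u\<close>.\<close>
  with ymax y'(1) have "l / b \<le> 1" by blast
  then have lb: "l \<le> b" using b0 ab by (simp add: field_simps)
  have "x = (a / (1 - l)) *\<^sub>R x'"
    using arg_cong[OF eqs(1), of "\<lambda>v. (1 / (1 - l)) *\<^sub>R v"] l by simp
  also have "\<dots> = (a / (1 - l)) *\<^sub>R x' + (1 - a / (1 - l)) *\<^sub>R 0" by simp
  also have "\<dots> \<in> level u"
  proof (rule convexD[OF convex_level x'(1) zero])
    have "a \<le> 1 - l" using lb ab by simp
    then show "0 \<le> a / (1 - l)" "0 \<le> 1 - a / (1 - l)" using ab l by simp_all
  qed simp
  finally show False using u by simp
qed

lemma rigidity:
  assumes A: "A \<noteq> {}" "A \<noteq> UNIV"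
    and eq: "scaled_integral UNIV h \<le> scaled_integral A h * scaled_integral (- A) h"
  shows "h x = indicator (level 1) x" "0 \<in> level 1" "splits A (level 1)"
proof -
  let ?B = "- A"
  have disj: "A \<inter> ?B = {}" by auto
  have le: "scaled_integral A h * scaled_integral ?B h \<le> scaled_integral UNIV h"
    using scaled_integral_mult_le[OF measurable_h nonneg le_1 qc disj] by simp
  then have fin: "scaled_integral A h * scaled_integral ?B h < top"
    using scaled_integral_UNIV_finite by simp
  have eq': "scaled_integral (A \<union> ?B) h \<le> scaled_integral A h * scaled_integral ?B h"
    using eq by simp
  note cons = scaled_integral_eq_consequences[OF measurable_h nonneg le_1 qc disj eq' fin]
  have good: "AE u in lborel. 0 < u \<and> u < 1 \<longrightarrow> product_level A u"
    using cons(2) by eventually_elim (auto simp: product_level_def)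
  then have good': "AE u in lborel. 0 < u \<and> u < 1 \<longrightarrow> product_level ?B u"
    by eventually_elim (auto simp: product_level_def mult.commute)
  interpret pair_sigma_finite "coord_measure A" "coord_measure ?B" by (rule pair_sigma_finite_coord)
  \<comment> \<open>If \<open>a * b = min a b\<close> and \<open>a \<le> b\<close>, then
    \<open>a = 0\<close> or \<open>b = 1\<close>.\<close>
  have "AE p in coord_pair A ?B. (h (fst p) = 0 \<or> h (fst p) = 1) \<or> (h (snd p) = 0 \<or> h (snd p) = 1)"
    using cons(1)
  proof eventually_elim
    case (elim p)
    then show ?case by (cases "h (fst p) \<le> h (snd p)") (auto simp: min_def)
  qed
  from AE_pair[OF this]
  have "AE x in coord_measure A. AE y in coord_measure ?B. (h x = 0 \<or> h x = 1) \<or> (h y = 0 \<or> h y = 1)"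
    by simp
  \<comment> \<open>The condition on \<open>y\<close> does not involve \<open>x\<close>: if it fails
    on a set of positive measure, almost every \<open>x\<close> must be two-valued.\<close>
  then have "(AE x in coord_measure A. h x = 0 \<or> h x = 1) \<or> (AE y in coord_measure ?B. h y = 0 \<or> h y = 1)"
    by (auto elim: eventually_mono)
  moreover have "AE x in coord_measure A. h x = 0 \<or> h x = 1"
    if two: "AE y in coord_measure ?B. h y = 0 \<or> h y = 1"
    using AE_coord_measure[of A]
  proof eventually_elim
    case (elim x)
    then show ?case using two_valued_transfer[OF good A(2) two elim] nonneg[of x] by force
  qed
  moreover have "AE y in coord_measure ?B. h y = 0 \<or> h y = 1"
    if two: "AE x in coord_measure A. h x = 0 \<or> h x = 1"
    using AE_coord_measure[of ?B]
  proof eventually_elim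
    case (elim x)
    have cc: "- ?B = A" by (rule double_complement)
    have two': "AE y in coord_measure (- ?B). h y = 0 \<or> h y = 1" unfolding cc by (rule two)
    have "?B \<noteq> UNIV" using A(1) by blast
    then have "h x = 1" if "0 < h x"
      by (rule two_valued_transfer[OF good' _ two' elim that])
    then show ?case using nonneg[of x] by (cases "h x = 0") auto
  qed
  ultimately have two: "AE x in coord_measure A. h x = 0 \<or> h x = 1" "AE y in coord_measure ?B. h y = 0 \<or> h y = 1"
    by auto
  have vol: "scaled_integral C h = scaled_vol C (level 1)" if "AE x in coord_measure C. h x = 0 \<or> h x = 1" for C
  proof -
    have "(\<integral>\<^sup>+x. ennreal (h x) \<partial>coord_measure C) = (\<integral>\<^sup>+x. indicator (level 1) x \<partial>coord_measure C)"
      by (rule nn_integral_cong_AE) (use that in eventually_elim, auto)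
    then show ?thesis by (simp add: scaled_integral_def scaled_vol_def)
  qed
  have vol_le: "scaled_vol UNIV (level 1) \<le> scaled_integral UNIV h"
    unfolding scaled_vol_UNIV scaled_integral_def coord_measure_UNIV
    using nn_integral_mono[of lborel "indicator (level 1)" "\<lambda>x. ennreal (h x)"] nonneg
    by (auto intro!: mult_left_mono split: split_indicator)
  have cone: "scaled_vol A (level 1) * scaled_vol ?B (level 1) \<le> scaled_vol (A \<union> ?B) (level 1)"
    by (rule scaled_vol_mult_le[OF _ _ _ disj]) (use convex_level[of 1] in \<open>auto simp: convex_alt\<close>)
  \<comment> \<open>A circle of inequalities: the integral is at most the product of section volumes
    of \<open>level 1\<close>, which is at most the volume of \<open>level 1\<close>, which is at
    most the integral.\<close>
  have all: "scaled_integral UNIV h = scaled_vol UNIV (level 1)"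
    "scaled_vol UNIV (level 1) = scaled_vol A (level 1) * scaled_vol ?B (level 1)"
    using eq vol[OF two(1)] vol[OF two(2)] vol_le cone by (auto intro: antisym)
  have pos: "0 < scaled_vol UNIV (level 1)" using all(1) scaled_integral_UNIV_pos by simp
  have int1: "interior (level 1) \<noteq> {}"
    using pos null_of_convex_empty_interior[OF convex_level measurable_level, of 1]
    by (auto simp: scaled_vol_UNIV)
  have fin1: "scaled_vol UNIV (level 1) < top" using all scaled_integral_UNIV_finite by simp
  show zero: "0 \<in> level 1"
    by (rule zero_mem_of_scaled_vol_eq[of _ A ?B]) (use all pos fin1 convex_level closed_level[of 1] in auto)
  have hull: "level 1 \<subseteq> convex hull ((level 1 \<inter> coord_subspace A) \<union> (level 1 \<inter> coord_subspace ?B))"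
  proof (rule subset_hull_of_scaled_vol[where A=A])
    show "compact (level 1)" "convex (level 1)"
      using compact_level[of 1] convex_level by auto
    show "compact (level 1 \<inter> coord_subspace A)" "compact (level 1 \<inter> coord_subspace ?B)"
      using compact_level[of 1] by (auto intro: compact_Int_coord_subspace)
    show "convex (level 1 \<inter> coord_subspace A)" "convex (level 1 \<inter> coord_subspace ?B)"
      by (intro convex_Int_coord_subspace convex_level)+
    show "scaled_vol UNIV (level 1) \<le>
        scaled_vol A (level 1 \<inter> coord_subspace A) * scaled_vol ?B (level 1 \<inter> coord_subspace ?B)"
      using all by (simp add: scaled_vol_coord_subspace)
  qed (use int1 in auto)
  show "splits A (level 1)"
    by (rule splits_of_subset_hull[OF convex_level zero hull])
  \<comment> \<open>Since \<open>level 1\<close> exhausts the integral, \<open>h\<close> is its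
    indicator almost everywhere. It becomes one everywhere because an open null set is empty and the
    support lies in the closure of its interior.\<close>
  have int_eq: "(\<integral>\<^sup>+x. ennreal (h x) \<partial>lborel) = (\<integral>\<^sup>+x. indicator (level 1) x \<partial>lborel)"
    using all(1) fact_less_top[of "CARD('n)"] 
    by (auto simp: scaled_integral_def scaled_vol_def coord_measure_UNIV ennreal_mult_cancel_left)
  have "AE x in lborel. indicator (level 1) x = ennreal (h x)"
  proof (rule nn_integral_eq_imp_AE_eq[OF _ _ _ int_eq])
    show "AE x in lborel. indicator (level 1) x \<le> ennreal (h x)"
      using nonneg by (auto split: split_indicator intro!: AE_I2)
    show "(\<integral>\<^sup>+x. indicator (level 1) x \<partial>lborel) < top" using int_eq finite_integral by simp
  qed auto
  then have "AE x in lborel. x \<notin> interior (supp h) - level 1"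
  proof eventually_elim
    case (elim x)
    then show ?case using interior_subset[of "supp h"] by (auto simp: supp_def split: split_indicator_asm)
  qed
  moreover have op: "open (interior (supp h) - level 1)" using closed_level[of 1] by auto
  ultimately have "emeasure lborel (interior (supp h) - level 1) = 0"
    by (subst (asm) AE_iff_measurable[OF _ refl]) (auto simp: set_diff_eq)
  then have "interior (supp h) - level 1 = {}"
    using emeasure_lborel_open_pos[OF op] by force
  then have "closure (interior (supp h)) \<subseteq> level 1"
    using closed_level[of 1] by (intro closure_minimal) auto
  then have "supp h \<subseteq> level 1"
    using convex_closure_interior[OF quasi_concave_convex_supp[OF qc] interior_supp] closure_subset by blast
  then show "h x = indicator (level 1) x"
    using le_1[of x] nonneg[of x] by (auto simp: supp_def indicator_def not_le intro!: antisym)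
qed

end

subsection \<open>Boundary regularization\<close>

locale solid_log_concave =
  fixes f :: "real ^ 'n \<Rightarrow> real"
  assumes f: "f \<in> integrable_log_concave" and int: "interior (supp f) \<noteq> {}"
begin

abbreviation supp_int :: "(real ^ 'n) set" where
  "supp_int \<equiv> interior (supp f)"

lemma log_concave_f: "log_concave f" and integrable_f: "integrable lebesgue f"
  using f by (auto simp: integrable_log_concave_def)

lemma nonneg_f: "0 \<le> f x"
  using log_concaveD(1)[OF log_concave_f] .

lemma convex_supp: "convex (supp f)"
  by (rule quasi_concave_convex_supp[OF log_concave_imp_quasi_concave[OF log_concave_f]])

lemma pos_f: "x \<in> supp_int \<Longrightarrow> 0 < f x"
  using interior_subset[of "supp f"] by (auto simp: supp_def)

text \<open>\<open>- ln f\<close> is finite and convex on an open convex set, hence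
  continuous.\<close>

lemma continuous_on_supp_int: "continuous_on supp_int f"
proof -
  have "convex_on supp_int (\<lambda>x. - ln (f x))"
  proof (rule convex_onI)
    fix t :: real and x y assume t: "0 < t" "t < 1" and xy: "x \<in> supp_int" "y \<in> supp_int"
    have "(1 - t) *\<^sub>R x + t *\<^sub>R y \<in> supp_int"
      using t xy by (intro convexD convex_interior convex_supp) auto
    have "ln (f x powr (1 - t) * f y powr t) \<le> ln (f ((1 - t) *\<^sub>R x + t *\<^sub>R y))"
      using t pos_f[OF xy(1)] pos_f[OF xy(2)] by (intro ln_mono log_concaveD(2)[OF log_concave_f]) auto
    moreover have "ln (f x powr (1 - t) * f y powr t) = (1 - t) * ln (f x) + t * ln (f y)"
      using pos_f[OF xy(1)] pos_f[OF xy(2)] by (simp add: ln_mult ln_powr)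
    ultimately show "- ln (f ((1 - t) *\<^sub>R x + t *\<^sub>R y)) \<le> (1 - t) * - ln (f x) + t * - ln (f y)"
      by simp
  qed (intro convex_interior convex_supp)
  then have "continuous_on supp_int (\<lambda>x. - ln (f x))" by (intro convex_on_continuous open_interior)
  then have "continuous_on supp_int (\<lambda>x. exp (- (- ln (f x))))"
    by (rule continuous_on_exp[OF continuous_on_minus])
  then show ?thesis by (rule continuous_on_eq) (simp add: pos_f)
qed

lemma open_superlevel: "open {y \<in> supp_int. s < f y}"
proof -
  have "open (supp_int \<inter> f -` {s<..})"
    by (rule continuous_open_preimage[OF continuous_on_supp_int]) auto
  moreover have "supp_int \<inter> f -` {s<..} = {y \<in> supp_int. s < f y}" by auto
  ultimately show ?thesis by simp
qed

lemma nn_integral_finite: "(\<integral>\<^sup>+x. ennreal (f x) \<partial>lebesgue) < top"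
  using integrable_f nonneg_f by (simp add: integrable_iff_bounded)

text \<open>If \<open>f > c\<close> on a ball about \<open>p\<close>, then
  \<open>f \<ge> sqrt (f x * c)\<close> on the ball of half the radius about the midpoint of
  \<open>x\<close> and \<open>p\<close>. The volume of that ball does not depend on
  \<open>x\<close>, so the integral bounds \<open>f x\<close>.\<close>

lemma bounded_above: "\<exists>M. \<forall>x. f x \<le> M"
proof -
  obtain p where p: "p \<in> supp_int" using int by blast
  define c where "c = f p / 2"
  have c: "0 < c" "c < f p" using pos_f[OF p] by (auto simp: c_def)
  then have "p \<in> {y \<in> supp_int. c < f y}" using p by simp
  then obtain r where r: "0 < r" "ball p r \<subseteq> {y \<in> supp_int. c < f y}"
    using open_superlevel[of c] by (meson openE)
  define b where "b = measure lborel (ball p (r / 2))"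
  have b: "0 < b" using r by (simp add: b_def content_ball_pos)
  define I where "I = enn2real (\<integral>\<^sup>+x. ennreal (f x) \<partial>lebesgue)"
  have I: "(\<integral>\<^sup>+x. ennreal (f x) \<partial>lebesgue) = ennreal I" "0 \<le> I"
    using nn_integral_finite by (auto simp: I_def)
  have "f x \<le> (I / b)\<^sup>2 / c" for x
  proof -
    let ?m = "(1 / 2) *\<^sub>R x + (1 / 2) *\<^sub>R p"
    have ge: "sqrt (f x * c) \<le> f y" if y: "y \<in> ball ?m (r / 2)" for y
    proof -
      \<comment> \<open>Chosen so that \<open>y\<close> is the midpoint of \<open>x\<close> and
        \<open>q\<close>.\<close>
      define q where "q = 2 *\<^sub>R y - x"
      have "dist p q = norm (2 *\<^sub>R (?m - y))"
        unfolding q_def dist_norm by (rule arg_cong[of _ _ norm]) (simp add: algebra_simps)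
      also have "\<dots> = 2 * dist ?m y" by (simp add: dist_norm)
      finally have "q \<in> ball p r" using y by simp
      then have "c < f q" using r by auto
      have "sqrt (f x * c) \<le> sqrt (f x * f q)"
        using \<open>c < f q\<close> nonneg_f[of x] by (intro real_sqrt_le_mono mult_left_mono) auto
      also have "\<dots> = f x powr (1 - 1 / 2) * f q powr (1 / 2)"
        using nonneg_f by (simp add: real_sqrt_mult powr_half_sqrt)
      also have "\<dots> \<le> f ((1 - 1 / 2) *\<^sub>R x + (1 / 2) *\<^sub>R q)"
        by (intro log_concaveD(2)[OF log_concave_f]) auto
      also have "(1 - 1 / 2) *\<^sub>R x + (1 / 2) *\<^sub>R q = y" by (simp add: q_def algebra_simps)
      finally show ?thesis .
    qed
    have "measure lborel (ball ?m (r / 2)) = b" using r by (simp add: b_def content_ball)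
    then have "emeasure lborel (ball ?m (r / 2)) = ennreal b"
      using emeasure_bounded_finite[of "ball ?m (r / 2)"] by (simp add: emeasure_eq_ennreal_measure less_top)
    then have "ennreal (sqrt (f x * c) * b) = (\<integral>\<^sup>+y. ennreal (sqrt (f x * c)) * indicator (ball ?m (r / 2)) y \<partial>lebesgue)"
      using b nonneg_f[of x] c by (simp add: nn_integral_cmult_indicator ennreal_mult)
    also have "\<dots> \<le> (\<integral>\<^sup>+y. ennreal (f y) \<partial>lebesgue)"
      using ge by (intro nn_integral_mono) (auto split: split_indicator intro: ennreal_leI)
    finally have "sqrt (f x * c) * b \<le> I" using I by simp
    then have "sqrt (f x * c) \<le> I / b" using b by (simp add: field_simps)
    then have "f x * c \<le> (I / b)\<^sup>2" using real_le_lsqrt sqrt_le_D by blast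
    then show ?thesis using c by (simp add: pos_le_divide_eq)
  qed
  then show ?thesis by blast
qed

text \<open>Replaces the upper limit by closures of open superlevel sets, from which closed levels
  and log-concavity follow. Only heights \<open>s < t\<close> occur, since the upper limit may be
  approached from below.\<close>

lemma le_boundary_reg_iff:
  assumes t: "0 < t"
  shows "t \<le> boundary_reg f x \<longleftrightarrow> (\<forall>s. 0 < s \<longrightarrow> s < t \<longrightarrow> x \<in> closure {y \<in> supp_int. s < f y})"
proof -
  let ?L = "Limsup (at x within supp_int) (\<lambda>y. ennreal (f y))"
  let ?S = "\<lambda>s. {y \<in> supp_int. s < f y}"
  obtain M where M: "\<And>x. f x \<le> M" using bounded_above by blast
  have "?L \<le> ennreal M" by (intro Limsup_bounded always_eventually allI ennreal_leI M)
  then have fin: "?L < top" using ennreal_less_top le_less_trans by blast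
  have freq: "(\<exists>\<^sub>F y in at x within supp_int. ennreal s < ennreal (f y)) \<longleftrightarrow> x \<in> closure (?S s)" if "0 \<le> s" for s
  proof -
    have "(y \<in> supp_int \<longrightarrow> \<not> ennreal s < ennreal (f y)) \<longleftrightarrow> y \<notin> ?S s" for y
      using that by (simp add: ennreal_less_iff)
    then have "(\<exists>\<^sub>F y in at x within supp_int. ennreal s < ennreal (f y)) \<longleftrightarrow> (\<exists>\<^sub>F y in at x. y \<in> ?S s)"
      unfolding frequently_def eventually_at_filter[of _ x supp_int] eventually_at_filter[of _ x UNIV]
      by (simp only: UNIV_I simp_thms)
    also have "\<dots> \<longleftrightarrow> x islimpt ?S s" by (simp add: islimpt_conv_frequently_at)
    \<comment> \<open>The filter excludes \<open>x\<close> itself; this loses nothing, as every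
      point of an open set is a limit point of it.\<close>
    also have "\<dots> \<longleftrightarrow> x \<in> closure (?S s)"
      unfolding closure_def using open_superlevel[of s] interior_limit_point[of x "?S s"]
      by (auto simp: interior_open)
    finally show ?thesis .
  qed
  have L: "ennreal t \<le> ?L \<longleftrightarrow> (\<forall>s. 0 < s \<longrightarrow> s < t \<longrightarrow> x \<in> closure (?S s))"
  proof
    assume *: "ennreal t \<le> ?L"
    show "\<forall>s. 0 < s \<longrightarrow> s < t \<longrightarrow> x \<in> closure (?S s)"
    proof (intro allI impI)
      fix s assume s: "0 < s" "s < t"
      then have "ennreal s < ennreal t" by (simp add: ennreal_less_iff)
      have "\<exists>\<^sub>F y in at x within supp_int. ennreal s < ennreal (f y)"
      proof (rule ccontr)
        assume "\<not> ?thesis"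
        then have "?L \<le> ennreal s" by (intro Limsup_bounded) (simp add: not_frequently not_less)
        with * \<open>ennreal s < ennreal t\<close> show False by (meson leD order_trans)
      qed
      then show "x \<in> closure (?S s)" using freq s by simp
    qed
  next
    assume *: "\<forall>s. 0 < s \<longrightarrow> s < t \<longrightarrow> x \<in> closure (?S s)"
    show "ennreal t \<le> ?L"
    proof (rule dense_le)
      fix c assume c: "c < ennreal t"
      then obtain s where s: "c = ennreal s" "0 \<le> s" by (cases c) (auto simp: top_unique)
      then have "s < t" using c by (simp add: ennreal_less_iff)
      define s' where "s' = (s + t) / 2"
      have s': "s < s'" "s' < t" "0 < s'" using s \<open>s < t\<close> by (auto simp: s'_def)
      then have freq': "\<exists>\<^sub>F y in at x within supp_int. ennreal s' < ennreal (f y)" using * freq by simp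
      have "ennreal s' \<le> ?L"
      proof (rule ccontr)
        assume "\<not> ?thesis"
        then have "\<forall>\<^sub>F y in at x within supp_int. ennreal (f y) < ennreal s'"
          by (intro Limsup_lessD) simp
        then have "\<forall>\<^sub>F y in at x within supp_int. \<not> ennreal s' < ennreal (f y)"
          by (rule eventually_mono) simp
        with freq' show False by (simp only: frequently_def not_True_eq_False simp_thms)
      qed
      moreover have "c \<le> ennreal s'" using s s' by (simp add: ennreal_leI)
      ultimately show "c \<le> ?L" by (rule order_trans[rotated])
    qed
  qed
  show ?thesis
  proof (cases "x \<in> closure (supp f)")
    case True
    then have "t \<le> boundary_reg f x \<longleftrightarrow> ennreal t \<le> ennreal (enn2real ?L)"
      by (simp only: boundary_reg_def if_True ennreal_le_iff enn2real_nonneg)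
    then have "t \<le> boundary_reg f x \<longleftrightarrow> ennreal t \<le> ?L" unfolding ennreal_enn2real[OF fin] .
    with L show ?thesis by simp
  next
    case False
    then have "\<not> t \<le> boundary_reg f x" using t by (simp add: boundary_reg_def)
    moreover have "closure (?S (t / 2)) \<subseteq> closure (supp f)"
      using interior_subset by (intro closure_mono) auto
    moreover from this have "x \<notin> closure (?S (t / 2))" using False by blast
    moreover have "0 < t / 2" "t / 2 < t" using t by auto
    ultimately show ?thesis by blast
  qed
qed

lemma boundary_reg_nonneg: "0 \<le> boundary_reg f x"
  by (simp add: boundary_reg_def)

lemma closed_boundary_reg_level:
  assumes "0 < t"
  shows "closed {x. t \<le> boundary_reg f x}"
proof -
  have "{x. t \<le> boundary_reg f x} = (\<Inter>s\<in>{0<..<t}. closure {y \<in> supp_int. s < f y})"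
    using le_boundary_reg_iff[OF assms] by auto
  then show ?thesis by auto
qed

lemma boundary_reg_le:
  assumes "\<And>x. f x \<le> M"
  shows "boundary_reg f x \<le> M"
proof (rule ccontr)
  assume *: "\<not> ?thesis"
  have "0 \<le> M" using nonneg_f[of x] assms[of x] by simp
  define s where "s = (M + boundary_reg f x) / 2"
  have s: "M < s" "0 < s" "s < boundary_reg f x" using * \<open>0 \<le> M\<close> by (auto simp: s_def)
  then have "x \<in> closure {y \<in> supp_int. s < f y}"
    using le_boundary_reg_iff[of "boundary_reg f x" x] by auto
  moreover have "{y \<in> supp_int. s < f y} = {}" using assms s by (auto simp: not_less intro: order_trans less_imp_le)
  ultimately show False by simp
qed

text \<open>Moving slightly from \<open>x\<close> towards an interior point \<open>p\<close> enters
  the interior of the support, and log-concavity keeps the value above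
  \<open>f x powr (1 - e) * f p powr e\<close>, which tends to \<open>f x\<close>.\<close>

lemma le_boundary_reg: "f x \<le> boundary_reg f x"
proof (cases "f x = 0")
  case True
  then show ?thesis using boundary_reg_nonneg by simp
next
  case False
  then have pos: "0 < f x" using nonneg_f[of x] by simp
  obtain p where p: "p \<in> supp_int" using int by blast
  show ?thesis
  proof (subst le_boundary_reg_iff[OF pos], intro allI impI)
    fix s assume s: "0 < s" "s < f x"
    let ?g = "\<lambda>e. (1 - e) *\<^sub>R x + e *\<^sub>R p"
    have "((\<lambda>e. f x powr (1 - e) * f p powr e) \<longlongrightarrow> f x powr (1 - 0) * f p powr 0) (at_right 0)"
      using pos pos_f[OF p] by (intro tendsto_intros) auto
    then have "\<forall>\<^sub>F e in at_right 0. s < f x powr (1 - e) * f p powr e"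
      using pos pos_f[OF p] s by (intro order_tendstoD(1)) auto
    moreover have "\<forall>\<^sub>F e in at_right (0::real). 0 < e \<and> e < 1"
      by (rule eventually_at_right_real[of 0 1, simplified, THEN eventually_mono]) auto
    ultimately have ev: "\<forall>\<^sub>F e in at_right 0. ?g e \<in> {y \<in> supp_int. s < f y}"
    proof eventually_elim
      case (elim e)
      have "x - e *\<^sub>R (x - p) \<in> supp_int"
        using elim p pos by (intro mem_interior_convex_shrink convex_supp) (auto simp: supp_def)
      moreover have "f x powr (1 - e) * f p powr e \<le> f (?g e)"
        using elim by (intro log_concaveD(2)[OF log_concave_f]) auto
      moreover have "x - e *\<^sub>R (x - p) = ?g e" by (simp add: algebra_simps)
      ultimately show ?case using elim by simp
    qed
    have "(?g \<longlongrightarrow> (1 - 0) *\<^sub>R x + 0 *\<^sub>R p) (at_right 0)" by (intro tendsto_intros)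
    then have lim: "(?g \<longlongrightarrow> x) (at_right 0)" by simp
    show "x \<in> closure {y \<in> supp_int. s < f y}"
    proof (rule Lim_in_closed_set[OF closed_closure _ _ lim])
      show "\<forall>\<^sub>F e in at_right 0. ?g e \<in> closure {y \<in> supp_int. s < f y}"
        using ev by eventually_elim (rule closure_subset[THEN subsetD])
    qed simp
  qed
qed

lemma boundary_reg_eq_on_supp_int:
  assumes x: "x \<in> supp_int"
  shows "boundary_reg f x = f x"
proof (rule antisym[OF _ le_boundary_reg], rule ccontr)
  assume *: "\<not> boundary_reg f x \<le> f x"
  define s where "s = (f x + boundary_reg f x) / 2"
  have s: "f x < s" "0 < s" "s < boundary_reg f x" using * nonneg_f[of x] by (auto simp: s_def)
  then have cl: "x \<in> closure {y \<in> supp_int. s < f y}"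
    using le_boundary_reg_iff[of "boundary_reg f x" x] by auto
  have "isCont f x" using continuous_on_supp_int x by (simp add: continuous_on_eq_continuous_at)
  then have "\<forall>\<^sub>F y in nhds x. f y < s"
    using s by (auto simp: isCont_def tendsto_at_iff_tendsto_nhds dest: order_tendstoD(2))
  then obtain T where T: "open T" "x \<in> T" "\<And>y. y \<in> T \<Longrightarrow> f y < s" by (auto simp: eventually_nhds)
  then have "T \<inter> {y \<in> supp_int. s < f y} = {}" by force
  then have "T \<inter> closure {y \<in> supp_int. s < f y} = {}" using T(1) by (simp add: open_Int_closure_eq_empty)
  with cl T show False by blast
qed

lemma boundary_reg_AE_eq: "AE x in lebesgue. boundary_reg f x = f x"
proof -
  have "negligible (frontier (supp f))" by (rule negligible_convex_frontier[OF convex_supp])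
  then have "frontier (supp f) \<in> null_sets lebesgue" by (simp add: negligible_iff_null_sets)
  then have "AE x in lebesgue. x \<notin> frontier (supp f)" by (rule AE_not_in)
  then show ?thesis
  proof eventually_elim
    case (elim x)
    then consider "x \<in> supp_int" | "x \<notin> closure (supp f)" by (auto simp: frontier_def)
    then show ?case
    proof cases
      case 2
      then have "x \<notin> supp f" using closure_subset by blast
      then show ?thesis using 2 nonneg_f[of x] by (auto simp: boundary_reg_def supp_def)
    qed (rule boundary_reg_eq_on_supp_int)
  qed
qed

lemma log_concave_boundary_reg: "log_concave (boundary_reg f)"
  unfolding log_concave_def
proof (intro conjI allI ballI)
  fix x y and l :: real assume l: "l \<in> {0..1}"
  let ?r = "boundary_reg f"
  show "?r x powr (1 - l) * ?r y powr l \<le> ?r ((1 - l) *\<^sub>R x + l *\<^sub>R y)"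
  proof (cases "?r x = 0 \<or> ?r y = 0")
    case True
    then show ?thesis using boundary_reg_nonneg by auto
  next
    case False
    then have pos: "0 < ?r x" "0 < ?r y" using boundary_reg_nonneg[of x] boundary_reg_nonneg[of y] by auto
    have tpos: "0 < ?r x powr (1 - l) * ?r y powr l" using pos by simp
    show ?thesis
    proof (subst le_boundary_reg_iff[OF tpos], intro allI impI)
      fix s assume s: "0 < s" "s < ?r x powr (1 - l) * ?r y powr l"
      \<comment> \<open>The factor \<open>q\<close> lowers both values just so far that their
        weighted geometric mean becomes \<open>s\<close>.\<close>
      define q where "q = s / (?r x powr (1 - l) * ?r y powr l)"
      have q: "0 < q" "q < 1" using s tpos by (auto simp: q_def)
      have "(?r x * q) powr (1 - l) * (?r y * q) powr l = (?r x powr (1 - l) * ?r y powr l) * (q powr (1 - l) * q powr l)"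
        using pos q by (simp add: powr_mult mult_ac)
      also have "q powr (1 - l) * q powr l = q" using q by (simp add: powr_add[symmetric])
      also have "(?r x powr (1 - l) * ?r y powr l) * q = s" unfolding q_def using tpos by (metis less_irrefl nonzero_mult_div_cancel_left times_divide_eq_right)
      finally have s_eq: "(?r x * q) powr (1 - l) * (?r y * q) powr l = s" .
      have "x \<in> closure {z \<in> supp_int. ?r x * q < f z}" "y \<in> closure {z \<in> supp_int. ?r y * q < f z}"
        using le_boundary_reg_iff[OF pos(1), of x] le_boundary_reg_iff[OF pos(2), of y] pos q by auto
      then obtain X Y where X: "\<And>n::nat. X n \<in> supp_int" "\<And>n. ?r x * q < f (X n)" "X \<longlonglongrightarrow> x"
        and Y: "\<And>n::nat. Y n \<in> supp_int" "\<And>n. ?r y * q < f (Y n)" "Y \<longlonglongrightarrow> y"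
        unfolding closure_sequential by (metis (mono_tags, lifting) mem_Collect_eq)
      let ?Z = "\<lambda>n. (1 - l) *\<^sub>R X n + l *\<^sub>R Y n"
      have "?Z n \<in> {z \<in> supp_int. s < f z}" for n
      proof -
        have XY: "0 < f (X n)" "0 < f (Y n)" using pos_f X(1) Y(1) by auto
        have "?Z n \<in> supp_int" using l X Y by (intro convexD convex_interior convex_supp) auto
        moreover have "s < f (X n) powr (1 - l) * f (Y n) powr l"
        \<comment> \<open>Strictness must come from a factor with positive exponent: from
          \<open>X\<close> if \<open>l = 0\<close>, otherwise from \<open>Y\<close>.\<close>
        proof (cases "l = 0")
          case True
          then show ?thesis using s_eq X(2)[of n] pos q XY by simp
        next
          case False
          have "(?r x * q) powr (1 - l) * (?r y * q) powr l < f (X n) powr (1 - l) * f (Y n) powr l"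
            using False l X(2)[of n] Y(2)[of n] pos q XY
            by (intro mult_le_less_imp_less powr_mono2 powr_less_mono2) auto
          then show ?thesis by (simp only: s_eq)
        qed
        moreover have "f (X n) powr (1 - l) * f (Y n) powr l \<le> f (?Z n)"
          using l by (intro log_concaveD(2)[OF log_concave_f]) auto
        ultimately show ?thesis by simp
      qed
      moreover have "?Z \<longlonglongrightarrow> (1 - l) *\<^sub>R x + l *\<^sub>R y" using X Y by (intro tendsto_intros)
      ultimately show "(1 - l) *\<^sub>R x + l *\<^sub>R y \<in> closure {z \<in> supp_int. s < f z}"
        unfolding closure_sequential by (intro exI[of _ ?Z] conjI allI)
    qed
  qed
qed (rule boundary_reg_nonneg)

end

subsection \<open>Splitting along the induced cover\<close>

lemma coord_subspace_mono: "A \<subseteq> B \<Longrightarrow> coord_subspace A \<subseteq> coord_subspace B"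
  unfolding mem_coord_subspace subset_iff by blast

lemma coord_subspace_UNIV [simp]: "coord_subspace UNIV = UNIV"
  by (auto simp: mem_coord_subspace)

lemma splits_UNIV: "0 \<in> K \<Longrightarrow> splits UNIV K"
  unfolding splits_def
proof
  fix z assume "0 \<in> K" "z \<in> K"
  then show "\<exists>x\<in>K \<inter> coord_subspace UNIV. \<exists>y\<in>K \<inter> coord_subspace (- UNIV). \<exists>l\<in>{0..1}. z = (1 - l) *\<^sub>R x + l *\<^sub>R y"
    by (intro bexI[of _ z] bexI[of _ 0] bexI[of _ "0::real"]) auto
qed

lemma splits_empty: "0 \<in> K \<Longrightarrow> splits {} K"
  unfolding splits_def
proof
  fix z assume "0 \<in> K" "z \<in> K"
  then show "\<exists>x\<in>K \<inter> coord_subspace {}. \<exists>y\<in>K \<inter> coord_subspace (- {}). \<exists>l\<in>{0..1}. z = (1 - l) *\<^sub>R x + l *\<^sub>R y"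
    by (intro bexI[of _ 0] bexI[of _ z] bexI[of _ "1::real"]) auto
qed

lemma scaled_vol_Union_le_prod:
  assumes K: "K \<in> sets borel" "convex K" "0 \<in> K"
    and "sorted_wrt (\<lambda>A B. A \<inter> B = {}) b" "b \<noteq> []" "\<And>A. A \<in> set b \<Longrightarrow> splits A K"
  shows "scaled_vol (\<Union>(set b)) K \<le> (\<Prod>A\<leftarrow>b. scaled_vol A K)"
  using assms(4-6)
proof (induction b)
  case (Cons A b)
  show ?case
  proof (cases "b = []")
    case False
    let ?T = "\<Union>(set b)"
    have "scaled_vol (A \<union> ?T) K \<le> scaled_vol A K * scaled_vol ?T K"
    proof (rule scaled_vol_le_mult[OF K])
      show "A \<inter> ?T = {}" using Cons.prems by auto
      fix z assume z: "z \<in> K" "z \<in> coord_subspace (A \<union> ?T)"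
      then obtain x y l where x: "x \<in> K" "x \<in> coord_subspace A" and y: "y \<in> K" "y \<in> coord_subspace (- A)"
        and l: "l \<in> {0..1}" and eq: "z = (1 - l) *\<^sub>R x + l *\<^sub>R y"
        using Cons.prems(3)[of A] by (auto simp: splits_def)
      show "\<exists>x\<in>K \<inter> coord_subspace A. \<exists>y\<in>K \<inter> coord_subspace ?T. \<exists>l\<in>{0..1}. z = (1 - l) *\<^sub>R x + l *\<^sub>R y"
      \<comment> \<open>For \<open>l = 0\<close> the point \<open>y\<close> may have coordinates
        outside \<open>?T\<close>, so \<open>0\<close> replaces it; otherwise \<open>z\<close> and
        \<open>x\<close> force those coordinates to vanish.\<close>
      proof (cases "l = 0")
        case True
        then show ?thesis using x eq K(3) by (intro bexI[of _ x] bexI[of _ 0] bexI[of _ 0]) auto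
      next
        case False
        have "y $ i = 0" if i: "i \<notin> ?T" for i
        proof (cases "i \<in> A")
          case True
          then show ?thesis using y(2) by (simp add: mem_coord_subspace)
        next
          case notA: False
          then have "z $ i = 0" "x $ i = 0" using z(2) x(2) i by (auto simp: mem_coord_subspace)
          with eq have "l * y $ i = 0" by simp
          with False show ?thesis by simp
        qed
        then have "y \<in> coord_subspace ?T" by (simp add: mem_coord_subspace)
        with x y l eq show ?thesis by (intro bexI[of _ x] bexI[of _ y] bexI[of _ l]) auto
      qed
    qed
    also have "\<dots> \<le> scaled_vol A K * (\<Prod>A\<leftarrow>b. scaled_vol A K)"
      using Cons False by (intro mult_left_mono) auto
    finally show ?thesis by simp
  qed simp
qed simp

lemma induced_coverE:
  assumes "X \<in> induced_cover S UNIV"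
  obtains e where "X = (\<Inter>j\<in>{..<length S}. if e j then - (S ! j) else S ! j)" "X \<noteq> {}"
  using assms by (auto simp: induced_cover_def Compl_eq_Diff_UNIV)

lemma induced_cover_subset:
  assumes "X \<in> induced_cover S UNIV" "A \<in> set S"
  shows "X \<subseteq> A \<or> X \<subseteq> - A"
proof -
  obtain j where j: "j < length S" "A = S ! j" using assms(2) by (auto simp: in_set_conv_nth)
  obtain e where X: "X = (\<Inter>j\<in>{..<length S}. if e j then - (S ! j) else S ! j)"
    using assms(1) by (rule induced_coverE)
  have "X \<subseteq> (if e j then - (S ! j) else S ! j)" unfolding X using j by blast
  then show ?thesis using j by (auto split: if_splits)
qed

text \<open>An atom of the Boolean algebra generated by \<open>S\<close>. The induced cover consists
  exactly of these cells, and indexing them by a point avoids the exponents.\<close>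

definition cell :: "'a set list \<Rightarrow> 'a \<Rightarrow> 'a set" where
  "cell S i = {k. \<forall>A\<in>set S. k \<in> A \<longleftrightarrow> i \<in> A}"

lemma mem_cell: "k \<in> cell S i \<longleftrightarrow> (\<forall>j<length S. k \<in> S ! j \<longleftrightarrow> i \<in> S ! j)"
  by (simp add: cell_def all_set_conv_all_nth)

lemma cell_mem_induced_cover: "cell S i \<in> induced_cover S UNIV"
proof -
  have "(k \<in> (if i \<notin> S ! j then UNIV - S ! j else S ! j)) \<longleftrightarrow> (k \<in> S ! j \<longleftrightarrow> i \<in> S ! j)" for j k
    by simp
  then have eq: "cell S i = (\<Inter>j\<in>{..<length S}. if i \<notin> S ! j then UNIV - S ! j else S ! j)"
    unfolding set_eq_iff mem_cell INT_iff by (simp only: lessThan_iff Ball_def simp_thms)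
  have "cell S i \<in> {\<Inter>j\<in>{..<length S}. if e j then UNIV - S ! j else S ! j | e :: nat \<Rightarrow> bool. True}"
    unfolding eq by (intro CollectI exI[of _ "\<lambda>j. i \<notin> S ! j"] conjI TrueI refl)
  moreover have "i \<in> cell S i" by (simp add: cell_def)
  ultimately show ?thesis unfolding induced_cover_def by blast
qed

lemma induced_cover_eq_cell:
  assumes "X \<in> induced_cover S UNIV" "i \<in> X"
  shows "X = cell S i"
proof -
  obtain e where X: "X = (\<Inter>j\<in>{..<length S}. if e j then - (S ! j) else S ! j)"
    using assms(1) by (rule induced_coverE)
  have mem: "k \<in> X \<longleftrightarrow> (\<forall>j<length S. k \<in> S ! j \<longleftrightarrow> \<not> e j)" for k
  proof -
    have "(k \<in> (if e j then - (S ! j) else S ! j)) \<longleftrightarrow> (k \<in> S ! j \<longleftrightarrow> \<not> e j)" for j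
      by simp
    then show ?thesis unfolding X INT_iff by (simp only: lessThan_iff Ball_def simp_thms)
  qed
  show ?thesis
    unfolding set_eq_iff mem mem_cell using assms(2)[unfolded mem] by blast
qed

lemma finite_induced_cover: "finite (induced_cover S (UNIV :: 'n::finite set))"
  by (rule finite_subset[OF subset_UNIV]) simp

lemma induced_cover_nonempty: "induced_cover S UNIV \<noteq> {}"
  using cell_mem_induced_cover[of S] by auto

text \<open>If every member were \<open>{}\<close> or \<open>UNIV\<close>, all indices would have
  the same membership pattern. Rigidity needs a genuine pair \<open>A\<close>, \<open>- A\<close>,
  which a second cell provides.\<close>

lemma ex_nontrivial_member:
  assumes "2 \<le> card (induced_cover S (UNIV :: 'n::finite set))"
  shows "\<exists>A\<in>set S. A \<noteq> {} \<and> A \<noteq> UNIV"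
proof (rule ccontr)
  assume "\<not> ?thesis"
  then have "cell S i = UNIV" for i by (auto simp: cell_def)
  then have "induced_cover S UNIV \<subseteq> {UNIV}"
  proof (intro subsetI)
    fix X assume X: "X \<in> induced_cover S (UNIV :: 'n set)"
    then obtain i where "i \<in> X" by (auto simp: induced_cover_def)
    with induced_cover_eq_cell[OF X] \<open>\<And>i. cell S i = UNIV\<close> show "X \<in> {UNIV}" by simp
  qed
  then have "card (induced_cover S (UNIV :: 'n set)) \<le> card {UNIV :: 'n set}" by (intro card_mono) auto
  with assms show False by simp
qed

lemma extreme_point_splits:
  assumes "e extreme_point_of K" "splits A K"
  shows "e \<in> coord_subspace A \<or> e \<in> coord_subspace (- A)"
proof -
  obtain x y l where x: "x \<in> K" "x \<in> coord_subspace A" and y: "y \<in> K" "y \<in> coord_subspace (- A)"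
    and l: "0 \<le> l" "l \<le> 1" and e: "e = (1 - l) *\<^sub>R x + l *\<^sub>R y"
  proof -
    have "e \<in> K" using assms(1) by (simp add: extreme_point_of_def)
    with assms(2) obtain x y l where "x \<in> K \<inter> coord_subspace A" "y \<in> K \<inter> coord_subspace (- A)"
      "l \<in> {0..1}" "e = (1 - l) *\<^sub>R x + l *\<^sub>R y" unfolding splits_def by blast
    then show thesis by (intro that[of x y l]) auto
  qed
  have "e \<notin> open_segment x y" using assms x y by (auto simp: extreme_point_of_def)
  moreover have "e \<in> open_segment x y" if "x \<noteq> y" "l \<noteq> 0" "l \<noteq> 1"
    unfolding in_segment using that l e by (intro conjI exI[of _ l]) auto
  ultimately have "x = y \<or> l = 0 \<or> l = 1" by blast
  then show ?thesis using e x y by (auto simp: algebra_simps)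
qed

text \<open>Each \<open>A\<close> in \<open>S\<close> contains all or none of the indices of nonzero
  coordinates of \<open>e\<close>, so these indices share one membership pattern.\<close>

lemma extreme_point_in_cell:
  assumes e: "e extreme_point_of K" and split: "\<And>A. A \<in> set S \<Longrightarrow> splits A K"
  shows "\<exists>X\<in>induced_cover S UNIV. e \<in> coord_subspace X"
proof (cases "e = 0")
  case True
  then show ?thesis using cell_mem_induced_cover by force
next
  case False
  then obtain i where i: "e $ i \<noteq> 0" by (auto simp: vec_eq_iff)
  have "e $ k = 0" if k: "k \<notin> cell S i" for k
  proof -
    obtain A where A: "A \<in> set S" "(k \<in> A) \<noteq> (i \<in> A)" using k by (auto simp: cell_def)
    with extreme_point_splits[OF e split[OF A(1)]] i show ?thesis by (auto simp: mem_coord_subspace)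
  qed
  then show ?thesis using cell_mem_induced_cover[of S i] by (auto simp: mem_coord_subspace)
qed

lemma hull_of_cells:
  assumes K: "compact K" "convex K" and split: "\<And>A. A \<in> set S \<Longrightarrow> splits A K"
  shows "convex hull (\<Union>X\<in>induced_cover S UNIV. K \<inter> coord_subspace X) = K"
proof
  show "convex hull (\<Union>X\<in>induced_cover S UNIV. K \<inter> coord_subspace X) \<subseteq> K"
    using K by (intro hull_minimal) auto
  have "{e. e extreme_point_of K} \<subseteq> (\<Union>X\<in>induced_cover S UNIV. K \<inter> coord_subspace X)"
    using extreme_point_in_cell[OF _ split] by (auto simp: extreme_point_of_def)
  then show "K \<subseteq> convex hull (\<Union>X\<in>induced_cover S UNIV. K \<inter> coord_subspace X)"
    by (subst Krein_Milman_Minkowski[OF K]) (rule hull_mono)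
qed

section \<open>Coordinate projections and the bodies in the cells\<close>

definition coord_proj :: "'n set \<Rightarrow> real ^ 'n \<Rightarrow> real ^ 'n" where
  "coord_proj A x = (\<chi> i. if i \<in> A then x $ i else 0)"

lemma linear_coord_proj: "linear (coord_proj A)"
  by (auto intro!: linearI simp: coord_proj_def vec_eq_iff)

lemma coord_proj_mem: "coord_proj A x \<in> coord_subspace A"
  by (simp add: coord_proj_def mem_coord_subspace)

lemma coord_proj_id: "x \<in> coord_subspace A \<Longrightarrow> coord_proj A x = x"
  by (auto simp: coord_proj_def mem_coord_subspace vec_eq_iff)

lemma coord_proj_zero: "A \<inter> B = {} \<Longrightarrow> x \<in> coord_subspace B \<Longrightarrow> coord_proj A x = 0"
  by (auto simp: coord_proj_def mem_coord_subspace vec_eq_iff)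

text \<open>The projection onto \<open>X\<close> fixes the section in \<open>X\<close> and sends the
  sections in all other cells to \<open>0\<close>, so it maps their hull \<open>K\<close> into
  \<open>K\<close>. The image of a ball in \<open>K\<close> then yields a relative interior
  point.\<close>

lemma convex_body_in_section:
  fixes K :: "(real ^ 'n) set"
  assumes K: "compact K" "convex K" "0 \<in> K" "interior K \<noteq> {}"
    and split: "\<And>A. A \<in> set S \<Longrightarrow> splits A K" and X: "X \<in> induced_cover S UNIV"
  shows "convex_body_in X (K \<inter> coord_subspace X)"
proof -
  let ?U = "\<Union>Y\<in>induced_cover S UNIV. K \<inter> coord_subspace Y"
  have "coord_proj X ` ?U \<subseteq> K"
  proof clarsimp
    fix Y x assume Y: "Y \<in> induced_cover S UNIV" and x: "x \<in> K" "x \<in> coord_subspace Y"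
    show "coord_proj X x \<in> K"
    proof (cases "X \<inter> Y = {}")
      case False
      then have "X = Y" using induced_cover_eq_cell[OF X] induced_cover_eq_cell[OF Y] by blast
      then show ?thesis using x by (simp add: coord_proj_id)
    qed (use x K(3) in \<open>simp add: coord_proj_zero[of X Y]\<close>)
  qed
  then have "convex hull (coord_proj X ` ?U) \<subseteq> K" using K(2) by (rule hull_minimal)
  then have "coord_proj X ` (convex hull ?U) \<subseteq> K"
    by (simp only: convex_hull_linear_image[OF linear_coord_proj])
  moreover have "convex hull ?U = K" by (rule hull_of_cells[OF K(1,2) split])
  ultimately have proj: "coord_proj X ` K \<subseteq> K" by (simp only:)
  obtain p r where r: "0 < r" "ball p r \<subseteq> K" using K(4) by (meson ex_in_conv mem_interior)
  have "coord_subspace X \<inter> ball (coord_proj X p) r \<subseteq> K"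
  proof
    fix w assume w: "w \<in> coord_subspace X \<inter> ball (coord_proj X p) r"
    have "p + (w - coord_proj X p) \<in> ball p r"
      using w by (simp add: dist_norm norm_minus_commute)
    then have "coord_proj X (p + (w - coord_proj X p)) \<in> K" using r(2) proj by blast
    moreover have "coord_proj X (p + (w - coord_proj X p)) = w"
      using w coord_proj_id[of w X] coord_proj_id[OF coord_proj_mem, of X p]
      by (simp add: linear_add[OF linear_coord_proj] linear_diff[OF linear_coord_proj])
    ultimately show "w \<in> K" by simp
  qed
  then have "coord_proj X p \<in> (top_of_set (coord_subspace X)) interior_of (K \<inter> coord_subspace X)"
    unfolding interior_of_def using r(1) coord_proj_mem[of X p]
    by (intro CollectI exI[of _ "coord_subspace X \<inter> ball (coord_proj X p) r"])
       (auto intro: openin_open_Int)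
  then show ?thesis
    using K by (auto simp: convex_body_in_def intro: convex_Int_coord_subspace compact_Int_coord_subspace)
qed

text \<open>Each cell lies in \<open>A\<close> or in \<open>- A\<close>, so every generator of the
  hull already lies in one of the two sections.\<close>

lemma splits_hull_of_bodies:
  fixes K :: "'n::finite set \<Rightarrow> (real ^ 'n) set"
  assumes body: "\<And>X. X \<in> induced_cover S UNIV \<Longrightarrow> convex_body_in X (K X) \<and> 0 \<in> K X"
    and A: "A \<in> set S"
  shows "splits A (convex hull (\<Union>X\<in>induced_cover S UNIV. K X))"
proof (rule splits_of_subset_hull)
  let ?C = "convex hull (\<Union>X\<in>induced_cover S UNIV. K X)"
  obtain X where "X \<in> induced_cover S UNIV" using induced_cover_nonempty by blast
  with body show "0 \<in> ?C" by (intro hull_inc) auto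
  have "K X \<subseteq> (?C \<inter> coord_subspace A) \<union> (?C \<inter> coord_subspace (- A))" if X: "X \<in> induced_cover S UNIV" for X
  proof -
    have "K X \<subseteq> ?C" using X by (intro order_trans[OF _ hull_subset]) auto
    moreover have "K X \<subseteq> coord_subspace X" using body[OF X] by (simp add: convex_body_in_def)
    ultimately show ?thesis
      using induced_cover_subset[OF X A] coord_subspace_mono[of X A] coord_subspace_mono[of X "- A"] by blast
  qed
  then show "?C \<subseteq> convex hull ((?C \<inter> coord_subspace A) \<union> (?C \<inter> coord_subspace (- A)))"
    by (intro hull_mono) auto
qed (rule convex_convex_hull)

lemma compact_hull_of_bodies:
  fixes K :: "'n::finite set \<Rightarrow> (real ^ 'n) set"
  assumes "\<And>X. X \<in> induced_cover S UNIV \<Longrightarrow> convex_body_in X (K X)"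
  shows "compact (convex hull (\<Union>X\<in>induced_cover S UNIV. K X))"
  using assms by (intro compact_convex_hull compact_UN finite_induced_cover) (auto simp: convex_body_in_def)

subsection \<open>Blocks of a reducible cover\<close>

lemma prod_list_le_power:
  fixes xs :: "ennreal list"
  assumes "\<And>x. x \<in> set xs \<Longrightarrow> x \<le> a"
  shows "prod_list xs \<le> a ^ length xs"
  using assms by (induction xs) (auto intro!: mult_mono)

lemma prod_list_eq_power:
  fixes xs :: "ennreal list"
  assumes "\<And>x. x \<in> set xs \<Longrightarrow> x \<le> a" "prod_list xs = a ^ length xs" "0 < a" "a < top" "x \<in> set xs"
  shows "x = a"
  using assms(1,2,5)
proof (induction xs)
  case (Cons y ys)
  have le: "prod_list ys \<le> a ^ length ys" using Cons.prems(1) by (intro prod_list_le_power) auto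
  have pow: "0 < a ^ length ys" "a ^ length ys < top"
    using assms(3,4) by (auto simp: zero_less_iff_neq_zero power_less_top_ennreal)
  have y: "y = a"
  proof (rule ccontr)
    assume "y \<noteq> a"
    then have "y < a" using Cons.prems(1)[of y] by simp
    have "y * prod_list ys \<le> y * a ^ length ys" using le by (rule mult_left_mono) simp
    also have "\<dots> < a * a ^ length ys" using \<open>y < a\<close> pow by (rule ennreal_mult_strict_right_mono)
    finally show False using Cons.prems(2) by simp
  qed
  then have "prod_list ys = a ^ length ys"
    using Cons.prems(2) assms(3,4) by (auto simp: ennreal_mult_cancel_left)
  with Cons y show ?case by auto
qed simp

lemma prod_nth_eq_prod_list: "(\<Prod>j<length S. F (S ! j)) = (\<Prod>A\<leftarrow>S. F A)"
  for F :: "'a \<Rightarrow> 'b::comm_monoid_mult"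
  by (induction S rule: rev_induct) (simp_all add: nth_append lessThan_Suc mult.commute)

lemma prod_list_mset_cong:
  fixes F :: "'a \<Rightarrow> 'b::comm_monoid_mult"
  assumes "mset xs = mset ys"
  shows "(\<Prod>A\<leftarrow>xs. F A) = (\<Prod>A\<leftarrow>ys. F A)"
  using assms by (metis mset_map prod_mset_prod_list)

lemma prod_list_concat: "(\<Prod>A\<leftarrow>concat B. F A) = (\<Prod>b\<leftarrow>B. \<Prod>A\<leftarrow>b. F A)"
  for F :: "'a \<Rightarrow> 'b::comm_monoid_mult"
  by (induction B) simp_all

lemma length_le_length_concat: "(\<And>b. b \<in> set B \<Longrightarrow> b \<noteq> []) \<Longrightarrow> length B \<le> length (concat B)"
proof (induction B)
  case (Cons b B)
  then have "length B \<le> length (concat B)" "0 < length b" by auto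
  then show ?case unfolding concat.simps length_append list.size by linarith
qed simp

definition one_cover :: "'a set list \<Rightarrow> bool" where
  "one_cover b \<longleftrightarrow> sorted_wrt (\<lambda>A C. A \<inter> C = {}) b \<and> \<Union>(set b) = UNIV \<and> b \<noteq> []"

lemma one_reducible_blocks:
  fixes S :: "'a set list" and F :: "'a set \<Rightarrow> ennreal"
  assumes "one_reducible s S UNIV"
  shows "\<exists>B. length B = s \<and> set S = (\<Union>b\<in>set B. set b) \<and> s \<le> length S \<and> (\<forall>b\<in>set B. one_cover b) \<and>
    (\<Prod>j<length S. F (S ! j)) = (\<Prod>b\<leftarrow>B. \<Prod>A\<leftarrow>b. F A)"
proof -
  obtain B where B: "length B = s" "mset (concat B) = mset S" "\<And>b. b \<in> set B \<Longrightarrow> is_cover 1 b UNIV"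
    using assms unfolding one_reducible_def by blast
  have "set S = (\<Union>b\<in>set B. set b)" using mset_eq_setD[OF B(2)] by simp
  moreover have "s \<le> length S"
    using length_le_length_concat[OF is_cover_1(3)[OF B(3)], of B] mset_eq_length[OF B(2)] B(1) by simp
  moreover have "one_cover b" if "b \<in> set B" for b
    unfolding one_cover_def using is_cover_1[OF B(3)[OF that]] by blast
  moreover have "(\<Prod>j<length S. F (S ! j)) = (\<Prod>b\<leftarrow>B. \<Prod>A\<leftarrow>b. F A)"
    unfolding prod_nth_eq_prod_list prod_list_mset_cong[OF B(2)[symmetric]] prod_list_concat ..
  ultimately show ?thesis using B(1) by blast
qed

lemma nn_integral_coord_lebesgue: "(\<integral>\<^sup>+x. h x \<partial>coord_lebesgue A) = (\<integral>\<^sup>+x. h x \<partial>coord_measure A)"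
  by (simp add: coord_lebesgue_eq nn_integral_completion)

text \<open>The support lies in a hyperplane \<open>?H\<close>. Applied to its indicator, the block
  inequality bounds a product of scaled section volumes by \<open>n!\<close> times the volume of
  \<open>?H\<close>, which is \<open>0\<close>; so \<open>?H\<close> is null for some
  \<open>A\<close> of the block, and that factor of \<open>rhs\<close> vanishes.\<close>

lemma rhs_eq_0:
  fixes f :: "real ^ 'n \<Rightarrow> real"
  assumes f: "f \<in> integrable_log_concave" and flat: "interior (supp f) = {}"
    and s: "0 < s" "one_reducible s S UNIV"
  shows "rhs s S f = 0"
proof -
  have qc: "quasi_concave f"
    using f log_concave_imp_quasi_concave by (auto simp: integrable_log_concave_def)
  have pos: "0 \<le> f x" for x
    using f log_concaveD(1) by (auto simp: integrable_log_concave_def)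
  have "convex (supp f)" by (rule quasi_concave_convex_supp[OF qc])
  with flat obtain a d where ab: "a \<noteq> 0" "supp f \<subseteq> {x. a \<bullet> x = d}"
    using empty_interior_subset_hyperplane by blast
  let ?H = "{x. a \<bullet> x = d}"
  have [measurable]: "?H \<in> sets borel" by (simp add: closed_hyperplane borel_closed)
  let ?h = "\<lambda>x. indicator ?H x :: real"
  have qch: "quasi_concave ?h"
    unfolding quasi_concave_def
  proof (intro allI impI)
    fix x y and l :: real assume "0 < l" "l < 1"
    have "a \<bullet> ((1 - l) *\<^sub>R x + l *\<^sub>R y) = d" if "a \<bullet> x = d" "a \<bullet> y = d"
      using that by (simp add: inner_add_right left_diff_distrib)
    then show "min (?h x) (?h y) \<le> ?h ((1 - l) *\<^sub>R x + l *\<^sub>R y)"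
      by (cases "a \<bullet> x = d \<and> a \<bullet> y = d") (auto simp: indicator_def)
  qed
  obtain B where B: "length B = s" "set S = (\<Union>b\<in>set B. set b)"
    and cov: "\<And>b. b \<in> set B \<Longrightarrow> one_cover b"
    using one_reducible_blocks[OF s(2), where F="\<lambda>_. 1"] by blast
  obtain b where b: "b \<in> set B" using B(1) s(1) by (metis length_0_conv list.set_intros(1) neq_Nil_conv not_less_zero)
  have "(\<Prod>A\<leftarrow>b. scaled_integral A ?h) \<le> scaled_integral (\<Union>(set b)) ?h"
    using cov[OF b] unfolding one_cover_def by (intro scaled_integral_prod_le qch) (auto simp: indicator_def)
  also have "\<dots> = 0"
  proof -
    have "emeasure lborel ?H = 0"
      using ab by (intro null_of_convex_empty_interior convex_hyperplane interior_hyperplane) auto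
    then show ?thesis using cov[OF b] by (simp add: one_cover_def scaled_integral_def coord_measure_UNIV ennreal_indicator)
  qed
  finally have "0 \<in> (\<lambda>A. scaled_integral A ?h) ` set b" by (simp add: prod_list_zero_iff)
  then obtain A where A0: "0 = scaled_integral A ?h" and "A \<in> set b" by (rule imageE)
  with b B(2) have A: "A \<in> set S" by blast
  then have null: "emeasure (coord_measure A) ?H = 0"
    using A0 by (simp add: scaled_integral_def ennreal_indicator)
  \<comment> \<open>\<open>f\<close> may be unbounded here, so it is compared with
    \<open>top\<close> on the hyperplane, which a null set absorbs.\<close>
  have "(\<integral>\<^sup>+x. ennreal (f x) \<partial>coord_lebesgue A) \<le> (\<integral>\<^sup>+x. top * indicator ?H x \<partial>coord_measure A)"
    unfolding nn_integral_coord_lebesgue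
  proof (rule nn_integral_mono)
    fix x show "ennreal (f x) \<le> top * indicator ?H x"
    proof (cases "x \<in> ?H")
      case False
      then have "\<not> 0 < f x" using ab(2) unfolding supp_def by blast
      then show ?thesis using pos[of x] by simp
    qed simp
  qed
  also have "\<dots> = 0" using null by (simp add: nn_integral_cmult_indicator)
  finally have "(\<integral>\<^sup>+x. ennreal (f x) \<partial>coord_lebesgue A) = 0" by simp
  moreover obtain j where j: "j < length S" "S ! j = A" using A unfolding in_set_conv_nth by blast
  ultimately have "(\<Prod>j<length S. \<integral>\<^sup>+x. ennreal (f x) \<partial>coord_lebesgue (S ! j)) = 0"
    by (intro prod_zero bexI[of _ j]) (simp_all only: j finite_lessThan lessThan_iff)
  then show ?thesis unfolding rhs_def by (simp only: mult_zero_right)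
qed

lemma log_concave_divide:
  assumes g: "log_concave g" and c: "0 < c"
  shows "log_concave (\<lambda>x. g x / c)"
  unfolding log_concave_def
proof (intro conjI allI ballI)
  fix x show "0 \<le> g x / c" using log_concaveD(1)[OF g] c by simp
next
  fix x y and l :: real assume l: "l \<in> {0..1}"
  have "(g x / c) powr (1 - l) * (g y / c) powr l = (g x powr (1 - l) * g y powr l) / (c powr (1 - l) * c powr l)"
    using log_concaveD(1)[OF g] c by (simp add: powr_divide)
  also have "c powr (1 - l) * c powr l = c" using c by (simp add: powr_add[symmetric])
  also have "(g x powr (1 - l) * g y powr l) / c \<le> g ((1 - l) *\<^sub>R x + l *\<^sub>R y) / c"
    using l c by (intro divide_right_mono log_concaveD(2)[OF g]) auto
  finally show "(g x / c) powr (1 - l) * (g y / c) powr l \<le> g ((1 - l) *\<^sub>R x + l *\<^sub>R y) / c" .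
qed

section \<open>Inequality and equality on a single block\<close>

context unit_log_concave
begin

lemma scaled_integral_block_le:
  assumes "one_cover b"
  shows "(\<Prod>A\<leftarrow>b. scaled_integral A h) \<le> scaled_integral UNIV h"
  using scaled_integral_prod_le[OF measurable_h nonneg le_1 qc, of b] assms by (simp add: one_cover_def)

text \<open>The member \<open>A\<close> is set against the union of all others, which is
  \<open>- A\<close>. The product over the others is at most \<open>scaled_integral (- A) h\<close>,
  so equality on the block passes to the pair.\<close>

lemma rigidity_of_block:
  assumes b: "one_cover b"
    and eq: "(\<Prod>A\<leftarrow>b. scaled_integral A h) = scaled_integral UNIV h"
    and A: "A \<in> set b" "A \<noteq> {}" "A \<noteq> UNIV"
  shows "h x = indicator (level 1) x" "0 \<in> level 1" "splits A (level 1)"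
proof -
  obtain us ws where bs: "b = us @ A # ws" using split_list[OF A(1)] by blast
  have sb: "sorted_wrt (\<lambda>A C. A \<inter> C = {}) (us @ A # ws)" and ub: "\<Union>(set (us @ A # ws)) = UNIV"
    using b unfolding bs one_cover_def by blast+
  have sorted: "sorted_wrt (\<lambda>A C. A \<inter> C = {}) (us @ ws)"
    using sb unfolding sorted_wrt_append by simp
  have disj: "A \<inter> C = {}" if "C \<in> set (us @ ws)" for C
    using sb that unfolding sorted_wrt_append by (auto simp: Int_commute)
  have "\<Union>(set (us @ A # ws)) = A \<union> \<Union>(set (us @ ws))" by auto
  with ub have "A \<union> \<Union>(set (us @ ws)) = UNIV" by (simp only:)
  moreover have "A \<inter> \<Union>(set (us @ ws)) = {}"
    unfolding Int_Union by (simp only: disj UN_constant cong: SUP_cong) simp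
  ultimately have union: "\<Union>(set (us @ ws)) = - A"
    by (intro compl_unique[symmetric])
  have ne: "us @ ws \<noteq> []"
  proof
    assume "us @ ws = []"
    then have "- A = {}" unfolding union[symmetric] by simp
    then show False using A(3) by blast
  qed
  have "scaled_integral UNIV h = scaled_integral A h * (\<Prod>A\<leftarrow>us @ ws. scaled_integral A h)"
    unfolding eq[symmetric] bs by (simp add: mult_ac)
  also have "\<dots> \<le> scaled_integral A h * scaled_integral (- A) h"
    using scaled_integral_prod_le[OF measurable_h nonneg le_1 qc sorted ne]
    unfolding union by (rule mult_left_mono) simp
  finally have le: "scaled_integral UNIV h \<le> scaled_integral A h * scaled_integral (- A) h" .
  show "h x = indicator (level 1) x" "0 \<in> level 1" "splits A (level 1)"
    by (rule rigidity[OF A(2,3) le])+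
qed

lemma scaled_integral_indicator:
  assumes "\<And>x. h x = indicator C x" and [measurable]: "C \<in> sets borel"
  shows "scaled_integral A h = scaled_vol A C"
  using assms by (simp add: scaled_integral_def scaled_vol_def ennreal_indicator)

lemma block_equality:
  assumes b: "one_cover b"
    and C: "\<And>x. h x = indicator C x" "C \<in> sets borel" "convex C" "0 \<in> C"
    and split: "\<And>A. A \<in> set b \<Longrightarrow> splits A C"
  shows "(\<Prod>A\<leftarrow>b. scaled_integral A h) = scaled_integral UNIV h"
proof (rule antisym[OF scaled_integral_block_le[OF b]])
  show "scaled_integral UNIV h \<le> (\<Prod>A\<leftarrow>b. scaled_integral A h)"
    unfolding scaled_integral_indicator[OF C(1,2)]
    using scaled_vol_Union_le_prod[OF C(2-4) _ _ split, of b] b by (simp add: one_cover_def)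
qed

end

subsection \<open>The two sides of the inequality\<close>

lemma scaled_integral_divide:
  fixes g :: "real ^ 'n \<Rightarrow> real"
  assumes [measurable]: "g \<in> borel_measurable borel" and M: "0 < M"
  shows "scaled_integral A (\<lambda>x. g x / M) =
    ennreal (fact (card A) / M) * (\<integral>\<^sup>+x. ennreal (g x) \<partial>coord_lebesgue A)"
proof -
  have "(\<integral>\<^sup>+x. ennreal (g x / M) \<partial>coord_measure A) = (\<integral>\<^sup>+x. ennreal (1 / M) * ennreal (g x) \<partial>coord_measure A)"
    using M by (intro nn_integral_cong) (simp add: ennreal_mult'[symmetric])
  also have "\<dots> = ennreal (1 / M) * (\<integral>\<^sup>+x. ennreal (g x) \<partial>coord_measure A)"
    by (rule nn_integral_cmult) measurable
  finally have eq: "(\<integral>\<^sup>+x. ennreal (g x / M) \<partial>coord_measure A) =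
      ennreal (1 / M) * (\<integral>\<^sup>+x. ennreal (g x) \<partial>coord_lebesgue A)"
    unfolding nn_integral_coord_lebesgue .
  have "(fact (card A) :: ennreal) = ennreal (fact (card A))"
    by (metis ennreal_of_nat_eq_real_of_nat of_nat_fact)
  then have "(fact (card A) :: ennreal) * ennreal (1 / M) = ennreal (fact (card A) / M)"
    using M by (simp only: ennreal_mult'[symmetric] fact_ge_zero) simp
  then show ?thesis
    unfolding scaled_integral_def eq by (simp only: mult.assoc[symmetric])
qed

lemma prod_mono_ennreal:
  fixes F G :: "'a \<Rightarrow> ennreal"
  assumes "\<And>i. i \<in> I \<Longrightarrow> F i \<le> G i"
  shows "prod F I \<le> prod G I"
  using assms by (induction I rule: infinite_finite_induct) (auto intro!: mult_mono)

text \<open>The constant clears \<open>(n!) ^ s\<close> and distributes the scale: on the left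
  \<open>M ^ (m - s) / M ^ m\<close> leaves one \<open>1 / M\<close> for each of the
  \<open>s\<close> integrals, on the right each of the \<open>m\<close> factors receives
  one.\<close>

lemma normalized_sides:
  fixes g :: "real ^ 'n \<Rightarrow> real"
  assumes g: "g \<in> borel_measurable borel" and M: "0 < M" and sup: "sup_norm g = ennreal M"
    and len: "s \<le> length S"
  defines "c \<equiv> ennreal (fact CARD('n) ^ s / M ^ length S)"
  shows "c * lhs s S g = scaled_integral UNIV (\<lambda>x. g x / M) ^ s"
    and "c * rhs s S g = (\<Prod>j<length S. scaled_integral (S ! j) (\<lambda>x. g x / M))"
proof -
  let ?I = "\<integral>\<^sup>+x. ennreal (g x) \<partial>lebesgue"
  have I: "?I = (\<integral>\<^sup>+x. ennreal (g x) \<partial>coord_lebesgue UNIV)"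
    by (simp add: coord_lebesgue_eq coord_measure_UNIV)
  have "M ^ length S = M ^ s * M ^ (length S - s)" using len by (simp flip: power_add)
  then have "fact CARD('n) ^ s / M ^ length S * M ^ (length S - s) = (fact CARD('n) / M) ^ s"
    using M by (simp add: power_divide field_simps)
  then have "c * ennreal M ^ (length S - s) = ennreal (fact CARD('n) / M) ^ s"
    using M unfolding c_def by (simp add: ennreal_power ennreal_mult'[symmetric])
  then show "c * lhs s S g = scaled_integral UNIV (\<lambda>x. g x / M) ^ s"
    unfolding lhs_def sup scaled_integral_divide[OF g M] I power_mult_distrib mult.assoc[symmetric] by simp
  let ?p = "\<Prod>j<length S. fact (card (S ! j)) :: real"
  have "c * ennreal (?p / fact CARD('n) ^ s) = ennreal (?p / M ^ length S)"
    using M unfolding c_def by (subst ennreal_mult'[symmetric]) auto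
  also have "?p / M ^ length S = (\<Prod>j<length S. fact (card (S ! j)) / M)"
    by (simp add: prod_dividef)
  also have "ennreal \<dots> = (\<Prod>j<length S. ennreal (fact (card (S ! j)) / M))"
    using M by (intro prod_ennreal[symmetric]) auto
  finally show "c * rhs s S g = (\<Prod>j<length S. scaled_integral (S ! j) (\<lambda>x. g x / M))"
    unfolding rhs_def scaled_integral_divide[OF g M] prod.distrib mult.assoc[symmetric] by simp
qed

section \<open>The normalized inequality and its equality case\<close>

context unit_log_concave
begin

lemma prod_scaled_integral_le:
  assumes "one_reducible s S UNIV"
  shows "(\<Prod>j<length S. scaled_integral (S ! j) h) \<le> scaled_integral UNIV h ^ s"
proof -
  obtain B where B: "length B = s" "\<And>b. b \<in> set B \<Longrightarrow> one_cover b"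
    and prod: "(\<Prod>j<length S. scaled_integral (S ! j) h) = (\<Prod>b\<leftarrow>B. \<Prod>A\<leftarrow>b. scaled_integral A h)"
    using one_reducible_blocks[OF assms, where F="\<lambda>A. scaled_integral A h"] by blast
  have "(\<Prod>b\<leftarrow>B. \<Prod>A\<leftarrow>b. scaled_integral A h) \<le> scaled_integral UNIV h ^ length (map (\<lambda>b. \<Prod>A\<leftarrow>b. scaled_integral A h) B)"
    using scaled_integral_block_le[OF B(2)] by (intro prod_list_le_power) auto
  then show ?thesis using B(1) prod by simp
qed

text \<open>Each block product is at most the positive finite number
  \<open>scaled_integral UNIV h\<close>, so equality over \<open>s\<close> blocks is equality in
  each. Rigidity handles the nontrivial members; \<open>{}\<close> and \<open>UNIV\<close> split any
  set containing \<open>0\<close>.\<close>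

lemma equality_imp_indicator:
  assumes red: "one_reducible s S UNIV"
    and eq: "(\<Prod>j<length S. scaled_integral (S ! j) h) = scaled_integral UNIV h ^ s"
    and ne: "\<exists>A\<in>set S. A \<noteq> {} \<and> A \<noteq> UNIV"
  shows "\<forall>x. h x = indicator (level 1) x" "0 \<in> level 1" "\<forall>A\<in>set S. splits A (level 1)"
proof -
  obtain B where B: "length B = s" "\<And>b. b \<in> set B \<Longrightarrow> one_cover b" and S: "set S = (\<Union>b\<in>set B. set b)"
    and prod: "(\<Prod>j<length S. scaled_integral (S ! j) h) = (\<Prod>b\<leftarrow>B. \<Prod>A\<leftarrow>b. scaled_integral A h)"
    using one_reducible_blocks[OF red, where F="\<lambda>A. scaled_integral A h"] by blast
  have block: "(\<Prod>A\<leftarrow>b. scaled_integral A h) = scaled_integral UNIV h" if "b \<in> set B" for b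
  proof (rule prod_list_eq_power)
    show "prod_list (map (\<lambda>b. \<Prod>A\<leftarrow>b. scaled_integral A h) B) =
        scaled_integral UNIV h ^ length (map (\<lambda>b. \<Prod>A\<leftarrow>b. scaled_integral A h) B)"
      using eq prod B(1) by simp
    show "x \<le> scaled_integral UNIV h" if "x \<in> set (map (\<lambda>b. \<Prod>A\<leftarrow>b. scaled_integral A h) B)" for x
      using that scaled_integral_block_le[OF B(2)] by auto
  qed (use that scaled_integral_UNIV_pos scaled_integral_UNIV_finite in auto)
  have rigid: "(\<forall>x. h x = indicator (level 1) x) \<and> 0 \<in> level 1 \<and> splits A (level 1)"
    if A: "A \<in> set S" "A \<noteq> {}" "A \<noteq> UNIV" for A
  proof -
    obtain b where b: "b \<in> set B" "A \<in> set b" using A(1) S by blast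
    note R = rigidity_of_block[OF B(2)[OF b(1)] block[OF b(1)] b(2) A(2,3)]
    show ?thesis using R(1) R(2) R(3) by blast
  qed
  obtain A0 where A0: "A0 \<in> set S" "A0 \<noteq> {}" "A0 \<noteq> UNIV" using ne by blast
  show "\<forall>x. h x = indicator (level 1) x" and zero: "0 \<in> level 1" using rigid[OF A0] by blast+
  show "\<forall>A\<in>set S. splits A (level 1)"
    using rigid splits_empty[OF zero] splits_UNIV[OF zero] by blast
qed

lemma indicator_imp_equality:
  assumes red: "one_reducible s S UNIV"
    and C: "\<And>x. h x = indicator C x" "C \<in> sets borel" "convex C" "0 \<in> C"
    and split: "\<And>A. A \<in> set S \<Longrightarrow> splits A C"
  shows "(\<Prod>j<length S. scaled_integral (S ! j) h) = scaled_integral UNIV h ^ s"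
proof -
  obtain B where B: "length B = s" "\<And>b. b \<in> set B \<Longrightarrow> one_cover b" and S: "set S = (\<Union>b\<in>set B. set b)"
    and prod: "(\<Prod>j<length S. scaled_integral (S ! j) h) = (\<Prod>b\<leftarrow>B. \<Prod>A\<leftarrow>b. scaled_integral A h)"
    using one_reducible_blocks[OF red, where F="\<lambda>A. scaled_integral A h"] by blast
  have "(\<Prod>A\<leftarrow>b. scaled_integral A h) = scaled_integral UNIV h" if "b \<in> set B" for b
    by (rule block_equality[OF B(2)[OF that] C split]) (use S that in blast)
  then have "map (\<lambda>b. \<Prod>A\<leftarrow>b. scaled_integral A h) B = replicate (length B) (scaled_integral UNIV h)"
    by (simp add: map_replicate_const[symmetric] del: map_replicate_const)
  then show ?thesis unfolding prod B(1)[symmetric] by simp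
qed

lemma extremal_hull:
  assumes h: "\<And>x. h x = indicator (level 1) x" and zero: "0 \<in> level 1"
    and split: "\<And>A. A \<in> set S \<Longrightarrow> splits A (level 1)"
  shows "\<exists>K. (\<forall>X\<in>induced_cover S UNIV. convex_body_in X (K X) \<and> 0 \<in> K X) \<and>
    convex hull (\<Union>X\<in>induced_cover S UNIV. K X) = level 1"
proof (intro exI conjI ballI)
  have "1 \<le> h x" if "0 < h x" for x
  proof (rule ccontr)
    assume "\<not> 1 \<le> h x"
    then have "indicator (level 1) x = (0 :: real)" by (simp add: indicator_def)
    with h[of x] that show False by linarith
  qed
  then have "supp h = level 1" by (auto simp: supp_def intro: less_le_trans[OF zero_less_one])
  then have int: "interior (level 1) \<noteq> {}" using interior_supp by simp
  have comp: "compact (level 1)" by (rule compact_level) simp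
  show "convex hull (\<Union>X\<in>induced_cover S UNIV. level 1 \<inter> coord_subspace X) = level 1"
    by (rule hull_of_cells[OF comp convex_level split])
  show "convex_body_in X (level 1 \<inter> coord_subspace X)" if "X \<in> induced_cover S UNIV" for X
    by (rule convex_body_in_section[OF comp convex_level zero int split that])
  show "0 \<in> level 1 \<inter> coord_subspace X" for X using zero by simp
qed

end

section \<open>Supremum and normalization of the regularized function\<close>

context solid_log_concave
begin

definition height :: real where
  "height = (SUP x. f x)"

lemma bdd_above_f: "bdd_above (range f)"
  using bounded_above by (auto simp: bdd_above_def)

lemma le_height: "f x \<le> height"
  unfolding height_def by (rule cSUP_upper[OF UNIV_I bdd_above_f])

lemma height_pos: "0 < height"
proof -
  obtain p where "p \<in> supp_int" using int by blast
  then show ?thesis using pos_f[of p] le_height[of p] by simp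
qed

lemma sup_norm_f: "sup_norm f = ennreal height"
proof (rule antisym)
  show le: "sup_norm f \<le> ennreal height"
    unfolding sup_norm_def by (intro SUP_least ennreal_leI le_height)
  then have fin: "sup_norm f < top" using ennreal_less_top le_less_trans by blast
  have "f x \<le> enn2real (sup_norm f)" for x
  proof -
    have "ennreal (f x) \<le> sup_norm f" unfolding sup_norm_def by (rule SUP_upper) simp
    also have "\<dots> = ennreal (enn2real (sup_norm f))" using fin by simp
    finally show ?thesis by (simp add: ennreal_le_iff)
  qed
  then have "height \<le> enn2real (sup_norm f)" unfolding height_def by (intro cSUP_least) auto
  then have "ennreal height \<le> ennreal (enn2real (sup_norm f))" by (rule ennreal_leI)
  then show "ennreal height \<le> sup_norm f" using fin by simp
qed

lemma sup_norm_boundary_reg: "sup_norm (boundary_reg f) = ennreal height"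
proof (rule antisym)
  show "sup_norm (boundary_reg f) \<le> ennreal height"
    unfolding sup_norm_def by (intro SUP_least ennreal_leI boundary_reg_le le_height)
  show "ennreal height \<le> sup_norm (boundary_reg f)"
    unfolding sup_norm_f[symmetric] sup_norm_def by (intro SUP_mono') (rule ennreal_leI[OF le_boundary_reg])
qed

lemma measurable_boundary_reg [measurable]: "boundary_reg f \<in> borel_measurable borel"
  by (rule borel_measurable_of_closed_levels[OF boundary_reg_nonneg closed_boundary_reg_level])

lemma nn_integral_boundary_reg: "(\<integral>\<^sup>+x. ennreal (boundary_reg f x) \<partial>lebesgue) = (\<integral>\<^sup>+x. ennreal (f x) \<partial>lebesgue)"
  by (rule nn_integral_cong_AE) (use boundary_reg_AE_eq in eventually_elim, simp)

lemma unit_log_concave_normalized: "unit_log_concave (\<lambda>x. boundary_reg f x / height)"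
proof
  show "log_concave (\<lambda>x. boundary_reg f x / height)"
    by (rule log_concave_divide[OF log_concave_boundary_reg height_pos])
  show "boundary_reg f x / height \<le> 1" for x
    using boundary_reg_le[OF le_height] height_pos by simp
  show "closed {x. t \<le> boundary_reg f x / height}" if "0 < t" for t
    using closed_boundary_reg_level[of "t * height"] that height_pos by (simp add: pos_le_divide_eq)
  show "(\<integral>\<^sup>+x. ennreal (boundary_reg f x / height) \<partial>lborel) < top"
  proof -
    have "(\<integral>\<^sup>+x. ennreal (boundary_reg f x / height) \<partial>lborel) =
        (\<integral>\<^sup>+x. ennreal (1 / height) * ennreal (boundary_reg f x) \<partial>lborel)"
      using height_pos by (intro nn_integral_cong) (simp add: ennreal_mult'[symmetric])
    also have "\<dots> = ennreal (1 / height) * (\<integral>\<^sup>+x. ennreal (f x) \<partial>lebesgue)"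
      by (subst nn_integral_cmult) (auto simp: nn_integral_completion nn_integral_boundary_reg[unfolded nn_integral_completion])
    also have "\<dots> < top" using nn_integral_finite by (auto simp: ennreal_mult_less_top)
    finally show ?thesis .
  qed
  show "interior (supp (\<lambda>x. boundary_reg f x / height)) \<noteq> {}"
  proof -
    have "supp f \<subseteq> supp (\<lambda>x. boundary_reg f x / height)"
      using le_boundary_reg height_pos by (auto simp: supp_def intro!: divide_pos_pos intro: less_le_trans)
    then show ?thesis using int interior_mono by blast
  qed
  show "\<exists>x. e < boundary_reg f x / height" if "e < 1" for e
  proof -
    have "e * height < height" using that height_pos by simp
    then obtain x where "e * height < f x"
      unfolding height_def using less_cSUP_iff[OF UNIV_not_empty bdd_above_f] by blast
    then show ?thesis
      using le_boundary_reg[of x] height_pos by (intro exI[of _ x]) (simp add: pos_less_divide_eq)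
  qed
qed

lemma lhs_boundary_reg: "lhs s S (boundary_reg f) = lhs s S f"
  unfolding lhs_def sup_norm_f sup_norm_boundary_reg nn_integral_boundary_reg ..

text \<open>A section can lie in the boundary of the support, which is null in the whole space but
  perhaps not in the subspace. Regularizing may thus enlarge \<open>rhs\<close> while
  \<open>lhs\<close> stays fixed, so the inequality for the regularized function is the stronger
  one.\<close>

lemma rhs_boundary_reg_ge: "rhs s S f \<le> rhs s S (boundary_reg f)"
  unfolding rhs_def
  by (intro mult_left_mono prod_mono_ennreal nn_integral_mono ennreal_leI le_boundary_reg) auto

end

text \<open>Passing from equality to the extremal form takes at least two cells: for
  \<open>S = [UNIV]\<close> and \<open>s = 1\<close> both sides are the integral of the function, so
  equality always holds.\<close>

theorem theorem1p1:
  fixes f :: "real ^ 'n \<Rightarrow> real" and S :: "'n set list" and s :: nat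
  assumes "f \<in> integrable_log_concave"
    and "is_cover s S UNIV"
    and "one_reducible s S UNIV"
  shows "lhs s S f \<ge> rhs s S f \<and>
    (interior (supp f) \<noteq> {} \<longrightarrow>
      (2 \<le> card (induced_cover S UNIV) \<longrightarrow>
         (lhs s S (boundary_reg f) = rhs s S (boundary_reg f) \<longleftrightarrow> extremal S (boundary_reg f))) \<and>
      (extremal S (boundary_reg f) \<longrightarrow> lhs s S (boundary_reg f) = rhs s S (boundary_reg f)))"
proof (cases "interior (supp f) = {}")
  case True
  have "0 < s" using assms(2) unfolding is_cover_def by blast
  then show ?thesis using rhs_eq_0[OF assms(1) True _ assms(3)] True by simp
next
  case False
  interpret solid_log_concave f by standard (rule assms(1), rule False)
  let ?g = "boundary_reg f"
  define h where "h = (\<lambda>x. ?g x / height)"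
  interpret h: unit_log_concave h unfolding h_def by (rule unit_log_concave_normalized)
  have len: "s \<le> length S" using one_reducible_blocks[OF assms(3), where F="\<lambda>_. 1"] by blast
  define c where "c = ennreal (fact CARD('n) ^ s / height ^ length S)"
  have c: "0 < c" "c < top" using height_pos by (simp_all add: c_def)
  have L: "c * lhs s S ?g = scaled_integral UNIV h ^ s"
    and R: "c * rhs s S ?g = (\<Prod>j<length S. scaled_integral (S ! j) h)"
    unfolding c_def h_def
    by (rule normalized_sides[OF measurable_boundary_reg height_pos sup_norm_boundary_reg len])+
  have "c * rhs s S ?g \<le> c * lhs s S ?g"
    unfolding L R by (rule h.prod_scaled_integral_le[OF assms(3)])
  then have "rhs s S ?g \<le> lhs s S ?g"
    using c by (simp add: ennreal_mult_le_mult_iff)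
  then have ineq: "rhs s S f \<le> lhs s S f"
    using rhs_boundary_reg_ge[of s S] unfolding lhs_boundary_reg by (rule order_trans[rotated])
  have eq_iff: "lhs s S ?g = rhs s S ?g \<longleftrightarrow>
      (\<Prod>j<length S. scaled_integral (S ! j) h) = scaled_integral UNIV h ^ s"
    using c unfolding L[symmetric] R[symmetric] by (auto simp: ennreal_mult_cancel_left)
  have g_h: "ennreal (?g x) = sup_norm ?g * ennreal (h x)" for x
    using height_pos unfolding sup_norm_boundary_reg h_def by (simp add: ennreal_mult'[symmetric])
  have ext: "lhs s S ?g = rhs s S ?g" if ex: "extremal S ?g"
  proof -
    obtain K where K0: "(\<forall>X\<in>induced_cover S UNIV. convex_body_in X (K X) \<and> 0 \<in> K X) \<and>
      (\<forall>x. ennreal (?g x) = sup_norm ?g * indicator (convex hull (\<Union>X\<in>induced_cover S UNIV. K X)) x)"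
      using ex unfolding extremal_def by (rule exE)
    have K: "convex_body_in X (K X) \<and> 0 \<in> K X" if "X \<in> induced_cover S UNIV" for X
      using K0 that by blast
    have gK: "ennreal (?g x) = sup_norm ?g * indicator (convex hull (\<Union>X\<in>induced_cover S UNIV. K X)) x" for x
      using K0 by blast
    let ?C = "convex hull (\<Union>X\<in>induced_cover S UNIV. K X)"
    have "h x = indicator ?C x" for x
    proof -
      have "ennreal height * ennreal (h x) = ennreal height * indicator ?C x"
        using gK[of x] g_h[of x] unfolding sup_norm_boundary_reg by simp
      then have "ennreal (h x) = ennreal (indicator ?C x)"
        using height_pos by (simp add: ennreal_mult_cancel_left ennreal_indicator)
      then show ?thesis using h.nonneg[of x] by simp
    qed
    moreover have "?C \<in> sets borel" using compact_hull_of_bodies[of S K] K by (intro borel_compact) auto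
    moreover have "0 \<in> ?C"
    proof -
      obtain X where "X \<in> induced_cover S UNIV" using induced_cover_nonempty by blast
      with K show ?thesis by (intro hull_inc) auto
    qed
    moreover have "splits A ?C" if "A \<in> set S" for A
      using splits_hull_of_bodies[OF K that] .
    ultimately show ?thesis
      unfolding eq_iff using h.indicator_imp_equality[OF assms(3) _ _ convex_convex_hull] by blast
  qed
  have "extremal S ?g" if card: "2 \<le> card (induced_cover S UNIV)" and eq: "lhs s S ?g = rhs s S ?g"
  proof -
    note E = h.equality_imp_indicator[OF assms(3) eq[unfolded eq_iff] ex_nontrivial_member[OF card]]
    obtain K where K: "\<forall>X\<in>induced_cover S UNIV. convex_body_in X (K X) \<and> 0 \<in> K X"
      and hull: "convex hull (\<Union>X\<in>induced_cover S UNIV. K X) = h.level 1"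
      using h.extremal_hull[of S] E by blast
    have "ennreal (?g x) = sup_norm ?g * indicator (h.level 1) x" for x
      unfolding g_h E(1)[rule_format, of x] ennreal_indicator ..
    with K hull show ?thesis unfolding extremal_def by (intro exI[of _ K]) simp
  qed
  with ineq ext show ?thesis by blast
qed

end
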